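(* Let $N\ge1$, $\omega\in\mathbb{R}$ and $\gamma>1$. Then the quantity $d(\omega)$ is given by $$d(\omega)=\frac12\|\phi_\omega\|_{L^2}^2=\frac12\,\pi^{\frac N2}\gamma^{-\frac N2}e^{\omega+\gamma N},$$ where $\phi_\omega(x)=e^{\frac{\omega+\gamma N}{2}}e^{-\frac{\gamma}{2}|x|^2}$ for $x\in\mathbb{R}^N$.
   Context: All functions are complex valued. $\mathrm{Log}$ is the natural logarithm, with $|z|^2\mathrm{Log}|z|^2=0$ at $z=0$. $\Sigma(\mathbb{R}^N)=\{u\in H^1(\mathbb{R}^N): |x|u\in L^2(\mathbb{R}^N)\}$. For $u\in\Sigma(\mathbb{R}^N)$ define $$S_\omega(u)=\tfrac12\|\nabla u\|_{L^2}^2+\tfrac{\gamma(\gamma-1)}{2}\|xu\|_{L^2}^2+\tfrac{\omega+1}{2}\|u\|_{L^2}^2-\tfrac12\int_{\mathbb{R}^N}|u|^2\mathrm{Log}|u|^2dx,$$ $$I_\omega(u)=\|\nabla u\|_{L^2}^2+\gamma(\gamma-1)\|xu\|_{L^2}^2+\omega\|u\|_{L^2}^2-\int_{\mathbb{R}^N}|u|^2\mathrm{Log}|u|^2dx,$$ $$d(\omega)=\inf\{S_\omega(u): u\in\Sigma(\mathbb{R}^N)\setminus\{0\},\ I_\omega(u)=0\}=\tfrac12\inf\{\|u\|_{L^2}^2: u\in\Sigma(\mathbb{R}^N)\setminus\{0\},\ I_\omega(u)=0\}.$$ *)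

theory Defs
  imports "HOL-Analysis.Analysis"
begin

text \<open>
  Elements of \<open>L\<^sup>2(\<real>\<^sup>N)\<close> are represented by Borel functions; every class of Lebesgue measurable
  functions modulo equality almost everywhere has such a representative.
\<close>

definition L2 :: "('a::euclidean_space \<Rightarrow> 'b::euclidean_space) \<Rightarrow> bool" where
  "L2 f \<longleftrightarrow> f \<in> borel_measurable lborel \<and> integrable lborel (\<lambda>x. (norm (f x))\<^sup>2)"

definition L2_norm :: "('a::euclidean_space \<Rightarrow> 'b::euclidean_space) \<Rightarrow> real" where
  "L2_norm f = sqrt (\<integral>x. (norm (f x))\<^sup>2 \<partial>lborel)"

definition partial_deriv :: "'n \<Rightarrow> (real^'n::finite \<Rightarrow> real) \<Rightarrow> real^'n \<Rightarrow> real" where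
  "partial_deriv i \<phi> x = frechet_derivative \<phi> (at x) (axis i 1)"

primrec Ck :: "nat \<Rightarrow> (real^'n::finite \<Rightarrow> real) \<Rightarrow> bool" where
  "Ck 0 \<phi> \<longleftrightarrow> continuous_on UNIV \<phi>"
| "Ck (Suc k) \<phi> \<longleftrightarrow> (\<forall>x. \<phi> differentiable (at x)) \<and> (\<forall>i. Ck k (partial_deriv i \<phi>))"

definition test_function :: "(real^'n::finite \<Rightarrow> real) \<Rightarrow> bool" where
  "test_function \<phi> \<longleftrightarrow> (\<forall>k. Ck k \<phi>) \<and> compact (closure {x. \<phi> x \<noteq> 0})"

text \<open>
  By linearity, real-valued test functions define the same weak gradient as complex-valued ones.
  For \<open>u\<close> and \<open>g\<close> square integrable, both integrands below are integrable.
\<close>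

definition has_weak_gradient ::
  "(real^'n::finite \<Rightarrow> complex) \<Rightarrow> (real^'n \<Rightarrow> complex^'n) \<Rightarrow> bool" where
  "has_weak_gradient u g \<longleftrightarrow> (\<forall>\<phi> i. test_function \<phi> \<longrightarrow>
     (\<integral>x. partial_deriv i \<phi> x *\<^sub>R u x \<partial>lborel) = - (\<integral>x. \<phi> x *\<^sub>R (g x $ i) \<partial>lborel))"

definition H1 :: "(real^'n::finite \<Rightarrow> complex) \<Rightarrow> bool" where
  "H1 u \<longleftrightarrow> L2 u \<and> (\<exists>g. L2 g \<and> has_weak_gradient u g)"

text \<open>Weak gradients are unique up to null sets, so the choice does not affect norms.\<close>

definition weak_gradient :: "(real^'n::finite \<Rightarrow> complex) \<Rightarrow> real^'n \<Rightarrow> complex^'n" where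
  "weak_gradient u = (SOME g. L2 g \<and> has_weak_gradient u g)"

definition Sigma_space :: "(real^'n::finite \<Rightarrow> complex) set" where
  "Sigma_space = {u. H1 u \<and> L2 (\<lambda>x. norm x *\<^sub>R u x)}"

text \<open>
  The convention \<open>|z|\<^sup>2 Log |z|\<^sup>2 = 0\<close> at \<open>z = 0\<close> holds because of the factor \<open>0\<close>.
  For \<open>u\<close> in \<^const>\<open>Sigma_space\<close> the integrand is integrable.
\<close>

definition log_integral :: "(real^'n::finite \<Rightarrow> complex) \<Rightarrow> real" where
  "log_integral u = (\<integral>x. (cmod (u x))\<^sup>2 * ln ((cmod (u x))\<^sup>2) \<partial>lborel)"

definition S_functional :: "real \<Rightarrow> real \<Rightarrow> (real^'n::finite \<Rightarrow> complex) \<Rightarrow> real" where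
  "S_functional \<gamma> \<omega> u =
     1/2 * (L2_norm (weak_gradient u))\<^sup>2
     + \<gamma> * (\<gamma> - 1) / 2 * (L2_norm (\<lambda>x. norm x *\<^sub>R u x))\<^sup>2
     + (\<omega> + 1) / 2 * (L2_norm u)\<^sup>2
     - 1/2 * log_integral u"

definition I_functional :: "real \<Rightarrow> real \<Rightarrow> (real^'n::finite \<Rightarrow> complex) \<Rightarrow> real" where
  "I_functional \<gamma> \<omega> u =
     (L2_norm (weak_gradient u))\<^sup>2
     + \<gamma> * (\<gamma> - 1) * (L2_norm (\<lambda>x. norm x *\<^sub>R u x))\<^sup>2
     + \<omega> * (L2_norm u)\<^sup>2
     - log_integral u"

definition nehari_set :: "real \<Rightarrow> real \<Rightarrow> (real^'n::finite \<Rightarrow> complex) set" where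
  "nehari_set \<gamma> \<omega> =
     {u \<in> Sigma_space. \<not> (AE x in lborel. u x = 0) \<and> I_functional \<gamma> \<omega> u = 0}"

text \<open>
  The infimum is taken in the extended reals, where it is meaningful without knowing beforehand
  that the set is nonempty and bounded below. The type argument carries the space \<open>\<real>\<^sup>N\<close>.
\<close>

definition d_level :: "'n::finite itself \<Rightarrow> real \<Rightarrow> real \<Rightarrow> ereal" where
  "d_level (T :: 'n itself) \<gamma> \<omega> =
     (INF u \<in> (nehari_set \<gamma> \<omega> :: (real^'n \<Rightarrow> complex) set). ereal (S_functional \<gamma> \<omega> u))"

lemma S_functional_eq:
  "S_functional \<gamma> \<omega> u = 1/2 * I_functional \<gamma> \<omega> u + 1/2 * (L2_norm u)\<^sup>2"
  by (simp add: S_functional_def I_functional_def field_simps)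

lemma d_level_eq_half_Inf_mass:
  "d_level TYPE('n::finite) \<gamma> \<omega> =
     ereal (1/2) * (INF u \<in> (nehari_set \<gamma> \<omega> :: (real^'n \<Rightarrow> complex) set). ereal ((L2_norm u)\<^sup>2))"
proof -
  let ?A = "nehari_set \<gamma> \<omega> :: (real^'n \<Rightarrow> complex) set"
  have "d_level TYPE('n) \<gamma> \<omega> = (INF u \<in> ?A. ereal (1/2) * ereal ((L2_norm u)\<^sup>2))"
    unfolding d_level_def
    by (intro INF_cong refl) (simp add: S_functional_eq nehari_set_def)
  also have "\<dots> = Inf ((\<lambda>z. ereal (1/2) * z) ` (\<lambda>u. ereal ((L2_norm u)\<^sup>2)) ` ?A)"
    by (simp add: image_image)
  also have "\<dots> = ereal (1/2) * (INF u \<in> ?A. ereal ((L2_norm u)\<^sup>2))"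
    using ereal_Inf_cmult[of "1/2" "\<lambda>z. z \<in> (\<lambda>u. ereal ((L2_norm u)\<^sup>2)) ` ?A"]
    by (simp add: setcompr_eq_image Collect_mem_eq)
  finally show ?thesis .
qed

definition gaussian_state :: "real \<Rightarrow> real \<Rightarrow> real^'n::finite \<Rightarrow> complex" where
  "gaussian_state \<gamma> \<omega> x =
     complex_of_real (exp ((\<omega> + \<gamma> * real CARD('n)) / 2) * exp (- (\<gamma> / 2) * (norm x)\<^sup>2))"

end

theory Submission
  imports Defs "HOL-Probability.Distributions"
begin

text \<open>
  On the Nehari set \<open>S\<close> is half the squared norm \<open>m = \<parallel>u\<parallel>\<^sup>2\<close>, so the claim is a sharp lower bound for
  \<open>m\<close> together with its attainment by the Gaussian \<open>\<phi>\<close>. Write \<open>f = |u|\<^sup>2\<close> and let \<open>G\<close> be the product of the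
  densities \<open>\<surd>(\<gamma>/\<pi>) exp (- \<gamma> s\<^sup>2)\<close>. Two sharp inequalities, both equalities for \<open>\<phi>\<close>, are combined:

  \<^item> the Gaussian logarithmic Sobolev inequality
    \<open>\<integral> f ln (f / G) \<le> m ln m + \<parallel>\<nabla>u\<parallel>\<^sup>2 / \<gamma> + \<gamma> \<parallel>xu\<parallel>\<^sup>2 - N m\<close>,
  \<^item> the ground state energy of the harmonic oscillator, \<open>N m \<le> \<parallel>\<nabla>u\<parallel>\<^sup>2 / \<gamma> + \<gamma> \<parallel>xu\<parallel>\<^sup>2\<close>.

  The term \<open>- f ln G\<close> contributes \<open>\<gamma> \<parallel>xu\<parallel>\<^sup>2\<close> on the left of the first inequality. After cancelling it, adding
  \<open>\<gamma> - 1\<close> times the second inequality produces exactly \<open>\<parallel>\<nabla>u\<parallel>\<^sup>2 + \<gamma>(\<gamma> - 1) \<parallel>xu\<parallel>\<^sup>2\<close> on the right, the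
  gradient and moment part of \<open>I\<close>, and \<open>I u = 0\<close> turns the sum into a lower bound for \<open>ln m\<close>
  (\<open>nehari_mass_lower_bound\<close>).

  Both inequalities come from one principle (\<open>weak_integration_by_parts_le\<close>): for bounded \<open>T\<close> with
  bounded derivative \<open>\<partial>\<^sub>iT\<close>,
  \<open>\<integral> \<partial>\<^sub>iT f \<le> t \<parallel>\<partial>\<^sub>iu\<parallel>\<^sup>2 + (1/t) \<integral> T\<^sup>2 f\<close>.
  Formally this is \<open>\<parallel>\<surd>t \<partial>\<^sub>iu + T u / \<surd>t\<parallel>\<^sup>2 \<ge> 0\<close>. For a merely weakly differentiable \<open>u\<close> it is obtained from
  difference quotients, which satisfy \<open>\<parallel>u(\<sqdot> + h e\<^sub>i) - u\<parallel> \<le> h \<parallel>\<partial>\<^sub>iu\<parallel>\<close> (\<open>L2_difference_le\<close>).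

  The oscillator bound takes \<open>T\<close> close to \<open>x\<^sub>i\<close>. For the logarithmic Sobolev inequality, \<open>T\<close> is the
  monotone map that transports a density of the form \<open>exp V G\<close> in the \<open>i\<close>-th coordinate to a Gaussian:
  the change of variables formula expresses \<open>V\<close> through \<open>ln \<partial>\<^sub>iT\<close> and \<open>T\<^sup>2\<close>, and \<open>ln z \<le> z - 1\<close> makes the
  estimate linear in \<open>\<partial>\<^sub>iT\<close>. This handles one coordinate. Replacing \<open>V\<close> by the logarithm of
  the Gaussian mean of \<open>exp V\<close> in that coordinate and repeating the step for every coordinate
  reaches the constant \<open>ln \<integral> exp V G\<close> (\<open>iterated_coordinate_log_sobolev\<close>). The result is the dual form of the
  inequality, a bound for \<open>\<integral> V f\<close> in terms of \<open>\<integral> exp V G\<close> for every bounded \<open>V\<close>; inserting truncations of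
  \<open>ln (f / G)\<close> gives the entropy form and, at the same time, the integrability of \<open>f ln f\<close>
  (\<open>entropy_le_of_variational_bound\<close>).
\<close>

section \<open>Smooth functions of compact support\<close>

text \<open>
  The family \<open>s\<^sup>-\<^sup>j exp (- 1/s)\<close>, extended by \<open>0\<close> to \<open>s \<le> 0\<close>. Its span is closed under differentiation,
  so smoothness of the standard flat function follows by induction on the order.
\<close>

definition flat_exp :: "nat \<Rightarrow> real \<Rightarrow> real" where
  "flat_exp j s = (if s > 0 then inverse s ^ j * exp (- inverse s) else 0)"

lemma flat_exp_nonneg: "flat_exp j s \<ge> 0"
  by (simp add: flat_exp_def)

lemma flat_exp_div_tendsto_0: "((\<lambda>s. flat_exp j s / s) \<longlongrightarrow> 0) (at 0)"
proof -
  have "((\<lambda>s::real. inverse s ^ Suc j / exp (inverse s)) \<longlongrightarrow> 0) (at_right 0)"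
    by (rule filterlim_compose[OF tendsto_power_div_exp_0 filterlim_inverse_at_top_right])
  moreover have "eventually (\<lambda>s::real. inverse s ^ Suc j / exp (inverse s) = flat_exp j s / s) (at_right 0)"
    by (auto simp: eventually_at_filter flat_exp_def exp_minus field_simps)
  ultimately have R: "((\<lambda>s. flat_exp j s / s) \<longlongrightarrow> 0) (at_right 0)"
    by (rule Lim_transform_eventually)
  have "eventually (\<lambda>s::real. 0 = flat_exp j s / s) (at_left 0)"
    by (auto simp: eventually_at_filter flat_exp_def)
  then have L: "((\<lambda>s. flat_exp j s / s) \<longlongrightarrow> 0) (at_left 0)"
    using Lim_transform_eventually tendsto_const by fast
  show ?thesis using L R by (simp add: filterlim_split_at)
qed

lemma has_real_derivative_flat_exp:
  "(flat_exp j has_real_derivative (flat_exp (Suc (Suc j)) s - real j * flat_exp (Suc j) s)) (at s)"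
proof -
  consider "s > 0" | "s < 0" | "s = 0" by linarith
  then show ?thesis
  proof cases
    case 1
    have "((\<lambda>s. inverse s ^ j * exp (- inverse s)) has_real_derivative
        (flat_exp (Suc (Suc j)) s - real j * flat_exp (Suc j) s)) (at s)"
    proof (cases j)
      case (Suc l)
      have "((\<lambda>s. inverse s ^ Suc l) has_real_derivative
          (real (Suc l) * inverse s ^ l * (- (inverse s ^ 2)))) (at s)"
        using DERIV_power[OF DERIV_inverse, of s "Suc l"] 1 by (simp add: mult_ac numeral_2_eq_2)
      moreover have "((\<lambda>s. exp (- inverse s)) has_real_derivative exp (- inverse s) * inverse s ^ 2) (at s)"
        using 1 by (auto intro!: derivative_eq_intros simp: power2_eq_square)
      ultimately have "((\<lambda>s. inverse s ^ Suc l * exp (- inverse s)) has_real_derivative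
          (real (Suc l) * inverse s ^ l * (- (inverse s ^ 2))) * exp (- inverse s)
          + exp (- inverse s) * inverse s ^ 2 * inverse s ^ Suc l) (at s)"
        by (rule DERIV_mult)
      then show ?thesis
        using 1 Suc by (simp add: flat_exp_def algebra_simps power2_eq_square)
    qed (use 1 in \<open>auto intro!: derivative_eq_intros simp: flat_exp_def power2_eq_square\<close>)
    then show ?thesis
      by (rule has_field_derivative_transform_within_open[where S="{0<..}"])
         (use 1 in \<open>auto simp: flat_exp_def\<close>)
  next
    case 2
    have "((\<lambda>s. 0) has_real_derivative (flat_exp (Suc (Suc j)) s - real j * flat_exp (Suc j) s)) (at s)"
      using 2 by (simp add: flat_exp_def)
    then show ?thesis
      by (rule has_field_derivative_transform_within_open[where S="{..<0}"])
         (use 2 in \<open>auto simp: flat_exp_def\<close>)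
  next
    case 3
    show ?thesis unfolding 3 has_field_derivative_iff
      using flat_exp_div_tendsto_0[of j] by (simp add: flat_exp_def)
  qed
qed

lemma partial_deriv_eqI:
  "(f has_derivative f') (at x) \<Longrightarrow> partial_deriv i f x = f' (axis i 1)"
  unfolding partial_deriv_def using frechet_derivative_at by metis

lemma Ck_Suc_imp: "Ck (Suc k) f \<Longrightarrow> Ck k f"
proof (induction k arbitrary: f)
  case 0
  then show ?case
    by (auto intro!: continuous_at_imp_continuous_on differentiable_imp_continuous_within)
next
  case (Suc k)
  then show ?case by (metis Ck.simps(2))
qed

lemma Ck_const: "Ck k (\<lambda>x. c)"
proof (induction k arbitrary: c)
  case (Suc k)
  have "partial_deriv i (\<lambda>x. c) = (\<lambda>x. 0)" for i :: 'a
    by (rule ext, subst partial_deriv_eqI[OF has_derivative_const]) simp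
  then show ?case using Suc by simp
qed simp

lemma has_derivative_frechet: "f differentiable (at x) \<Longrightarrow> (f has_derivative frechet_derivative f (at x)) (at x)"
  by (simp add: frechet_derivative_works)

lemma Ck_add: "Ck k f \<Longrightarrow> Ck k g \<Longrightarrow> Ck k (\<lambda>x. f x + g x)"
proof (induction k arbitrary: f g)
  case 0
  then show ?case by (simp add: continuous_on_add)
next
  case (Suc k)
  have "partial_deriv i (\<lambda>x. f x + g x) = (\<lambda>x. partial_deriv i f x + partial_deriv i g x)" for i
    using Suc.prems
    by (intro ext, subst partial_deriv_eqI[OF has_derivative_add[OF has_derivative_frechet has_derivative_frechet]])
       (auto simp: partial_deriv_def)
  with Suc show ?case by auto
qed

lemma Ck_mult: "Ck k f \<Longrightarrow> Ck k g \<Longrightarrow> Ck k (\<lambda>x. f x * g x)"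
proof (induction k arbitrary: f g)
  case 0
  then show ?case by (simp add: continuous_on_mult)
next
  case (Suc k)
  have "partial_deriv i (\<lambda>x. f x * g x) = (\<lambda>x. f x * partial_deriv i g x + partial_deriv i f x * g x)" for i
    using Suc.prems
    by (intro ext, subst partial_deriv_eqI[OF has_derivative_mult[OF has_derivative_frechet has_derivative_frechet]])
       (auto simp: partial_deriv_def)
  then show ?case
    using Suc.prems by (auto intro!: Ck_add Suc.IH Ck_Suc_imp[OF Suc.prems(1)] Ck_Suc_imp[OF Suc.prems(2)])
qed

lemma Ck_prod: "finite S \<Longrightarrow> (\<And>i. i \<in> S \<Longrightarrow> Ck k (f i)) \<Longrightarrow> Ck k (\<lambda>x. \<Prod>i\<in>S. f i x)"
  by (induction S rule: finite_induct) (auto intro: Ck_const Ck_mult)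

text \<open>
  The induction is on the order of differentiability for all \<open>j\<close> at once, because a derivative
  raises the index.
\<close>

lemma Ck_flat_exp_coordinate: "Ck k (\<lambda>x::real^'n::finite. flat_exp j (c * x $ i + d))"
proof (induction k arbitrary: j)
  case 0
  have "continuous_on UNIV (flat_exp j)"
    using has_real_derivative_flat_exp DERIV_isCont continuous_at_imp_continuous_on by blast
  then show ?case
    by (auto intro!: continuous_on_compose2[of UNIV "flat_exp j"] continuous_intros)
next
  case (Suc k)
  let ?f = "\<lambda>j (x::real^'n). flat_exp j (c * x $ i + d)"
  let ?D = "\<lambda>x. ?f (Suc (Suc j)) x + (- real j) * ?f (Suc j) x"
  have D: "(?f j has_derivative (\<lambda>h. ?D x * (c * h $ i))) (at x)" for x
  proof -
    have "((\<lambda>x::real^'n. c * x $ i + d) has_derivative (\<lambda>h. c * h $ i)) (at x)"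
      by (auto intro!: derivative_eq_intros bounded_linear_imp_has_derivative bounded_linear_vec_nth)
    from has_derivative_compose[OF this has_real_derivative_flat_exp[unfolded has_field_derivative_def]]
    show ?thesis by simp
  qed
  have "partial_deriv l (?f j) = (\<lambda>x. ?D x * (c * axis l 1 $ i))" for l
    using partial_deriv_eqI[OF D] by blast
  moreover have "Ck k (\<lambda>x. ?D x * (c * axis l 1 $ i))" for l
    by (intro Ck_add Ck_mult Ck_const Suc)
  moreover have "?f j differentiable (at x)" for x
    using D by (auto simp: differentiable_def)
  ultimately show ?case by (simp only: Ck.simps) simp
qed

lemma has_derivative_translate:
  fixes f :: "real^'n::finite \<Rightarrow> real"
  assumes "f differentiable (at (x + a))"
  shows "((\<lambda>x. f (x + a)) has_derivative frechet_derivative f (at (x + a))) (at x)"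
proof -
  have "((\<lambda>x. x + a) has_derivative (\<lambda>h. h)) (at x)"
    by (auto intro!: derivative_eq_intros)
  from has_derivative_compose[OF this has_derivative_frechet[OF assms]] show ?thesis .
qed

lemma Ck_translate:
  "Ck k f \<Longrightarrow> Ck k (\<lambda>x::real^'n::finite. f (x + a))"
proof (induction k arbitrary: f)
  case 0
  then show ?case by (auto intro!: continuous_on_compose2[of UNIV f] continuous_intros)
next
  case (Suc k)
  have "partial_deriv i (\<lambda>x. f (x + a)) = (\<lambda>x. partial_deriv i f (x + a))" for i
  proof
    fix x
    have "f differentiable (at (x + a))" using Suc.prems by simp
    from partial_deriv_eqI[OF has_derivative_translate[OF this]]
    show "partial_deriv i (\<lambda>x. f (x + a)) x = partial_deriv i f (x + a)"
      by (simp add: partial_deriv_def)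
  qed
  then show ?case
    using Suc has_derivative_translate[of f _ a] by (auto simp: differentiable_def[of "\<lambda>x. f (x+a)"])
qed

lemma test_functionI:
  assumes "\<And>k. Ck k \<phi>" "compact K" "{x. \<phi> x \<noteq> 0} \<subseteq> K" shows "test_function \<phi>"
proof -
  have "closure {x. \<phi> x \<noteq> 0} \<subseteq> K"
    using assms by (intro closure_minimal compact_imp_closed)
  then show ?thesis
    using assms unfolding test_function_def
    by (metis closed_closure inf.absorb_iff2 compact_Int_closed)
qed

lemma test_function_translate:
  assumes "test_function \<phi>" shows "test_function (\<lambda>x::real^'n::finite. \<phi> (x + a))"
proof (rule test_functionI)
  show "{x. \<phi> (x + a) \<noteq> 0} \<subseteq> (\<lambda>x. x - a) ` closure {x. \<phi> x \<noteq> 0}"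
    using closure_subset[of "{x. \<phi> x \<noteq> 0}"] by (force simp: image_iff intro: bexI[of _ "_ + a"])
qed (use assms in \<open>auto simp: test_function_def intro!: Ck_translate compact_translation_subtract\<close>)

lemma test_function_partial_deriv_eq_0:
  fixes \<phi> :: "real^'n::finite \<Rightarrow> real"
  assumes "x \<notin> closure {x. \<phi> x \<noteq> 0}" shows "partial_deriv i \<phi> x = 0"
proof -
  have "((\<lambda>x. 0::real) has_derivative (\<lambda>h. 0)) (at x)" by simp
  then have "(\<phi> has_derivative (\<lambda>h. 0)) (at x)"
    by (rule has_derivative_transform_within_open[of _ _ _ _ "- closure {x. \<phi> x \<noteq> 0}"])
       (use assms closure_subset[of "{x. \<phi> x \<noteq> 0}"] in auto)
  then show ?thesis by (simp add: partial_deriv_eqI)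
qed

lemma test_function_partial_deriv:
  fixes \<phi> :: "real^'n::finite \<Rightarrow> real"
  assumes "test_function \<phi>" shows "test_function (partial_deriv i \<phi>)"
proof (rule test_functionI)
  show "{x. partial_deriv i \<phi> x \<noteq> 0} \<subseteq> closure {x. \<phi> x \<noteq> 0}"
    using test_function_partial_deriv_eq_0 by blast
  show "Ck k (partial_deriv i \<phi>)" for k
    using assms Ck.simps(2)[of k \<phi>] by (auto simp: test_function_def simp del: Ck.simps)
qed (use assms in \<open>auto simp: test_function_def\<close>)

lemma test_function_continuous: "test_function \<phi> \<Longrightarrow> continuous_on UNIV \<phi>"
  unfolding test_function_def by (metis Ck.simps(1))

lemma test_function_has_derivative:
  "test_function \<phi> \<Longrightarrow> (\<phi> has_derivative frechet_derivative \<phi> (at x)) (at x)"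
  unfolding test_function_def by (metis Ck.simps(2) has_derivative_frechet)

lemma test_function_measurable: "test_function \<phi> \<Longrightarrow> \<phi> \<in> borel_measurable borel"
  by (simp add: borel_measurable_continuous_onI test_function_continuous)

lemma test_function_bounded:
  fixes \<phi> :: "real^'n::finite \<Rightarrow> real"
  assumes "test_function \<phi>"
  obtains B where "B \<ge> 0" "\<And>x. \<bar>\<phi> x\<bar> \<le> B"
proof -
  let ?K = "closure {x. \<phi> x \<noteq> 0}"
  have "bounded (\<phi> ` ?K)"
    using assms continuous_on_subset[OF test_function_continuous[OF assms]]
    by (intro compact_imp_bounded compact_continuous_image) (auto simp: test_function_def)
  then obtain B where B: "B > 0" "\<And>x. x \<in> ?K \<Longrightarrow> \<bar>\<phi> x\<bar> \<le> B"
    unfolding bounded_pos by auto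
  have "\<bar>\<phi> x\<bar> \<le> B" for x
    using B closure_subset[of "{x. \<phi> x \<noteq> 0}"] by (cases "\<phi> x = 0") auto
  with B show ?thesis by (intro that[of B]) auto
qed

lemma test_function_integrable:
  fixes \<phi> :: "real^'n::finite \<Rightarrow> real"
  assumes "test_function \<phi>" shows "integrable lborel \<phi>"
proof -
  let ?K = "closure {x. \<phi> x \<noteq> 0}"
  have "continuous_on ?K \<phi>"
    using continuous_on_subset[OF test_function_continuous[OF assms]] by simp
  then have "set_integrable lborel ?K \<phi>"
    using assms borel_integrable_compact[of ?K \<phi>]
    by (auto simp: test_function_def set_integrable_def)
  moreover have "(\<lambda>x. indicator ?K x *\<^sub>R \<phi> x) = \<phi>"
    using closure_subset[of "{x. \<phi> x \<noteq> 0}"] by (intro ext) (auto simp: indicator_def)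
  ultimately show ?thesis by (simp add: set_integrable_def)
qed

text \<open>
  As \<open>n\<close> grows, each factor \<open>exp (- 1/((n + 1) s))\<close> with \<open>s > 0\<close> tends to \<open>1\<close>, while it vanishes for
  \<open>s \<le> 0\<close>. The bumps therefore converge to the indicator of the box, with values in \<open>[0, 1]\<close>.
\<close>

definition box_bump :: "real^'n::finite \<Rightarrow> real^'n \<Rightarrow> nat \<Rightarrow> real^'n \<Rightarrow> real" where
  "box_bump a b n x = (\<Prod>i\<in>UNIV. flat_exp 0 (real (Suc n) * (x $ i - a $ i)) * flat_exp 0 (real (Suc n) * (b $ i - x $ i)))"

lemma flat_exp_eq_0_iff: "flat_exp 0 s = 0 \<longleftrightarrow> s \<le> 0"
  by (simp add: flat_exp_def)

lemma flat_exp_le_1: "flat_exp 0 s \<le> 1"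
  by (simp add: flat_exp_def)

lemma box_bump_eq_0: "x \<notin> box a b \<Longrightarrow> box_bump a b n x = 0"
  by (auto simp: box_bump_def mem_box_cart flat_exp_eq_0_iff not_less mult_le_0_iff)

lemma test_function_box_bump: "test_function (box_bump a b n)"
proof -
  have "Ck k (box_bump a b n)" for k
  proof -
    have "Ck k (\<lambda>x. flat_exp 0 (real (Suc n) * (x $ i - a $ i)))" for i
      using Ck_flat_exp_coordinate[of k 0 "real (Suc n)" i "- real (Suc n) * a $ i"]
      by (simp add: algebra_simps)
    moreover have "Ck k (\<lambda>x. flat_exp 0 (real (Suc n) * (b $ i - x $ i)))" for i
      using Ck_flat_exp_coordinate[of k 0 "- real (Suc n)" i "real (Suc n) * b $ i"]
      by (simp add: algebra_simps)
    ultimately show ?thesis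
      unfolding box_bump_def[abs_def] by (intro Ck_prod Ck_mult) auto
  qed
  then show ?thesis
    by (rule test_functionI[where K="cbox a b"])
       (use box_bump_eq_0[of _ a b n] box_subset_cbox[of a b] in auto)
qed

lemma box_bump_bounds: "0 \<le> box_bump a b n x" "box_bump a b n x \<le> 1"
  unfolding box_bump_def
  by (auto intro!: prod_nonneg prod_le_1 mult_nonneg_nonneg mult_le_one flat_exp_nonneg flat_exp_le_1)

lemma flat_exp_scale_tendsto_1:
  assumes "s > 0" shows "(\<lambda>n. flat_exp 0 (real (Suc n) * s)) \<longlonglongrightarrow> 1"
proof -
  have "(\<lambda>n. exp (- (inverse (real (Suc n)) * inverse s))) \<longlonglongrightarrow> exp (- (0 * inverse s))"
    by (intro tendsto_intros LIMSEQ_inverse_real_of_nat)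
  then show ?thesis using assms by (simp add: flat_exp_def inverse_mult_distrib)
qed

lemma box_bump_tendsto: "(\<lambda>n. box_bump a b n x) \<longlonglongrightarrow> indicator (box a b) x"
proof (cases "x \<in> box a b")
  case True
  have "(\<lambda>n. box_bump a b n x) \<longlonglongrightarrow> (\<Prod>i\<in>(UNIV::'a set). 1 * 1)"
    unfolding box_bump_def using True
    by (intro tendsto_prod tendsto_mult flat_exp_scale_tendsto_1) (auto simp: mem_box_cart)
  then show ?thesis using True by simp
qed (simp add: box_bump_eq_0)

section \<open>Functions orthogonal to all test functions\<close>

text \<open>
  Testing against \<open>box_bump\<close> and passing to the limit shows that \<open>w\<close> has integral \<open>0\<close> over every box.
  Boxes are an intersection stable generator of the Borel sets, so inside a fixed box the integral
  vanishes over every Borel set.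
\<close>

lemma AE_eq_0_of_test_functions:
  fixes w :: "real^'n::finite \<Rightarrow> complex"
  assumes [measurable]: "w \<in> borel_measurable borel"
    and int: "\<And>a b. set_integrable lborel (cbox a b) w"
    and test: "\<And>\<phi>. test_function \<phi> \<Longrightarrow> (\<integral>x. \<phi> x *\<^sub>R w x \<partial>lborel) = 0"
  shows "AE x in lborel. w x = 0"
proof -
  have box0: "(\<integral>x. indicator (box a b) x *\<^sub>R w x \<partial>lborel) = 0" for a b
  proof -
    have [measurable]: "box_bump a b n \<in> borel_measurable borel" for n
      by (rule test_function_measurable[OF test_function_box_bump])
    have "(\<lambda>n. \<integral>x. box_bump a b n x *\<^sub>R w x \<partial>lborel) \<longlonglongrightarrow> (\<integral>x. indicator (box a b) x *\<^sub>R w x \<partial>lborel)"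
    proof (rule integral_dominated_convergence)
      show "integrable lborel (\<lambda>x. norm (indicator (cbox a b) x *\<^sub>R w x))"
        using int[of a b] by (intro integrable_norm) (simp add: set_integrable_def)
      show "AE x in lborel. (\<lambda>n. box_bump a b n x *\<^sub>R w x) \<longlonglongrightarrow> indicator (box a b) x *\<^sub>R w x"
        by (intro AE_I2 tendsto_scaleR box_bump_tendsto tendsto_const)
      show "AE x in lborel. norm (box_bump a b n x *\<^sub>R w x) \<le> norm (indicator (cbox a b) x *\<^sub>R w x)" for n
      proof (rule AE_I2)
        fix x show "norm (box_bump a b n x *\<^sub>R w x) \<le> norm (indicator (cbox a b) x *\<^sub>R w x)"
        proof (cases "x \<in> box a b")
          case True
          then have "x \<in> cbox a b" using box_subset_cbox by blast
          then show ?thesis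
            using box_bump_bounds[of a b n x] mult_left_le_one_le[of "norm (w x)" "box_bump a b n x"]
            by simp
        qed (simp add: box_bump_eq_0)
      qed
    qed measurable
    then show ?thesis
      unfolding test[OF test_function_box_bump] by (rule LIMSEQ_unique[OF _ tendsto_const])
  qed
  have AEn: "AE x in lborel. indicator (box a b) x *\<^sub>R w x = 0" for a b
  proof (rule sigma_finite_measure.density_zero[OF sigma_finite_lborel])
    show int': "integrable lborel (\<lambda>x. indicator (box a b) x *\<^sub>R w x)" for a b
    proof -
      have "integrable lborel (\<lambda>x. indicator (box a b) x *\<^sub>R (indicator (cbox a b) x *\<^sub>R w x))"
        using int[of a b] by (intro integrable_mult_indicator[of "box a b"]) (auto simp: set_integrable_def)
      moreover have "indicator (box a b) x *\<^sub>R (indicator (cbox a b) x *\<^sub>R w x) = indicator (box a b) x *\<^sub>R w x" for x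
        using box_subset_cbox[of a b] by (auto simp: indicator_def)
      ultimately show ?thesis by (simp only:)
    qed
    fix A :: "(real^'n) set" assume "A \<in> sets lborel"
    then have A: "A \<in> sets borel" by simp
    define wb where "wb x = indicator (box a b) x *\<^sub>R w x" for x
    have wb: "integrable lborel wb" "(\<integral>x. wb x \<partial>lborel) = 0"
      using int'[of a b] box0[of a b] by (simp_all add: wb_def[abs_def])
    let ?P = "\<lambda>A. (\<integral>x. indicator A x *\<^sub>R wb x \<partial>lborel) = 0"
    have "Int_stable  (range (\<lambda>(a, b). box a b :: (real^'n) set))"
      by (auto simp: Int_stable_def box_Int_box)
    moreover have "(range (\<lambda>(a, b). box a b :: (real^'n) set)) \<subseteq> Pow UNIV"
      by auto
    moreover have "A \<in> sigma_sets UNIV (range (\<lambda>(a, b). box a b))"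
       using A unfolding borel_eq_box by simp
    ultimately have "?P A"
    proof (induction rule: sigma_sets_induct_disjoint)
      case (basic A)
      then obtain c d where A: "A = box c d" by auto
      have "indicator A x *\<^sub>R wb x = indicator (box c d \<inter> box a b) x *\<^sub>R w x" for x
        by (auto simp: A wb_def indicator_def)
      then show ?case by (simp only: box_Int_box box0)
    next
      case empty then show ?case by simp
    next
      case (compl A)
      then have [measurable]: "A \<in> sets borel"
        by (simp add: borel_eq_box)
      have "indicator (UNIV - A) x *\<^sub>R wb x
          = wb x - indicator A x *\<^sub>R wb x" for x
        by (auto simp: indicator_def)
      moreover have "integrable lborel (\<lambda>x. indicator A x *\<^sub>R wb x)"
        by (intro integrable_mult_indicator wb) simp
      ultimately show ?case
        using wb compl by simp
    next
      case (union F)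
      then have F[measurable]: "\<And>i. F i \<in> sets borel"
        by (simp add: borel_eq_box subset_eq)
      have "set_integrable lborel (\<Union>i. F i) wb"
        unfolding set_integrable_def by (intro integrable_mult_indicator wb) simp
      from lebesgue_integral_countable_add[of F, OF _ _ this] F union.hyps(1)
      have "set_lebesgue_integral lborel (\<Union>i. F i) wb = (\<Sum>i. set_lebesgue_integral lborel (F i) wb)"
        by (auto simp: disjoint_family_on_def)
      then show ?case using union.IH by (simp add: set_lebesgue_integral_def)
    qed
    then show "set_lebesgue_integral lborel A (\<lambda>x. indicator (box a b) x *\<^sub>R w x) = 0"
      by (simp add: set_lebesgue_integral_def wb_def)
  qed
  then have "AE x in lborel. \<forall>n::nat. indicator (box (- (real n *\<^sub>R One)) (real n *\<^sub>R One)) x *\<^sub>R w x = 0"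
    by (simp only: AE_all_countable simp_thms)
  then show ?thesis
  proof (rule AE_mp, intro AE_I2 impI)
    fix x :: "real^'n"
    assume *: "\<forall>n::nat. indicator (box (- (real n *\<^sub>R One)) (real n *\<^sub>R One)) x *\<^sub>R w x = 0"
    have "x \<in> (\<Union>n::nat. box (- (real n *\<^sub>R One)) (real n *\<^sub>R One))"
      by (simp only: UN_box_eq_UNIV UNIV_I)
    then obtain n :: nat where "x \<in> box (- (real n *\<^sub>R One)) (real n *\<^sub>R One)"
      by (rule UN_E)
    then show "w x = 0" using *[rule_format, of n] by simp
  qed
qed

section \<open>Translations and square integrable functions\<close>

lemma integrable_bounded_mult:
  fixes f w :: "'a::euclidean_space \<Rightarrow> real"
  assumes f: "integrable lborel f" and [measurable]: "w \<in> borel_measurable borel" and w: "\<And>x. \<bar>w x\<bar> \<le> K"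
  shows "integrable lborel (\<lambda>x. w x * f x)"
proof (rule Bochner_Integration.integrable_bound)
  show "integrable lborel (\<lambda>x. K * f x)" using f by simp
  have "norm (w x * f x) \<le> norm (K * f x)" for x
    using mult_right_mono[OF order_trans[OF w[of x] abs_ge_self[of K]], of "\<bar>f x\<bar>"] by (simp add: abs_mult)
  then show "AE x in lborel. norm (w x * f x) \<le> norm (K * f x)" by simp
qed (use borel_measurable_integrable[OF f] in measurable)

lemma nn_integral_translate:
  fixes f :: "'a::euclidean_space \<Rightarrow> ennreal"
  assumes [measurable]: "f \<in> borel_measurable borel"
  shows "(\<integral>\<^sup>+x. f (x + c) \<partial>lborel) = (\<integral>\<^sup>+x. f x \<partial>lborel)"
  using nn_integral_distr[of "(+) c" lborel borel f] lborel_distr_plus[of c]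
  by (simp add: add.commute)

lemma integrable_translate:
  fixes f :: "'a::euclidean_space \<Rightarrow> 'b::{banach, second_countable_topology}"
  assumes "integrable lborel f"
  shows "integrable lborel (\<lambda>x. f (x + c))"
proof -
  have [measurable]: "f \<in> borel_measurable borel"
    using borel_measurable_integrable[OF assms] by simp
  show ?thesis
    using assms integrable_distr_eq[of "(+) c" lborel borel f] lborel_distr_plus[of c]
    by (simp add: add.commute)
qed

lemma integral_translate:
  fixes f :: "'a::euclidean_space \<Rightarrow> 'b::{banach, second_countable_topology}"
  assumes [measurable]: "f \<in> borel_measurable borel"
  shows "(\<integral>x. f (x + c) \<partial>lborel) = (\<integral>x. f x \<partial>lborel)"
  using integral_distr[of "(+) c" lborel borel f] lborel_distr_plus[of c]
  by (simp add: add.commute)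

lemma L2_measurable: "L2 f \<Longrightarrow> f \<in> borel_measurable borel"
  by (simp add: L2_def)

lemma L2_norm_square: "L2 f \<Longrightarrow> (L2_norm f)\<^sup>2 = (\<integral>x. (norm (f x))\<^sup>2 \<partial>lborel)"
  by (simp add: L2_norm_def)

lemma integrable_scaleR_L2:
  fixes f :: "'a::euclidean_space \<Rightarrow> real" and u :: "'a \<Rightarrow> 'b::euclidean_space"
  assumes "L2 f" "L2 u" shows "integrable lborel (\<lambda>x. f x *\<^sub>R u x)"
proof (rule Bochner_Integration.integrable_bound)
  show "integrable lborel (\<lambda>x. (norm (f x))\<^sup>2 + (norm (u x))\<^sup>2)"
    using assms by (auto simp: L2_def)
  have "norm (f x *\<^sub>R u x) \<le> norm ((norm (f x))\<^sup>2 + (norm (u x))\<^sup>2)" for x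
    using sum_squares_bound[of "norm (f x)" "norm (u x)"]
    using mult_nonneg_nonneg[of "norm (f x)" "norm (u x)"] by (simp del: mult_nonneg_nonneg)
  then show "AE x in lborel. norm (f x *\<^sub>R u x) \<le> norm ((norm (f x))\<^sup>2 + (norm (u x))\<^sup>2)" by simp
qed (use assms[THEN L2_measurable] in simp)

lemma test_function_L2:
  fixes \<phi> :: "real^'n::finite \<Rightarrow> real"
  assumes "test_function \<phi>" shows "L2 \<phi>"
proof -
  obtain B where "\<And>x. \<bar>\<phi> x\<bar> \<le> B" using test_function_bounded[OF assms] by blast
  then have "integrable lborel (\<lambda>x. \<phi> x * \<phi> x)"
    by (rule integrable_bounded_mult[OF test_function_integrable[OF assms] test_function_measurable[OF assms]])
  then show ?thesis
    using test_function_measurable[OF assms] by (simp add: L2_def power2_eq_square)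
qed

lemma L2_set_integrable:
  fixes u :: "'a::euclidean_space \<Rightarrow> 'b::euclidean_space"
  assumes "L2 u" shows "set_integrable lborel (cbox a b) u"
proof -
  have "L2 (indicator (cbox a b) :: 'a \<Rightarrow> real)"
    using integrable_real_indicator[of "cbox a b" lborel] emeasure_lborel_cbox_finite[of a b]
    by (simp add: L2_def power2_eq_square flip: indicator_inter_arith)
  then show ?thesis
    unfolding set_integrable_def by (rule integrable_scaleR_L2[OF _ assms])
qed

lemma L2_diff:
  fixes u v :: "'a::euclidean_space \<Rightarrow> 'b::euclidean_space"
  assumes "L2 u" "L2 v" shows "L2 (\<lambda>x. u x - v x)"
  unfolding L2_def
proof
  note [measurable] = assms[THEN L2_measurable]
  show "(\<lambda>x. u x - v x) \<in> borel_measurable lborel" by simp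
  show "integrable lborel (\<lambda>x. (norm (u x - v x))\<^sup>2)"
  proof (rule Bochner_Integration.integrable_bound)
    show "integrable lborel (\<lambda>x. 2 * (norm (u x))\<^sup>2 + 2 * (norm (v x))\<^sup>2)"
      using assms by (auto simp: L2_def)
    have "(norm (u x - v x))\<^sup>2 \<le> 2 * (norm (u x))\<^sup>2 + 2 * (norm (v x))\<^sup>2" for x
    proof -
      have "(norm (u x - v x))\<^sup>2 \<le> (norm (u x) + norm (v x))\<^sup>2"
        by (intro power_mono norm_triangle_ineq4) simp
      also have "\<dots> \<le> 2 * (norm (u x))\<^sup>2 + 2 * (norm (v x))\<^sup>2"
        using sum_squares_bound[of "norm (u x)" "norm (v x)"] by (simp add: power2_sum)
      finally show ?thesis .
    qed
    then show "AE x in lborel. norm ((norm (u x - v x))\<^sup>2) \<le> norm (2 * (norm (u x))\<^sup>2 + 2 * (norm (v x))\<^sup>2)"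
      by simp
  qed simp
qed

lemma L2_translate:
  assumes "L2 u" shows "L2 (\<lambda>x. u (x + c))"
  using assms integrable_translate[of "\<lambda>x. (norm (u x))\<^sup>2" c]
  by (auto simp: L2_def intro: measurable_compose_rev)

section \<open>Difference quotients of weakly differentiable functions\<close>

lemma partial_derivative_along_line:
  fixes \<phi> :: "real^'n::finite \<Rightarrow> real"
  assumes "test_function \<phi>"
  shows "((\<lambda>s. \<phi> (x + s *\<^sub>R axis i 1)) has_real_derivative partial_deriv i \<phi> (x + s *\<^sub>R axis i 1)) (at s)"
proof -
  have "((\<lambda>s. x + s *\<^sub>R axis i 1) has_derivative (\<lambda>h. h *\<^sub>R axis i 1)) (at s)"
    by (auto intro!: derivative_eq_intros)
  from has_derivative_compose[OF this test_function_has_derivative[OF assms]]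
  have D: "((\<lambda>s. \<phi> (x + s *\<^sub>R axis i 1)) has_derivative
      (\<lambda>h. frechet_derivative \<phi> (at (x + s *\<^sub>R axis i 1)) (h *\<^sub>R axis i 1))) (at s)" .
  have "linear (frechet_derivative \<phi> (at y))" for y
    using test_function_has_derivative[OF assms] has_derivative_linear by blast
  then show ?thesis
    unfolding has_field_derivative_def partial_deriv_def
    by (intro has_derivative_eq_rhs[OF D] ext) (simp add: linear_scale)
qed

text \<open>
  One component of \<^const>\<open>has_weak_gradient\<close>; the estimates below treat the coordinates one at a time.
\<close>

definition has_weak_partial_deriv ::
  "'n \<Rightarrow> (real^'n::finite \<Rightarrow> complex) \<Rightarrow> (real^'n \<Rightarrow> complex) \<Rightarrow> bool" where
  "has_weak_partial_deriv i u v \<longleftrightarrow> (\<forall>\<phi>. test_function \<phi> \<longrightarrow>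
     (\<integral>x. partial_deriv i \<phi> x *\<^sub>R u x \<partial>lborel) = - (\<integral>x. \<phi> x *\<^sub>R v x \<partial>lborel))"

lemma has_weak_gradient_iff:
  "has_weak_gradient u g \<longleftrightarrow> (\<forall>i. has_weak_partial_deriv i u (\<lambda>x. g x $ i))"
  by (auto simp: has_weak_gradient_def has_weak_partial_deriv_def)

lemma mult_le_sum_squares: "0 \<le> a \<Longrightarrow> 0 \<le> b \<Longrightarrow> a * b \<le> a\<^sup>2 + (b::real)\<^sup>2"
  using sum_squares_bound[of a b] mult_nonneg_nonneg[of a b] by linarith

text \<open>
  Almost everywhere \<open>u (x + h e\<^sub>i) - u x\<close> is the integral \<open>A x\<close> of \<open>v\<close> over the segment from \<open>x\<close> to
  \<open>x + h e\<^sub>i\<close>: tested against \<open>\<phi>\<close>, this is Fubini's theorem, the definition of the weak derivative for the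
  translates of \<open>\<phi>\<close>, and the fundamental theorem of calculus for \<open>\<phi>\<close>. The norm of \<open>A\<close> is controlled by
  the Cauchy-Schwarz inequality on the segment and translation invariance.
\<close>

lemma L2_difference_le:
  fixes u v :: "real^'n::finite \<Rightarrow> complex"
  assumes u: "L2 u" and v: "L2 v" and h: "h > 0"
    and weak: "has_weak_partial_deriv i u v"
  shows "(\<integral>x. (norm (u (x + h *\<^sub>R axis i 1) - u x))\<^sup>2 \<partial>lborel) \<le> h\<^sup>2 * (\<integral>x. (norm (v x))\<^sup>2 \<partial>lborel)"
proof -
  note [measurable] = u[THEN L2_measurable] v[THEN L2_measurable]
  define e :: "real^'n" where "e = axis i 1"
  define q where "q x s = indicator {0..h} s *\<^sub>R v (x + s *\<^sub>R e)" for x :: "real^'n" and s :: real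
  define A where "A x = (\<integral>s. q x s \<partial>lborel)" for x
  have [measurable]: "(\<lambda>(x, s). q x s) \<in> borel_measurable (lborel \<Otimes>\<^sub>M lborel)"
    unfolding q_def by measurable
  have [measurable]: "q x \<in> borel_measurable borel" for x
    unfolding q_def by measurable
  have [measurable]: "A \<in> borel_measurable borel"
    unfolding A_def using lborel.borel_measurable_lebesgue_integral[of q lborel] by simp
  have A_le: "(ennreal (norm (A x)))\<^sup>2 \<le> ennreal h * (\<integral>\<^sup>+s. (ennreal (norm (q x s)))\<^sup>2 \<partial>lborel)" for x
  proof -
    have "ennreal (norm (A x)) \<le> (\<integral>\<^sup>+s. norm (q x s) \<partial>lborel)"
      by (cases "integrable lborel (q x)")
         (auto simp: A_def integral_norm_bound_ennreal not_integrable_integral_eq)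
    also have "\<dots> = (\<integral>\<^sup>+s. ennreal (norm (q x s)) * indicator {0..h} s \<partial>lborel)"
      by (intro nn_integral_cong) (auto simp: q_def split: split_indicator)
    finally have "(ennreal (norm (A x)))\<^sup>2 \<le> (\<integral>\<^sup>+s. ennreal (norm (q x s)) * indicator {0..h} s \<partial>lborel)\<^sup>2"
      by (intro power_mono) auto
    also have "\<dots> \<le> (\<integral>\<^sup>+s. (ennreal (norm (q x s)))\<^sup>2 \<partial>lborel) * (\<integral>\<^sup>+s. (indicator {0..h} s)\<^sup>2 \<partial>lborel)"
      by (rule Cauchy_Schwarz_nn_integral) auto
    also have "(\<integral>\<^sup>+s. (indicator {0..h} s)\<^sup>2 \<partial>lborel) = (\<integral>\<^sup>+s. indicator {0..h} s \<partial>lborel)"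
      by (intro nn_integral_cong) (auto split: split_indicator)
    also have "\<dots> = ennreal h" using h by simp
    finally show ?thesis by (simp add: mult.commute)
  qed
  have v2: "(\<integral>\<^sup>+x. (ennreal (norm (v x)))\<^sup>2 \<partial>lborel) = ennreal (\<integral>x. (norm (v x))\<^sup>2 \<partial>lborel)"
    using v by (simp add: L2_def nn_integral_eq_integral ennreal_power)
  have q2: "(\<integral>\<^sup>+x. \<integral>\<^sup>+s. (ennreal (norm (q x s)))\<^sup>2 \<partial>lborel \<partial>lborel) = ennreal h * ennreal (\<integral>x. (norm (v x))\<^sup>2 \<partial>lborel)"
  proof -
    have "(\<integral>\<^sup>+x. \<integral>\<^sup>+s. (ennreal (norm (q x s)))\<^sup>2 \<partial>lborel \<partial>lborel)
        = (\<integral>\<^sup>+s. \<integral>\<^sup>+x. (ennreal (norm (q x s)))\<^sup>2 \<partial>lborel \<partial>lborel)"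
      by (rule lborel_pair.Fubini'[symmetric]) measurable
    also have "\<dots> = (\<integral>\<^sup>+s. indicator {0..h} s * (\<integral>\<^sup>+x. (ennreal (norm (v (x + s *\<^sub>R e))))\<^sup>2 \<partial>lborel) \<partial>lborel)"
      by (intro nn_integral_cong) (auto simp: q_def split: split_indicator)
    also have "\<dots> = (\<integral>\<^sup>+s. indicator {0..h} s * ennreal (\<integral>x. (norm (v x))\<^sup>2 \<partial>lborel) \<partial>lborel)"
      by (subst nn_integral_translate) (simp_all add: v2)
    also have "\<dots> = ennreal h * ennreal (\<integral>x. (norm (v x))\<^sup>2 \<partial>lborel)"
      using h by (simp add: nn_integral_multc)
    finally show ?thesis .
  qed
  have A2: "(\<integral>\<^sup>+x. (ennreal (norm (A x)))\<^sup>2 \<partial>lborel) \<le> ennreal (h\<^sup>2 * (\<integral>x. (norm (v x))\<^sup>2 \<partial>lborel))"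
  proof -
    have "(\<integral>\<^sup>+x. (ennreal (norm (A x)))\<^sup>2 \<partial>lborel)
        \<le> (\<integral>\<^sup>+x. ennreal h * (\<integral>\<^sup>+s. (ennreal (norm (q x s)))\<^sup>2 \<partial>lborel) \<partial>lborel)"
      by (intro nn_integral_mono A_le)
    also have "\<dots> = ennreal h * (ennreal h * ennreal (\<integral>x. (norm (v x))\<^sup>2 \<partial>lborel))"
      by (subst nn_integral_cmult) (simp_all add: q2)
    also have "\<dots> = ennreal (h\<^sup>2 * (\<integral>x. (norm (v x))\<^sup>2 \<partial>lborel))"
      using h by (simp add: ennreal_mult power2_eq_square mult.assoc)
    finally show ?thesis .
  qed
  have LA: "L2 A"
    unfolding L2_def using A2
    by (auto simp: integrable_iff_bounded ennreal_power intro: le_less_trans)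
  have intA: "(\<integral>x. (norm (A x))\<^sup>2 \<partial>lborel) \<le> h\<^sup>2 * (\<integral>x. (norm (v x))\<^sup>2 \<partial>lborel)"
    using A2 LA by (simp add: L2_def ennreal_power nn_integral_eq_integral)
  have LD: "L2 (\<lambda>x. u (x + h *\<^sub>R e) - u x)"
    by (intro L2_diff L2_translate u)
  have "AE x in lborel. (u (x + h *\<^sub>R e) - u x) - A x = 0"
  proof (rule AE_eq_0_of_test_functions)
    show "set_integrable lborel (cbox a b) (\<lambda>x. (u (x + h *\<^sub>R e) - u x) - A x)" for a b
      by (intro L2_set_integrable L2_diff LD LA)
    fix \<phi> :: "real^'n \<Rightarrow> real" assume phi: "test_function \<phi>"
    let ?d = "partial_deriv i \<phi>"
    note [measurable] = test_function_measurable[OF phi] test_function_measurable[OF test_function_partial_deriv[OF phi, of i]]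
    have d: "test_function ?d" by (rule test_function_partial_deriv[OF phi])
    have Lphi: "L2 \<phi>" and Ld: "L2 ?d" using phi d by (simp_all add: test_function_L2)
    have sp: "(\<integral>\<^sup>+s. \<integral>\<^sup>+x. ennreal (norm (indicator {0..h} s *\<^sub>R (f (x - s *\<^sub>R e) *\<^sub>R w x))) \<partial>lborel \<partial>lborel) < \<infinity>"
      if f: "L2 f" and w: "L2 w" for f :: "real^'n \<Rightarrow> real" and w :: "real^'n \<Rightarrow> complex"
    proof -
      note [measurable] = f[THEN L2_measurable] w[THEN L2_measurable]
      let ?C = "ennreal ((\<integral>x. (norm (f x))\<^sup>2 \<partial>lborel) + (\<integral>x. (norm (w x))\<^sup>2 \<partial>lborel))"
      have "(\<integral>\<^sup>+x. ennreal (norm (indicator {0..h} s *\<^sub>R (f (x - s *\<^sub>R e) *\<^sub>R w x))) \<partial>lborel) \<le> indicator {0..h} s * ?C" for s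
      proof -
        have "(\<integral>\<^sup>+x. ennreal (norm (f (x - s *\<^sub>R e) *\<^sub>R w x)) \<partial>lborel)
           \<le> (\<integral>\<^sup>+x. (ennreal ((norm (f (x + (- s *\<^sub>R e))))\<^sup>2) + ennreal ((norm (w x))\<^sup>2)) \<partial>lborel)"
        proof (intro nn_integral_mono)
          fix x
          have "norm (f (x - s *\<^sub>R e) *\<^sub>R w x) \<le> (norm (f (x - s *\<^sub>R e)))\<^sup>2 + (norm (w x))\<^sup>2"
            unfolding norm_scaleR real_norm_def by (intro mult_le_sum_squares) auto
          then show "ennreal (norm (f (x - s *\<^sub>R e) *\<^sub>R w x))
            \<le> ennreal ((norm (f (x + (- s *\<^sub>R e))))\<^sup>2) + ennreal ((norm (w x))\<^sup>2)"
            by (simp flip: ennreal_plus)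
        qed
        also have "\<dots> = (\<integral>\<^sup>+x. ennreal ((norm (f x))\<^sup>2) \<partial>lborel) + (\<integral>\<^sup>+x. ennreal ((norm (w x))\<^sup>2) \<partial>lborel)"
          by (subst nn_integral_add) (simp_all add: nn_integral_translate[of "\<lambda>x. ennreal ((norm (f x))\<^sup>2)" "- s *\<^sub>R e", simplified])
        also have "\<dots> = ?C"
          using f w by (simp add: L2_def nn_integral_eq_integral)
        finally show ?thesis by (auto split: split_indicator)
      qed
      then have "(\<integral>\<^sup>+s. \<integral>\<^sup>+x. ennreal (norm (indicator {0..h} s *\<^sub>R (f (x - s *\<^sub>R e) *\<^sub>R w x))) \<partial>lborel \<partial>lborel)
          \<le> (\<integral>\<^sup>+s. indicator {0..h} s * ?C \<partial>lborel)"
        by (intro nn_integral_mono)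
      also have "\<dots> = ennreal h * ?C" using h by (subst nn_integral_multc) auto
      also have "\<dots> < \<infinity>" by (simp add: ennreal_mult_less_top)
      finally show ?thesis .
    qed
    have sp_int: "integrable (lborel \<Otimes>\<^sub>M lborel) (\<lambda>(x, s). indicator {0..h} s *\<^sub>R (f (x - s *\<^sub>R e) *\<^sub>R w x))"
      if f: "L2 f" and w: "L2 w" for f :: "real^'n \<Rightarrow> real" and w :: "real^'n \<Rightarrow> complex"
    proof -
      note [measurable] = f[THEN L2_measurable] w[THEN L2_measurable]
      show ?thesis
        unfolding integrable_iff_bounded
        using sp[OF f w] by (subst lborel_pair.nn_integral_snd[symmetric]) (auto simp: split_beta)
    qed
    have "(\<integral>x. \<phi> x *\<^sub>R A x \<partial>lborel) = (\<integral>s. \<integral>x. \<phi> x *\<^sub>R q x s \<partial>lborel \<partial>lborel)"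
    proof -
      have "integrable (lborel \<Otimes>\<^sub>M lborel) (\<lambda>(x, s). \<phi> x *\<^sub>R q x s)"
        unfolding integrable_iff_bounded
      proof
        have *: "(\<integral>\<^sup>+x. ennreal (norm (\<phi> x *\<^sub>R q x s)) \<partial>lborel)
          = (\<integral>\<^sup>+x. ennreal (norm (\<phi> (x - s *\<^sub>R e) *\<^sub>R q (x - s *\<^sub>R e) s)) \<partial>lborel)" for s
          using nn_integral_translate[of "\<lambda>x. ennreal (norm (\<phi> x *\<^sub>R q x s))" "- s *\<^sub>R e", symmetric]
          by simp
        have "(\<integral>\<^sup>+s. \<integral>\<^sup>+x. ennreal (norm (\<phi> x *\<^sub>R q x s)) \<partial>lborel \<partial>lborel) < \<infinity>"
          unfolding * using sp[OF Lphi v] by (simp add: q_def mult_ac)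
        then show "(\<integral>\<^sup>+z. ennreal (norm (case z of (x, s) \<Rightarrow> \<phi> x *\<^sub>R q x s)) \<partial>(lborel \<Otimes>\<^sub>M lborel)) < \<infinity>"
          by (subst lborel_pair.nn_integral_snd[symmetric]) (auto simp: split_beta)
      qed measurable
      from lborel_pair.Fubini_integral[OF this] show ?thesis by (simp add: A_def)
    qed
    also have "\<dots> = (\<integral>s. \<integral>x. - (indicator {0..h} s *\<^sub>R (?d (x - s *\<^sub>R e) *\<^sub>R u x)) \<partial>lborel \<partial>lborel)"
    proof (rule Bochner_Integration.integral_cong[OF refl])
      fix s
      let ?f = "\<lambda>x. \<phi> (x + (- s *\<^sub>R e))"
      have f: "test_function ?f" by (rule test_function_translate[OF phi])
      have dfx: "partial_deriv i ?f = (\<lambda>x. ?d (x + (- s *\<^sub>R e)))"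
      proof
        fix x
        have "\<phi> differentiable (at (x + - s *\<^sub>R e))"
          using test_function_has_derivative[OF phi] by (auto simp: differentiable_def)
        from partial_deriv_eqI[OF has_derivative_translate[OF this], of i]
        show "partial_deriv i ?f x = ?d (x + (- s *\<^sub>R e))"
          by (simp add: partial_deriv_def)
      qed
      have "(\<integral>x. \<phi> x *\<^sub>R v (x + s *\<^sub>R e) \<partial>lborel) = (\<integral>x. ?f x *\<^sub>R v x \<partial>lborel)"
        using integral_translate[of "\<lambda>x. ?f x *\<^sub>R v x" "s *\<^sub>R e"] by simp
      also have "\<dots> = - (\<integral>x. ?d (x - s *\<^sub>R e) *\<^sub>R u x \<partial>lborel)"
        using weak[unfolded has_weak_partial_deriv_def, rule_format, OF f] unfolding dfx by simp
      finally have "(\<integral>x. \<phi> x *\<^sub>R v (x + s *\<^sub>R e) \<partial>lborel) = - (\<integral>x. ?d (x - s *\<^sub>R e) *\<^sub>R u x \<partial>lborel)" .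
      then show "(\<integral>x. \<phi> x *\<^sub>R q x s \<partial>lborel) = (\<integral>x. - (indicator {0..h} s *\<^sub>R (?d (x - s *\<^sub>R e) *\<^sub>R u x)) \<partial>lborel)"
        by (cases "s \<in> {0..h}") (simp_all add: q_def)
    qed
    also have "\<dots> = (\<integral>x. \<integral>s. - (indicator {0..h} s *\<^sub>R (?d (x - s *\<^sub>R e) *\<^sub>R u x)) \<partial>lborel \<partial>lborel)"
      using Bochner_Integration.integrable_minus[OF sp_int[OF Ld u]]
      by (intro lborel_pair.Fubini_integral) (simp add: case_prod_beta' del: scaleR_scaleR)
    also have "\<dots> = (\<integral>x. (\<phi> (x - h *\<^sub>R e) - \<phi> x) *\<^sub>R u x \<partial>lborel)"
    proof (rule Bochner_Integration.integral_cong[OF refl])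
      fix x
      have "((\<lambda>s. \<phi> (x - s *\<^sub>R e)) has_real_derivative - ?d (x - s *\<^sub>R e)) (at s)" for s
        using DERIV_chain2[where f = "\<lambda>s. \<phi> (x + s *\<^sub>R axis i 1)" and g = uminus and x = s,
            OF partial_derivative_along_line[OF phi] DERIV_minus[OF DERIV_ident]]
        by (simp add: e_def)
      moreover have "continuous_on UNIV (\<lambda>s. - ?d (x - s *\<^sub>R e))"
        by (intro continuous_on_minus continuous_on_compose2[OF test_function_continuous[OF d]] continuous_intros) auto
      then have "isCont (\<lambda>s. - ?d (x - s *\<^sub>R e)) s" for s
        by (simp add: continuous_on_eq_continuous_at)
      ultimately have "has_bochner_integral lborel (\<lambda>s. - ?d (x - s *\<^sub>R e) * indicator {0..h} s)
          (\<phi> (x - h *\<^sub>R e) - \<phi> (x - 0 *\<^sub>R e))"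
        using h by (intro has_bochner_integral_FTC_Icc_real) auto
      then have "has_bochner_integral lborel (\<lambda>s. (- ?d (x - s *\<^sub>R e) * indicator {0..h} s) *\<^sub>R u x)
          ((\<phi> (x - h *\<^sub>R e) - \<phi> (x - 0 *\<^sub>R e)) *\<^sub>R u x)"
        by (rule has_bochner_integral_scaleR_left)
      then show "(\<integral>s. - (indicator {0..h} s *\<^sub>R (?d (x - s *\<^sub>R e) *\<^sub>R u x)) \<partial>lborel) = (\<phi> (x - h *\<^sub>R e) - \<phi> x) *\<^sub>R u x"
        by (simp add: has_bochner_integral_iff mult_ac)
    qed
    also have "\<dots> = (\<integral>x. \<phi> x *\<^sub>R (u (x + h *\<^sub>R e) - u x) \<partial>lborel)"
    proof -
      have 1: "integrable lborel (\<lambda>x. \<phi> (x - h *\<^sub>R e) *\<^sub>R u x)"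
        using integrable_scaleR_L2[OF L2_translate[OF Lphi, of "- (h *\<^sub>R e)"] u] by simp
      have 2: "integrable lborel (\<lambda>x. \<phi> x *\<^sub>R u x)"
        by (rule integrable_scaleR_L2[OF Lphi u])
      have 3: "integrable lborel (\<lambda>x. \<phi> x *\<^sub>R u (x + h *\<^sub>R e))"
        by (rule integrable_scaleR_L2[OF Lphi L2_translate[OF u]])
      have "(\<integral>x. \<phi> (x - h *\<^sub>R e) *\<^sub>R u x \<partial>lborel) = (\<integral>x. \<phi> x *\<^sub>R u (x + h *\<^sub>R e) \<partial>lborel)"
        using integral_translate[of "\<lambda>x. \<phi> (x - h *\<^sub>R e) *\<^sub>R u x" "h *\<^sub>R e"] by simp
      then show ?thesis
        using 1 2 3 by (simp add: scaleR_diff_left scaleR_diff_right)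
    qed
    finally have eq: "(\<integral>x. \<phi> x *\<^sub>R A x \<partial>lborel) = (\<integral>x. \<phi> x *\<^sub>R (u (x + h *\<^sub>R e) - u x) \<partial>lborel)" .
    have "(\<integral>x. \<phi> x *\<^sub>R ((u (x + h *\<^sub>R e) - u x) - A x) \<partial>lborel)
      = (\<integral>x. \<phi> x *\<^sub>R (u (x + h *\<^sub>R e) - u x) \<partial>lborel) - (\<integral>x. \<phi> x *\<^sub>R A x \<partial>lborel)"
      unfolding scaleR_diff_right[of _ _ "A _"]
      by (intro Bochner_Integration.integral_diff integrable_scaleR_L2 Lphi LD LA)
    then show "(\<integral>x. \<phi> x *\<^sub>R ((u (x + h *\<^sub>R e) - u x) - A x) \<partial>lborel) = 0" using eq by simp
  qed measurable
  then have "(\<integral>x. (norm (u (x + h *\<^sub>R e) - u x))\<^sup>2 \<partial>lborel) = (\<integral>x. (norm (A x))\<^sup>2 \<partial>lborel)"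
    by (intro integral_cong_AE) auto
  with intA show ?thesis by (simp add: e_def)
qed

section \<open>Integration by parts as an inequality\<close>

text \<open>
  With difference quotients in place of derivatives, translation invariance moves the quotient
  from \<open>T\<close> to \<open>|u|\<^sup>2\<close>, where \<open>|b\<^sup>2 - a\<^sup>2| \<le> |b - a| (a + b)\<close> and Young's inequality separate the difference
  quotient of \<open>u\<close> from \<open>T u\<close>. As \<open>h\<close> tends to \<open>0\<close> only \<open>T\<close> has to converge, and \<open>u\<close> stays as it is.
\<close>

lemma weak_integration_by_parts_le:
  fixes u v :: "real^'n::finite \<Rightarrow> complex" and T T' :: "real^'n \<Rightarrow> real"
  assumes u: "L2 u" and v: "L2 v" and t: "t > 0"
    and weak: "has_weak_partial_deriv i u v"
    and T[measurable]: "T \<in> borel_measurable borel" and T'[measurable]: "T' \<in> borel_measurable borel"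
    and B: "\<And>x. \<bar>T x\<bar> \<le> B" and C: "\<And>x. \<bar>T' x\<bar> \<le> C"
    and deriv: "\<And>x. ((\<lambda>s. T (x + s *\<^sub>R axis i 1)) has_real_derivative T' x) (at 0)"
  shows "(\<integral>x. T' x * (norm (u x))\<^sup>2 \<partial>lborel)
      \<le> t * (\<integral>x. (norm (v x))\<^sup>2 \<partial>lborel) + (1 / t) * (\<integral>x. (T x)\<^sup>2 * (norm (u x))\<^sup>2 \<partial>lborel)"
proof -
  note [measurable] = u[THEN L2_measurable] v[THEN L2_measurable]
  define e :: "real^'n" where "e = axis i 1"
  define f where "f x = (norm (u x))\<^sup>2" for x
  have [measurable]: "f \<in> borel_measurable borel" unfolding f_def by measurable
  have f0: "f x \<ge> 0" for x by (simp add: f_def)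
  have intf: "integrable lborel f" using u by (simp add: L2_def f_def[abs_def])
  note intbf = integrable_bounded_mult[OF intf]
  have T2: "\<bar>(T x)\<^sup>2\<bar> \<le> B\<^sup>2" for x
    using power_mono[OF B[of x], of 2] by simp
  have line: "((\<lambda>s. T (x + s *\<^sub>R e)) has_real_derivative T' (x + r *\<^sub>R e)) (at r)" for x r
  proof -
    have "((\<lambda>s. T (x + r *\<^sub>R e + s *\<^sub>R e)) has_real_derivative T' (x + r *\<^sub>R e)) (at 0)"
      using deriv by (simp add: e_def)
    then show ?thesis
      using DERIV_shift[of "\<lambda>s. T (x + s *\<^sub>R e)" "T' (x + r *\<^sub>R e)" 0 r]
      by (simp add: algebra_simps scaleR_add_left)
  qed
  define h where "h n = inverse (real (Suc n))" for n
  have h: "h n > 0" for n by (simp add: h_def)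
  have h0: "h \<longlonglongrightarrow> 0" unfolding h_def by (rule LIMSEQ_inverse_real_of_nat)
  define J where "J n = (\<integral>x. (T x - T (x - h n *\<^sub>R e)) / h n * f x \<partial>lborel)" for n
  have J_le: "J n \<le> t * (\<integral>x. (norm (v x))\<^sup>2 \<partial>lborel)
      + 1 / (2 * t) * ((\<integral>x. (T (x - h n *\<^sub>R e))\<^sup>2 * f x \<partial>lborel) + (\<integral>x. (T x)\<^sup>2 * f x \<partial>lborel))" for n
  proof -
    let ?k = "h n"
    define D where "D x = u (x + ?k *\<^sub>R e) - u x" for x
    have LD: "L2 D" unfolding D_def by (intro L2_diff L2_translate u)
    have D2: "(\<integral>x. (norm (D x))\<^sup>2 \<partial>lborel) \<le> ?k\<^sup>2 * (\<integral>x. (norm (v x))\<^sup>2 \<partial>lborel)"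
      unfolding D_def e_def by (rule L2_difference_le[OF u v h weak])
    have i1: "integrable lborel (\<lambda>x. T (x - ?k *\<^sub>R e) * f x)" by (rule intbf[where K=B]) (use B in auto)
    have i2: "integrable lborel (\<lambda>x. T x * f x)" by (rule intbf[where K=B]) (use B in auto)
    have i3: "integrable lborel (\<lambda>x. T x * f (x + ?k *\<^sub>R e))"
      using integrable_translate[OF i1, of "?k *\<^sub>R e"] by simp
    have i4: "integrable lborel (\<lambda>x. (T (x - ?k *\<^sub>R e))\<^sup>2 * f x)" by (rule intbf[where K="B\<^sup>2"]) (use T2 in auto)
    have i5: "integrable lborel (\<lambda>x. (T x)\<^sup>2 * f x)" by (rule intbf[where K="B\<^sup>2"]) (use T2 in auto)
    have i6: "integrable lborel (\<lambda>x. (T x)\<^sup>2 * f (x + ?k *\<^sub>R e))"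
      using integrable_translate[OF i4, of "?k *\<^sub>R e"] by simp
    have iD: "integrable lborel (\<lambda>x. (norm (D x))\<^sup>2)" using LD by (simp add: L2_def)
    have "J n = (\<integral>x. (1 / ?k) * (T x * f x - T (x - ?k *\<^sub>R e) * f x) \<partial>lborel)"
      unfolding J_def by (intro Bochner_Integration.integral_cong refl) (simp add: left_diff_distrib diff_divide_distrib)
    also have "\<dots> = (1 / ?k) * ((\<integral>x. T x * f x \<partial>lborel) - (\<integral>x. T (x - ?k *\<^sub>R e) * f x \<partial>lborel))"
      using i1 i2 by simp
    also have "(\<integral>x. T (x - ?k *\<^sub>R e) * f x \<partial>lborel) = (\<integral>x. T x * f (x + ?k *\<^sub>R e) \<partial>lborel)"
      using integral_translate[of "\<lambda>x. T (x - ?k *\<^sub>R e) * f x" "?k *\<^sub>R e"] by simp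
    also have "(1 / ?k) * ((\<integral>x. T x * f x \<partial>lborel) - (\<integral>x. T x * f (x + ?k *\<^sub>R e) \<partial>lborel))
      = (\<integral>x. (1 / ?k) * (T x * f x - T x * f (x + ?k *\<^sub>R e)) \<partial>lborel)"
      using i2 i3 by simp
    also have "\<dots> \<le> (\<integral>x. t / ?k\<^sup>2 * (norm (D x))\<^sup>2 + 1 / (2 * t) * ((T x)\<^sup>2 * f (x + ?k *\<^sub>R e) + (T x)\<^sup>2 * f x) \<partial>lborel)"
    proof (rule integral_mono)
      fix x
      define a b d where "a = norm (u (x + ?k *\<^sub>R e))" and "b = norm (u x)" and "d = norm (D x) / ?k"
      \<comment> \<open>Young, weighted so that the difference quotient carries the factor t/2; it is used once for a and once for b.\<close>
      have young: "d * \<bar>T x\<bar> * c \<le> t / 2 * d\<^sup>2 + 1 / (2 * t) * ((T x)\<^sup>2 * c\<^sup>2)" for c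
      proof -
        have "0 \<le> (t * d - \<bar>T x\<bar> * c)\<^sup>2" by simp
        then have "2 * t * (d * \<bar>T x\<bar> * c) \<le> t\<^sup>2 * d\<^sup>2 + (T x)\<^sup>2 * c\<^sup>2"
          by (simp add: power2_diff power_mult_distrib algebra_simps)
        then show ?thesis using t by (simp add: field_simps power2_eq_square)
      qed
      have ab: "\<bar>b - a\<bar> \<le> norm (D x)"
        unfolding a_def b_def D_def using norm_triangle_ineq3[of "u x" "u (x + ?k *\<^sub>R e)"]
        by (simp add: norm_minus_commute)
      have "(1 / ?k) * (T x * f x - T x * f (x + ?k *\<^sub>R e)) = T x * (b - a) * (a + b) / ?k"
        by (simp add: f_def a_def b_def power2_eq_square field_simps)
      also have "\<dots> \<le> \<bar>T x\<bar> * norm (D x) * (a + b) / ?k"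
      proof (intro divide_right_mono mult_right_mono)
        have "T x * (b - a) \<le> \<bar>T x\<bar> * \<bar>b - a\<bar>" using abs_ge_self[of "T x * (b - a)"] by (simp add: abs_mult)
        also have "\<dots> \<le> \<bar>T x\<bar> * norm (D x)" by (intro mult_left_mono ab) simp
        finally show "T x * (b - a) \<le> \<bar>T x\<bar> * norm (D x)" .
      qed (use h[of n] in \<open>auto simp: a_def b_def\<close>)
      also have "\<dots> = d * \<bar>T x\<bar> * a + d * \<bar>T x\<bar> * b" by (simp add: d_def ring_distribs add_divide_distrib mult_ac)
      also have "\<dots> \<le> t * d\<^sup>2 + 1 / (2 * t) * ((T x)\<^sup>2 * a\<^sup>2 + (T x)\<^sup>2 * b\<^sup>2)"
        using young[of a] young[of b] by (simp add: algebra_simps)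
      finally show "(1 / ?k) * (T x * f x - T x * f (x + ?k *\<^sub>R e))
          \<le> t / ?k\<^sup>2 * (norm (D x))\<^sup>2 + 1 / (2 * t) * ((T x)\<^sup>2 * f (x + ?k *\<^sub>R e) + (T x)\<^sup>2 * f x)"
        by (simp add: a_def b_def d_def f_def power_divide)
    qed (use i2 i3 i5 i6 iD in auto)
    also have "\<dots> = t / ?k\<^sup>2 * (\<integral>x. (norm (D x))\<^sup>2 \<partial>lborel)
        + 1 / (2 * t) * ((\<integral>x. (T x)\<^sup>2 * f (x + ?k *\<^sub>R e) \<partial>lborel) + (\<integral>x. (T x)\<^sup>2 * f x \<partial>lborel))"
      using i5 i6 iD by simp
    also have "(\<integral>x. (T x)\<^sup>2 * f (x + ?k *\<^sub>R e) \<partial>lborel) = (\<integral>x. (T (x - ?k *\<^sub>R e))\<^sup>2 * f x \<partial>lborel)"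
      using integral_translate[of "\<lambda>x. (T (x - ?k *\<^sub>R e))\<^sup>2 * f x" "?k *\<^sub>R e"] by simp
    also have "t / ?k\<^sup>2 * (\<integral>x. (norm (D x))\<^sup>2 \<partial>lborel) \<le> t * (\<integral>x. (norm (v x))\<^sup>2 \<partial>lborel)"
      using mult_left_mono[OF D2, of "t / ?k\<^sup>2"] t h[of n] by simp
    finally show ?thesis by simp
  qed
  have J_lim: "J \<longlonglongrightarrow> (\<integral>x. T' x * f x \<partial>lborel)"
    unfolding J_def
  proof (rule integral_dominated_convergence)
    show "integrable lborel (\<lambda>x. C * f x)" using intf by simp
    show "AE x in lborel. (\<lambda>n. (T x - T (x - h n *\<^sub>R e)) / h n * f x) \<longlonglongrightarrow> T' x * f x"
    proof (intro AE_I2 tendsto_mult tendsto_const)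
      fix x
      have D: "((\<lambda>s. (T (x + s *\<^sub>R e) - T x) / s) \<longlongrightarrow> T' x) (at 0)"
        using deriv[of x] by (simp add: has_field_derivative_iff e_def)
      have "filterlim (\<lambda>n. - h n) (at 0) sequentially"
        using tendsto_minus[OF h0] h by (intro filterlim_atI) (auto simp: less_imp_neq less_imp_neq[symmetric])
      from filterlim_compose[OF D this]
      show "(\<lambda>n. (T x - T (x - h n *\<^sub>R e)) / h n) \<longlonglongrightarrow> T' x"
        by (simp add: minus_divide_left[symmetric] diff_divide_distrib)
    qed
    show "AE x in lborel. norm ((T x - T (x - h n *\<^sub>R e)) / h n * f x) \<le> C * f x" for n
    proof (rule AE_I2)
      fix x
      have "\<exists>z. - h n < z \<and> z < 0 \<and> T (x + 0 *\<^sub>R e) - T (x + (- h n) *\<^sub>R e) = (0 - (- h n)) * T' (x + z *\<^sub>R e)"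
        by (rule MVT2) (use h[of n] line in auto)
      then obtain z where "T x - T (x - h n *\<^sub>R e) = h n * T' (x + z *\<^sub>R e)" by auto
      then have "\<bar>(T x - T (x - h n *\<^sub>R e)) / h n\<bar> \<le> C" using C h[of n] by simp
      then show "norm ((T x - T (x - h n *\<^sub>R e)) / h n * f x) \<le> C * f x"
        using mult_right_mono[OF _ f0[of x]] f0[of x]
        by (simp only: real_norm_def abs_mult[of _ "f x"] abs_of_nonneg)
    qed
  qed measurable
  have T_lim: "(\<lambda>n. \<integral>x. (T (x - h n *\<^sub>R e))\<^sup>2 * f x \<partial>lborel) \<longlonglongrightarrow> (\<integral>x. (T x)\<^sup>2 * f x \<partial>lborel)"
  proof (rule integral_dominated_convergence)
    show "integrable lborel (\<lambda>x. B\<^sup>2 * f x)" using intf by simp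
    show "AE x in lborel. (\<lambda>n. (T (x - h n *\<^sub>R e))\<^sup>2 * f x) \<longlonglongrightarrow> (T x)\<^sup>2 * f x"
    proof (intro AE_I2 tendsto_intros)
      fix x
      have "isCont (\<lambda>s. T (x + s *\<^sub>R e)) 0" using line[of x 0] by (rule DERIV_isCont)
      moreover have "(\<lambda>n. - h n) \<longlonglongrightarrow> 0" using tendsto_minus[OF h0] by simp
      ultimately have "(\<lambda>n. T (x + (- h n) *\<^sub>R e)) \<longlonglongrightarrow> T (x + 0 *\<^sub>R e)"
        by (rule isCont_tendsto_compose)
      then show "(\<lambda>n. T (x - h n *\<^sub>R e)) \<longlonglongrightarrow> T x" by simp
    qed
    show "AE x in lborel. norm ((T (x - h n *\<^sub>R e))\<^sup>2 * f x) \<le> B\<^sup>2 * f x" for n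
      using T2 f0 by (auto simp: abs_mult intro!: mult_right_mono)
  qed measurable
  have "(\<integral>x. T' x * f x \<partial>lborel) \<le> t * (\<integral>x. (norm (v x))\<^sup>2 \<partial>lborel)
      + 1 / (2 * t) * ((\<integral>x. (T x)\<^sup>2 * f x \<partial>lborel) + (\<integral>x. (T x)\<^sup>2 * f x \<partial>lborel))"
    by (rule LIMSEQ_le[OF J_lim tendsto_add[OF tendsto_const
          tendsto_mult[OF tendsto_const tendsto_add[OF T_lim tendsto_const]]]]) (use J_le in blast)
  then show ?thesis by (simp add: f_def)
qed

section \<open>Monotone transport onto a truncated density\<close>

text \<open>
  Continuity of the density makes the distribution function differentiable everywhere and not only
  almost everywhere; this is why the potentials below are continuous at first.
\<close>

lemma cdf_has_real_derivative:
  fixes k :: "real \<Rightarrow> real"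
  assumes cont: "continuous_on UNIV k" and int: "integrable lborel k"
  shows "((\<lambda>r. \<integral>s. indicator {..r} s * k s \<partial>lborel) has_real_derivative k r) (at r)"
proof -
  let ?K = "\<lambda>r. \<integral>s. indicator {..r} s * k s \<partial>lborel"
  obtain g where g: "\<And>x. x \<in> {r - 1..r + 1} \<Longrightarrow> (g has_vector_derivative k x) (at x within {r - 1..r + 1})"
    using antiderivative_continuous[of "r - 1" "r + 1" k] continuous_on_subset[OF cont subset_UNIV] by metis
  have eq: "?K x = g x + (?K (r - 1) - g (r - 1))" if x: "x \<in> {r - 1..r + 1}" for x
  proof -
    have i: "integrable lborel (\<lambda>s. indicator A s * k s)" if "A \<in> sets borel" for A
      using integrable_mult_indicator[OF _ int, of A] that by simp
    have "(\<integral>s. indicator {r - 1..x} s *\<^sub>R k s \<partial>lborel) = g x - g (r - 1)"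
    proof (rule integral_FTC_Icc)
      fix y assume "r - 1 \<le> y" "y \<le> x"
      then show "(g has_vector_derivative k y) (at y within {r - 1..x})"
        using x by (intro has_vector_derivative_within_subset[OF g]) auto
    qed (use x in simp, rule continuous_on_subset[OF cont subset_UNIV])
    moreover have "(\<integral>s. indicator {..x} s * k s \<partial>lborel)
        = (\<integral>s. indicator {..r - 1} s * k s + indicator {r - 1..x} s * k s \<partial>lborel)"
    proof (rule integral_cong_AE)
      show "AE s in lborel. indicator {..x} s * k s = indicator {..r - 1} s * k s + indicator {r - 1..x} s * k s"
        using AE_lborel_singleton[of "r - 1"] by eventually_elim (use x in \<open>auto split: split_indicator\<close>)
    qed (use borel_measurable_integrable[OF int] in measurable)
    ultimately show ?thesis using i by simp
  qed
  have "(g has_real_derivative k r) (at r)"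
    using g[of r] at_within_Icc_at[of "r - 1" r "r + 1"]
    by (simp add: has_real_derivative_iff_has_vector_derivative)
  then have "((\<lambda>x. g x + (?K (r - 1) - g (r - 1))) has_real_derivative k r) (at r)"
    by (auto intro!: derivative_eq_intros)
  then show ?thesis
    by (rule has_field_derivative_transform_within_open[where S="{r - 1<..<r + 1}"])
       (simp_all only: open_greaterThanLessThan greaterThanLessThan_iff, simp_all, rule eq[symmetric], simp)
qed

lemma cdf_strict_mono:
  fixes k :: "real \<Rightarrow> real"
  assumes cont: "continuous_on UNIV k" and int: "integrable lborel k" and pos: "\<And>s. k s > 0" and "r < r'"
  shows "(\<integral>s. indicator {..r} s * k s \<partial>lborel) < (\<integral>s. indicator {..r'} s * k s \<partial>lborel)"
  by (rule DERIV_pos_imp_increasing[OF \<open>r < r'\<close>]) (use cdf_has_real_derivative[OF cont int] pos in blast)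

lemma cdf_bounds:
  fixes k :: "real \<Rightarrow> real"
  assumes cont: "continuous_on UNIV k" and int: "integrable lborel k" and pos: "\<And>s. k s > 0"
  shows "0 < (\<integral>s. indicator {..r} s * k s \<partial>lborel)"
    and "(\<integral>s. indicator {..r} s * k s \<partial>lborel) < (\<integral>s. k s \<partial>lborel)"
proof -
  have i: "integrable lborel (\<lambda>s. indicator {..r} s * k s)" for r
    using integrable_mult_indicator[OF _ int, of "{..r}"] by simp
  have "0 \<le> (\<integral>s. indicator {..r - 1} s * k s \<partial>lborel)"
    using pos by (intro Bochner_Integration.integral_nonneg) (auto intro!: mult_nonneg_nonneg simp: less_imp_le)
  also have "\<dots> < (\<integral>s. indicator {..r} s * k s \<partial>lborel)"
    by (rule cdf_strict_mono[OF cont int pos]) simp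
  finally show "0 < (\<integral>s. indicator {..r} s * k s \<partial>lborel)" .
  have "(\<integral>s. indicator {..r} s * k s \<partial>lborel) < (\<integral>s. indicator {..r + 1} s * k s \<partial>lborel)"
    by (rule cdf_strict_mono[OF cont int pos]) simp
  also have "\<dots> \<le> (\<integral>s. k s \<partial>lborel)"
    using pos by (intro integral_mono i int) (auto intro: less_imp_le split: split_indicator)
  finally show "(\<integral>s. indicator {..r} s * k s \<partial>lborel) < (\<integral>s. k s \<partial>lborel)" .
qed

text \<open>
  \<open>P\<close> is the distribution function of \<open>g\<close> restricted to \<open>[-R, R]\<close> and normalized, continued strictly
  increasingly to the whole line, and \<open>Q\<close> is its inverse. Truncating the target keeps the transport
  map \<open>Q\<close> bounded, as the integration by parts inequality requires, at the price of the factor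
  \<open>\<kappa>\<close>, which tends to \<open>1\<close> with growing \<open>R\<close> if \<open>g\<close> is a probability density.
\<close>

lemma truncated_quantile:
  fixes g :: "real \<Rightarrow> real" and R :: real
  assumes cont: "continuous_on UNIV g" and int: "integrable lborel g" and pos: "\<And>s. g s > 0" and R: "R > 0"
  defines "\<kappa> \<equiv> \<integral>s. indicator {- R<..R} s * g s \<partial>lborel"
  shows "\<exists>P Q. strict_mono P \<and> 0 < \<kappa> \<and> (\<forall>p. 0 < p \<and> p < 1 \<longrightarrow>
    P (Q p) = p \<and> \<bar>Q p\<bar> \<le> R \<and> (Q has_real_derivative \<kappa> / g (Q p)) (at p))"
proof -
  define K where "K r = (\<integral>s. indicator {..r} s * g s \<partial>lborel)" for r
  have i: "integrable lborel (\<lambda>s. indicator A s * g s)" if "A \<in> sets borel" for A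
    using integrable_mult_indicator[OF _ int, of A] that by simp
  have "K R = (\<integral>s. indicator {..- R} s * g s + indicator {- R<..R} s * g s \<partial>lborel)"
    unfolding K_def using R by (intro Bochner_Integration.integral_cong refl) (auto split: split_indicator)
  then have kappa: "\<kappa> = K R - K (- R)" using i by (simp add: K_def \<kappa>_def)
  have K_mono: "K r < K r'" if "r < r'" for r r'
    unfolding K_def by (rule cdf_strict_mono[OF cont int pos that])
  have kpos: "\<kappa> > 0" using K_mono[of "- R" R] R kappa by simp
  define P where "P r = (K r - K (- R)) / \<kappa>" for r
  have P_mono: "strict_mono P"
    using K_mono kpos by (auto simp: strict_mono_def P_def divide_strict_right_mono)
  have P_deriv: "(P has_real_derivative g r / \<kappa>) (at r)" for r
    unfolding P_def K_def
    using DERIV_cdivide[OF DERIV_diff[OF cdf_has_real_derivative[OF cont int, of r] DERIV_const]] by simp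
  define Q where "Q = inv P"
  have QP: "Q (P r) = r" for r
    unfolding Q_def using strict_mono_imp_inj_on[OF P_mono] by (rule inv_f_f)
  have ex: "\<exists>r. - R \<le> r \<and> r \<le> R \<and> P r = p" if "0 < p" "p < 1" for p
  proof (rule IVT')
    show "P (- R) \<le> p" "p \<le> P R" using that kpos by (simp_all add: P_def kappa[symmetric])
    show "continuous_on {- R..R} P"
      by (intro continuous_at_imp_continuous_on ballI DERIV_isCont[OF P_deriv])
  qed (use R in simp)
  have PQ: "P (Q p) = p" and Q_le: "\<bar>Q p\<bar> \<le> R" if p: "0 < p" "p < 1" for p
  proof -
    obtain r where r: "- R \<le> r" "r \<le> R" "P r = p" using ex[OF p] by blast
    have "Q p = r" using QP[of r] r(3) by simp
    then show "P (Q p) = p" "\<bar>Q p\<bar> \<le> R" using r by (auto simp: abs_le_iff)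
  qed
  have QD: "(Q has_real_derivative \<kappa> / g (Q p)) (at p)" if p: "0 < p" "p < 1" for p
  proof -
    have "isCont Q (P (Q p))"
      by (rule isCont_inverse_function[of 1]) (simp_all only: zero_less_one QP DERIV_isCont[OF P_deriv])
    then have "isCont Q p" using PQ[OF p] by simp
    then have "(Q has_real_derivative inverse (g (Q p) / \<kappa>)) (at p)"
      by (intro DERIV_inverse_function[OF P_deriv _ p PQ]) (use pos[of "Q p"] kpos in auto)
    then show ?thesis by simp
  qed
  show ?thesis using P_mono kpos PQ Q_le QD by blast
qed

section \<open>Integrating out one coordinate\<close>

text \<open>
  The normal density of variance \<open>1/(2a)\<close>. With \<open>a = \<gamma>\<close> it is, coordinate by coordinate, the normalized
  square of the Gaussian state.
\<close>

definition gauss :: "real \<Rightarrow> real \<Rightarrow> real" where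
  "gauss a s = sqrt (a / pi) * exp (- a * s\<^sup>2)"

lemma gauss_eq_normal_density:
  assumes "a > 0" shows "gauss a = normal_density 0 (1 / sqrt (2 * a))"
  using assms by (intro ext) (simp add: gauss_def normal_density_def power_divide real_sqrt_divide field_simps)

lemma gauss_pos: "a > 0 \<Longrightarrow> gauss a s > 0"
  by (simp add: gauss_def)

lemma gauss_nonneg: "a > 0 \<Longrightarrow> gauss a s \<ge> 0"
  by (simp add: gauss_def)

lemma continuous_gauss: "continuous_on A (gauss a)"
  unfolding gauss_def by (intro continuous_intros)

lemma gauss_measurable [measurable]: "gauss a \<in> borel_measurable borel"
  by (intro borel_measurable_continuous_onI continuous_gauss)

lemma gauss_integrable: "a > 0 \<Longrightarrow> integrable lborel (gauss a)"
  by (simp add: gauss_eq_normal_density)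

lemma gauss_integral: "a > 0 \<Longrightarrow> (\<integral>s. gauss a s \<partial>lborel) = 1"
  by (simp add: gauss_eq_normal_density)

lemma nn_gauss_integral: "a > 0 \<Longrightarrow> (\<integral>\<^sup>+s. ennreal (gauss a s) \<partial>lborel) = 1"
  by (simp add: nn_integral_eq_integral gauss_integrable gauss_nonneg gauss_integral)

lemma integrable_bounded_gauss:
  assumes "a > 0" "w \<in> borel_measurable borel" "\<And>s. \<bar>w s\<bar> \<le> K"
  shows "integrable lborel (\<lambda>s. w s * gauss a s)"
  by (rule integrable_bounded_mult[OF gauss_integrable[OF assms(1)] assms(2,3)])

definition set_coord :: "'n \<Rightarrow> real^'n::finite \<Rightarrow> real \<Rightarrow> real^'n" where
  "set_coord i x s = x + (s - x $ i) *\<^sub>R axis i 1"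

lemma set_coord_nth: "set_coord i x s $ j = (if j = i then s else x $ j)"
  by (simp add: set_coord_def axis_def)

lemma set_coord_line: "set_coord i (x + r *\<^sub>R axis i 1) s = set_coord i x s"
  by (simp add: vec_eq_iff set_coord_nth) (simp add: axis_def)

lemma set_coord_self: "set_coord i x (x $ i) = x"
  by (simp add: set_coord_def)

text \<open>
  The logarithm of the mean of \<open>exp V\<close> when the \<open>i\<close>-th coordinate is resampled from \<^const>\<open>gauss\<close>. The
  difference \<open>V - coord_log_mean a i V\<close> is the logarithm of a probability density in the \<open>i\<close>-th
  coordinate relative to \<^const>\<open>gauss\<close>.
\<close>

definition coord_log_mean :: "real \<Rightarrow> 'n \<Rightarrow> (real^'n::finite \<Rightarrow> real) \<Rightarrow> real^'n \<Rightarrow> real" where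
  "coord_log_mean a i V x = ln (\<integral>s. exp (V (set_coord i x s)) * gauss a s \<partial>lborel)"

lemma coord_mean_bounds:
  assumes a: "a > 0" and V: "continuous_on UNIV V" "\<And>x. \<bar>V x\<bar> \<le> B"
  shows "integrable lborel (\<lambda>s. exp (V (set_coord i x s)) * gauss a s)" (is ?i)
    and "exp (- B) \<le> (\<integral>s. exp (V (set_coord i x s)) * gauss a s \<partial>lborel)" (is ?l)
    and "(\<integral>s. exp (V (set_coord i x s)) * gauss a s \<partial>lborel) \<le> exp B" (is ?u)
proof -
  have b: "exp (- B) \<le> exp (V y)" "exp (V y) \<le> exp B" for y
    using V(2)[of y] by (simp_all add: abs_le_iff)
  have [measurable]: "V \<in> borel_measurable borel" by (rule borel_measurable_continuous_onI[OF V(1)])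
  show i: ?i
    by (rule integrable_bounded_gauss[OF a, where K="exp B"]) (use b(2) in \<open>auto simp: set_coord_def\<close>)
  have "exp (- B) = (\<integral>s. exp (- B) * gauss a s \<partial>lborel)" using gauss_integral[OF a] by simp
  also have "\<dots> \<le> (\<integral>s. exp (V (set_coord i x s)) * gauss a s \<partial>lborel)"
    by (intro integral_mono i) (use a b gauss_integrable gauss_nonneg in \<open>auto intro!: mult_right_mono\<close>)
  finally show ?l .
  have "(\<integral>s. exp (V (set_coord i x s)) * gauss a s \<partial>lborel) \<le> (\<integral>s. exp B * gauss a s \<partial>lborel)"
    by (intro integral_mono i) (use a b gauss_integrable gauss_nonneg in \<open>auto intro!: mult_right_mono\<close>)
  also have "\<dots> = exp B" using gauss_integral[OF a] by simp
  finally show ?u .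
qed

lemma coord_log_mean_bounded:
  assumes "a > 0" "continuous_on UNIV V" "\<And>x. \<bar>V x\<bar> \<le> B"
  shows "\<bar>coord_log_mean a i V x\<bar> \<le> B"
proof -
  let ?Z = "\<integral>s. exp (V (set_coord i x s)) * gauss a s \<partial>lborel"
  have Z: "exp (- B) \<le> ?Z" "?Z \<le> exp B" using coord_mean_bounds[OF assms] by auto
  have "?Z > 0" using Z(1) exp_gt_zero[of "- B"] by linarith
  then have "ln (exp (- B)) \<le> ln ?Z" "ln ?Z \<le> ln (exp B)" using Z by (auto simp del: ln_exp)
  then show ?thesis by (simp add: coord_log_mean_def abs_le_iff)
qed

lemma exp_coord_log_mean:
  assumes "a > 0" "continuous_on UNIV V" "\<And>x. \<bar>V x\<bar> \<le> B"
  shows "exp (coord_log_mean a i V x) = (\<integral>s. exp (V (set_coord i x s)) * gauss a s \<partial>lborel)"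
  using less_le_trans[OF exp_gt_zero coord_mean_bounds(2)[OF assms, of i x]]
  by (simp add: coord_log_mean_def)

lemma coord_log_mean_continuous:
  assumes a: "a > 0" and V: "continuous_on UNIV V" "\<And>x. \<bar>V x\<bar> \<le> B"
  shows "continuous_on UNIV (coord_log_mean a i V)"
proof -
  let ?Z = "\<lambda>x. \<integral>s. exp (V (set_coord i x s)) * gauss a s \<partial>lborel"
  have [measurable]: "V \<in> borel_measurable borel" by (rule borel_measurable_continuous_onI[OF V(1)])
  have "continuous_on UNIV ?Z"
  proof (clarsimp simp: continuous_on_sequentially o_def)
    fix X :: "nat \<Rightarrow> real^'a" and x assume X: "X \<longlonglongrightarrow> x"
    show "(\<lambda>n. ?Z (X n)) \<longlonglongrightarrow> ?Z x"
    proof (rule integral_dominated_convergence)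
      show "integrable lborel (\<lambda>s. exp B * gauss a s)" using gauss_integrable[OF a] by simp
      show "AE s in lborel. (\<lambda>n. exp (V (set_coord i (X n) s)) * gauss a s) \<longlonglongrightarrow> exp (V (set_coord i x s)) * gauss a s"
      proof (intro AE_I2 tendsto_intros)
        fix s
        have "(\<lambda>n. set_coord i (X n) s) \<longlonglongrightarrow> set_coord i x s"
          unfolding set_coord_def by (intro tendsto_intros X)
        then show "(\<lambda>n. V (set_coord i (X n) s)) \<longlonglongrightarrow> V (set_coord i x s)"
          using V(1) by (auto simp: continuous_on_eq_continuous_at intro: isCont_tendsto_compose)
      qed
      show "AE s in lborel. norm (exp (V (set_coord i (X n) s)) * gauss a s) \<le> exp B * gauss a s" for n
        using V(2) gauss_nonneg[OF a] by (auto simp: abs_le_iff abs_mult intro!: mult_right_mono)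
    qed (simp_all add: set_coord_def)
  qed
  moreover have "?Z x \<noteq> 0" for x
    using coord_mean_bounds(2)[OF a V, of i x] exp_gt_zero[of "- B"] by linarith
  ultimately show ?thesis
    unfolding coord_log_mean_def[abs_def] by (intro continuous_on_ln) auto
qed

section \<open>The logarithmic Sobolev inequality in one coordinate\<close>

text \<open>
  Let \<open>T\<close> transport, along each line in direction \<open>i\<close>, the probability density \<open>exp (V - W) gauss\<close> to the
  density \<open>gauss\<close> truncated to \<open>[-R, R]\<close>, where \<open>W = coord_log_mean a i V\<close>. The change of variables
  formula reads \<open>\<partial>\<^sub>iT = \<kappa> exp (V - W - a x\<^sub>i\<^sup>2 + a T\<^sup>2)\<close>, so
  \<open>V - W = ln \<partial>\<^sub>iT - ln \<kappa> + a x\<^sub>i\<^sup>2 - a T\<^sup>2 \<le> \<partial>\<^sub>iT - 1 - ln \<kappa> + a x\<^sub>i\<^sup>2 - a T\<^sup>2\<close>.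
  Integrating against \<open>|u|\<^sup>2\<close>, the integration by parts inequality with \<open>t = 1/a\<close> absorbs the term \<open>- a T\<^sup>2\<close>.
\<close>

lemma coordinate_log_sobolev_truncated:
  fixes u v :: "real^'n::finite \<Rightarrow> complex" and V :: "real^'n \<Rightarrow> real"
  assumes u: "L2 u" and v: "L2 v" and a: "a > 0" and R: "R > 0"
    and weak: "has_weak_partial_deriv i u v"
    and xu: "integrable lborel (\<lambda>x. (x $ i)\<^sup>2 * (norm (u x))\<^sup>2)"
    and V: "continuous_on UNIV V" "\<And>x. \<bar>V x\<bar> \<le> B"
  shows "(\<integral>x. (V x - coord_log_mean a i V x) * (norm (u x))\<^sup>2 \<partial>lborel)
      \<le> (1 / a) * (\<integral>x. (norm (v x))\<^sup>2 \<partial>lborel) + a * (\<integral>x. (x $ i)\<^sup>2 * (norm (u x))\<^sup>2 \<partial>lborel)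
        - (1 + ln (\<integral>s. indicator {- R<..R} s * gauss a s \<partial>lborel)) * (\<integral>x. (norm (u x))\<^sup>2 \<partial>lborel)"
proof -
  note [measurable] = u[THEN L2_measurable] v[THEN L2_measurable]
  have Vm[measurable]: "V \<in> borel_measurable borel" by (rule borel_measurable_continuous_onI[OF V(1)])
  define W where "W = coord_log_mean a i V"
  have W: "continuous_on UNIV W" "\<And>x. \<bar>W x\<bar> \<le> B"
    unfolding W_def using coord_log_mean_continuous[OF a V] coord_log_mean_bounded[OF a V] by auto
  have [measurable]: "W \<in> borel_measurable borel" by (rule borel_measurable_continuous_onI[OF W(1)])
  define f where "f x = (norm (u x))\<^sup>2" for x
  have f0: "f x \<ge> 0" for x by (simp add: f_def)
  have [measurable]: "f \<in> borel_measurable borel" unfolding f_def by measurable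
  have intf: "integrable lborel f" using u by (simp add: L2_def f_def[abs_def])
  note intbf = integrable_bounded_mult[OF intf]
  define \<kappa> where "\<kappa> = (\<integral>s. indicator {- R<..R} s * gauss a s \<partial>lborel)"
  obtain P Q where P: "strict_mono P" and PQ: "\<And>p. 0 < p \<Longrightarrow> p < 1 \<Longrightarrow> P (Q p) = p"
    and Q_le: "\<And>p. 0 < p \<Longrightarrow> p < 1 \<Longrightarrow> \<bar>Q p\<bar> \<le> R"
    and Q_deriv: "\<And>p. 0 < p \<Longrightarrow> p < 1 \<Longrightarrow> (Q has_real_derivative \<kappa> / gauss a (Q p)) (at p)"
    and kpos: "0 < \<kappa>"
    using truncated_quantile[OF continuous_gauss gauss_integrable[OF a] gauss_pos[OF a] R]
    unfolding \<kappa>_def by blast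
  define k where "k x s = exp (V (set_coord i x s)) * gauss a s" for x s
  have k_cont: "continuous_on UNIV (k x)" for x
    unfolding k_def set_coord_def
    by (intro continuous_intros continuous_gauss continuous_on_compose2[OF V(1)]) auto
  have k_int: "integrable lborel (k x)" for x
    unfolding k_def[abs_def] using coord_mean_bounds(1)[OF a V] by simp
  have k_pos: "k x s > 0" for x s by (simp add: k_def gauss_pos[OF a])
  have expW: "exp (W x) = (\<integral>s. k x s \<partial>lborel)" for x
    unfolding W_def k_def by (rule exp_coord_log_mean[OF a V])
  define F where "F x = (\<integral>s. indicator {..x $ i} s * k x s \<partial>lborel) / exp (W x)" for x
  have F: "0 < F x" "F x < 1" for x
    using cdf_bounds[OF k_cont k_int k_pos] by (simp_all add: F_def expW[symmetric])
  have [measurable]: "F \<in> borel_measurable borel"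
  proof -
    define S where "S = {z :: (real^'n) \<times> real. snd z \<le> fst z $ i}"
    have [measurable]: "S \<in> sets borel"
      unfolding S_def by (intro borel_closed closed_Collect_le continuous_intros)
    have "continuous_on UNIV (\<lambda>z. k (fst z) (snd z))"
      unfolding k_def set_coord_def
      by (intro continuous_intros continuous_on_compose2[OF continuous_gauss[of UNIV]]
          continuous_on_compose2[OF V(1)]) auto
    then have [measurable]: "(\<lambda>z. k (fst z) (snd z)) \<in> borel_measurable borel"
      by (rule borel_measurable_continuous_onI)
    have "(\<lambda>z. indicator S z * k (fst z) (snd z)) \<in> borel_measurable (borel \<Otimes>\<^sub>M borel)"
      unfolding borel_prod by measurable
    then have "(\<lambda>(x, s). indicator {..x $ i} s * k x s) \<in> borel_measurable (borel \<Otimes>\<^sub>M lborel)"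
      by (simp add: S_def indicator_def case_prod_beta' cong: measurable_cong_sets)
    then have [measurable]: "(\<lambda>x. \<integral>s. indicator {..x $ i} s * k x s \<partial>lborel) \<in> borel_measurable borel"
      by (rule lborel.borel_measurable_lebesgue_integral)
    show ?thesis unfolding F_def by measurable
  qed
  define T where "T x = Q (F x)" for x
  have T_le: "\<bar>T x\<bar> \<le> R" for x using Q_le[OF F] by (simp add: T_def)
  have [measurable]: "T \<in> borel_measurable borel"
  proof (rule borel_measurable_iff_le[THEN iffD2], clarsimp)
    fix c
    \<comment> \<open>As P is increasing, sublevel sets of T are sublevel sets of F.\<close>
    have "T x \<le> c \<longleftrightarrow> F x \<le> P c" for x
      using strict_mono_less_eq[OF P, of "T x" c] PQ[OF F] by (simp add: T_def)
    then show "{x. T x \<le> c} \<in> sets borel" by simp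
  qed
  \<comment> \<open>The derivative of T, written so that boundedness and the logarithm can be read off.\<close>
  define T' where "T' x = \<kappa> * exp (V x - W x - a * (x $ i)\<^sup>2 + a * (T x)\<^sup>2)" for x
  have [measurable]: "T' \<in> borel_measurable borel" unfolding T'_def by measurable
  have T'_bound: "\<bar>T' x\<bar> \<le> \<kappa> * exp (2 * B + a * R\<^sup>2)" for x
  proof -
    have "(T x)\<^sup>2 \<le> R\<^sup>2" using power_mono[OF T_le[of x], of 2] by simp
    then have "a * (T x)\<^sup>2 \<le> a * R\<^sup>2" using a by simp
    moreover have "V x - W x \<le> 2 * B" using V(2)[of x] W(2)[of x] by (simp add: abs_le_iff)
    moreover have "0 \<le> a * (x $ i)\<^sup>2" using a by simp
    ultimately have "V x - W x - a * (x $ i)\<^sup>2 + a * (T x)\<^sup>2 \<le> 2 * B + a * R\<^sup>2" by linarith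
    then show ?thesis using kpos by (simp add: T'_def abs_mult)
  qed
  have deriv: "((\<lambda>s. T (x + s *\<^sub>R axis i 1)) has_real_derivative T' x) (at 0)" for x
  proof -
    have Wline: "W (x + s *\<^sub>R axis i 1) = W x" for s
      by (simp add: W_def coord_log_mean_def set_coord_line)
    have kline: "k (x + s *\<^sub>R axis i 1) = k x" for s
      by (intro ext) (simp add: k_def set_coord_line)
    have Feq: "F (x + s *\<^sub>R axis i 1) = (\<integral>r. indicator {..x $ i + s} r * k x r \<partial>lborel) / exp (W x)" for s
    proof -
      have "(x + s *\<^sub>R axis i 1) $ i = x $ i + s" by (simp add: axis_def)
      then show ?thesis by (simp only: F_def Wline kline)
    qed
    have "((\<lambda>s. \<integral>r. indicator {..x $ i + s} r * k x r \<partial>lborel) has_real_derivative k x (x $ i)) (at 0)"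
      using DERIV_shift[of "\<lambda>s. \<integral>r. indicator {..s} r * k x r \<partial>lborel" "k x (x $ i)" 0 "x $ i"]
        cdf_has_real_derivative[OF k_cont k_int, of x "x $ i"] by (simp add: add.commute)
    then have "((\<lambda>s. F (x + s *\<^sub>R axis i 1)) has_real_derivative k x (x $ i) / exp (W x)) (at 0)"
      unfolding Feq by (rule DERIV_cdivide)
    then have "((\<lambda>s. T (x + s *\<^sub>R axis i 1)) has_real_derivative
        \<kappa> / gauss a (Q (F x)) * (k x (x $ i) / exp (W x))) (at 0)"
      unfolding T_def using Q_deriv[OF F] by (intro DERIV_chain2[of Q]) auto
    moreover have "\<kappa> / gauss a (Q (F x)) * (k x (x $ i) / exp (W x)) = T' x"
      using a by (simp add: T'_def k_def set_coord_self gauss_def T_def exp_diff exp_add exp_minus field_simps)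
    ultimately show ?thesis by simp
  qed
  have main: "(\<integral>x. T' x * f x \<partial>lborel) \<le> (1 / a) * (\<integral>x. (norm (v x))\<^sup>2 \<partial>lborel) + a * (\<integral>x. (T x)\<^sup>2 * f x \<partial>lborel)"
    using weak_integration_by_parts_le[OF u v _ weak, of "1 / a" T T' R, OF _ _ _ T_le T'_bound deriv] a
    by (simp add: f_def)
  have T2: "\<bar>(T x)\<^sup>2\<bar> \<le> R\<^sup>2" for x
    using power_mono[OF T_le[of x], of 2] by simp
  have VW: "\<bar>V x - W x\<bar> \<le> 2 * B" for x using V(2)[of x] W(2)[of x] by (simp add: abs_le_iff)
  have i1: "integrable lborel (\<lambda>x. T' x * f x)" by (rule intbf[OF _ T'_bound]) simp
  have i2: "integrable lborel (\<lambda>x. (T x)\<^sup>2 * f x)" by (rule intbf[OF _ T2]) simp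
  have i3: "integrable lborel (\<lambda>x. (V x - W x) * f x)" by (rule intbf[OF _ VW]) simp
  have i4: "integrable lborel (\<lambda>x. (x $ i)\<^sup>2 * f x)" using xu by (simp add: f_def)
  have "(\<integral>x. (V x - W x) * f x \<partial>lborel)
      \<le> (\<integral>x. T' x * f x + a * ((x $ i)\<^sup>2 * f x) - a * ((T x)\<^sup>2 * f x) - (1 + ln \<kappa>) * f x \<partial>lborel)"
  proof (rule integral_mono)
    fix x
    have "ln (T' x) \<le> T' x - 1"
      using ln_le_minus_one[of "T' x"] kpos by (simp add: T'_def)
    moreover have "ln (T' x) = ln \<kappa> + (V x - W x - a * (x $ i)\<^sup>2 + a * (T x)\<^sup>2)"
      using kpos by (simp add: T'_def ln_mult)
    ultimately have "V x - W x \<le> T' x + a * (x $ i)\<^sup>2 - a * (T x)\<^sup>2 - (1 + ln \<kappa>)" by linarith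
    from mult_right_mono[OF this f0[of x]]
    show "(V x - W x) * f x \<le> T' x * f x + a * ((x $ i)\<^sup>2 * f x) - a * ((T x)\<^sup>2 * f x) - (1 + ln \<kappa>) * f x"
      by (simp add: algebra_simps)
  qed (use i1 i2 i3 i4 intf in auto)
  also have "\<dots> = (\<integral>x. T' x * f x \<partial>lborel) + a * (\<integral>x. (x $ i)\<^sup>2 * f x \<partial>lborel)
      - a * (\<integral>x. (T x)\<^sup>2 * f x \<partial>lborel) - (1 + ln \<kappa>) * (\<integral>x. f x \<partial>lborel)"
    using i1 i2 i4 intf by simp
  also have "\<dots> \<le> (1 / a) * (\<integral>x. (norm (v x))\<^sup>2 \<partial>lborel) + a * (\<integral>x. (x $ i)\<^sup>2 * f x \<partial>lborel)
      - (1 + ln \<kappa>) * (\<integral>x. f x \<partial>lborel)"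
    using main by linarith
  finally show ?thesis by (simp add: f_def W_def \<kappa>_def)
qed

lemma gauss_truncated_mass_tendsto:
  assumes a: "a > 0"
  shows "(\<lambda>n. \<integral>s. indicator {- real (Suc n)<..real (Suc n)} s * gauss a s \<partial>lborel) \<longlonglongrightarrow> 1"
proof -
  have "(\<lambda>n. \<integral>s. indicator {- real (Suc n)<..real (Suc n)} s * gauss a s \<partial>lborel) \<longlonglongrightarrow> (\<integral>s. gauss a s \<partial>lborel)"
  proof (rule integral_dominated_convergence)
    show "AE s in lborel. (\<lambda>n. indicator {- real (Suc n)<..real (Suc n)} s * gauss a s) \<longlonglongrightarrow> gauss a s"
    proof (intro AE_I2 tendsto_eventually)
      fix s :: real
      obtain N :: nat where N: "\<bar>s\<bar> < real N" using reals_Archimedean2 by blast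
      show "eventually (\<lambda>n. indicator {- real (Suc n)<..real (Suc n)} s * gauss a s = gauss a s) sequentially"
        using N by (intro eventually_sequentiallyI[of N]) (auto split: split_indicator)
    qed
    show "AE s in lborel. norm (indicator {- real (Suc n)<..real (Suc n)} s * gauss a s) \<le> gauss a s" for n
      using gauss_nonneg[OF a] by (auto split: split_indicator)
  qed (auto intro: gauss_integrable a)
  then show ?thesis using gauss_integral[OF a] by simp
qed

lemma coordinate_log_sobolev:
  fixes u v :: "real^'n::finite \<Rightarrow> complex" and V :: "real^'n \<Rightarrow> real"
  assumes u: "L2 u" and v: "L2 v" and a: "a > 0"
    and weak: "has_weak_partial_deriv i u v"
    and xu: "integrable lborel (\<lambda>x. (x $ i)\<^sup>2 * (norm (u x))\<^sup>2)"
    and V: "continuous_on UNIV V" "\<And>x. \<bar>V x\<bar> \<le> B"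
  shows "(\<integral>x. (V x - coord_log_mean a i V x) * (norm (u x))\<^sup>2 \<partial>lborel)
      \<le> (1 / a) * (\<integral>x. (norm (v x))\<^sup>2 \<partial>lborel) + a * (\<integral>x. (x $ i)\<^sup>2 * (norm (u x))\<^sup>2 \<partial>lborel)
        - (\<integral>x. (norm (u x))\<^sup>2 \<partial>lborel)"
    (is "?L \<le> ?D - ?m")
proof -
  let ?\<kappa> = "\<lambda>n. \<integral>s. indicator {- real (Suc n)<..real (Suc n)} s * gauss a s \<partial>lborel"
  have "(\<lambda>n. ?D - (1 + ln (?\<kappa> n)) * ?m) \<longlonglongrightarrow> ?D - (1 + ln 1) * ?m"
    by (intro tendsto_intros gauss_truncated_mass_tendsto a) simp
  moreover have "?L \<le> ?D - (1 + ln (?\<kappa> n)) * ?m" for n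
    by (rule coordinate_log_sobolev_truncated[OF u v a _ weak xu V]) simp
  ultimately show ?thesis
    using LIMSEQ_le_const[of "\<lambda>n. ?D - (1 + ln (?\<kappa> n)) * ?m" "?D - ?m" ?L] by simp
qed

section \<open>Tensorization over the coordinates\<close>

definition gauss_prod :: "real \<Rightarrow> real^'n::finite \<Rightarrow> real" where
  "gauss_prod a x = (\<Prod>i\<in>UNIV. gauss a (x $ i))"

lemma gauss_prod_pos: "a > 0 \<Longrightarrow> gauss_prod a x > 0"
  unfolding gauss_prod_def by (intro prod_pos gauss_pos)

lemma gauss_prod_nonneg: "a > 0 \<Longrightarrow> gauss_prod a x \<ge> 0"
  by (rule less_imp_le[OF gauss_prod_pos])

lemma gauss_prod_continuous: "continuous_on A (gauss_prod a)"
  unfolding gauss_prod_def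
  by (intro continuous_intros continuous_on_compose2[OF continuous_gauss[of UNIV]]) auto

lemma gauss_prod_measurable [measurable]: "gauss_prod a \<in> borel_measurable borel"
  by (intro borel_measurable_continuous_onI gauss_prod_continuous)

lemma prod_Basis_vec: "(\<Prod>b\<in>Basis. h (x \<bullet> b)) = (\<Prod>i\<in>UNIV. h ((x::real^'n::finite) $ i))"
proof -
  have B: "(Basis :: (real^'n) set) = range (\<lambda>i. axis i 1)"
    by (auto simp: Basis_vec_def)
  have inj: "inj (\<lambda>i. axis i 1 :: real^'n)"
    by (simp add: inj_on_def axis_eq_axis)
  show ?thesis
    unfolding B prod.reindex[OF inj] o_def by (simp add: cart_eq_inner_axis)
qed

lemma nn_gauss_prod_integral:
  assumes a: "a > 0"
  shows "(\<integral>\<^sup>+x. ennreal (gauss_prod a (x::real^'n::finite)) \<partial>lborel) = 1"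
proof -
  have "(\<integral>\<^sup>+x. ennreal (gauss_prod a (x::real^'n)) \<partial>lborel)
      = (\<integral>\<^sup>+x. (\<Prod>b\<in>Basis. ennreal (gauss a ((x::real^'n) \<bullet> b))) \<partial>lborel)"
    using gauss_nonneg[OF a]
    by (intro nn_integral_cong) (simp add: prod_Basis_vec[of "\<lambda>s. ennreal (gauss a s)"] gauss_prod_def prod_ennreal)
  also have "\<dots> = 1"
    by (subst nn_integral_lborel_prod) (simp_all add: nn_gauss_integral[OF a])
  finally show ?thesis .
qed

lemma gauss_prod_integrable: "a > 0 \<Longrightarrow> integrable lborel (gauss_prod a :: real^'n::finite \<Rightarrow> real)"
  by (rule integrableI_bounded) (simp_all add: gauss_prod_nonneg nn_gauss_prod_integral)

lemma gauss_prod_integral: "a > 0 \<Longrightarrow> (\<integral>x. gauss_prod a (x::real^'n::finite) \<partial>lborel) = 1"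
  by (subst integral_eq_nn_integral) (simp_all add: gauss_prod_nonneg nn_gauss_prod_integral)

text \<open>
  Shifting one coordinate only affects one factor of the product. This identity is the detailed
  balance behind \<open>nn_gauss_prod_resample\<close>.
\<close>

lemma gauss_prod_swap:
  "gauss a (x $ i) * gauss_prod a (x - s *\<^sub>R axis i 1) = gauss_prod a x * gauss a (x $ i - s)"
proof -
  have "gauss_prod a y = gauss a (y $ i) * (\<Prod>j\<in>UNIV - {i}. gauss a (y $ j))" for y :: "real^'a"
    unfolding gauss_prod_def by (rule prod.remove) auto
  moreover have "(\<Prod>j\<in>UNIV - {i}. gauss a ((x - s *\<^sub>R axis i 1) $ j)) = (\<Prod>j\<in>UNIV - {i}. gauss a (x $ j))"
    by (intro prod.cong) (auto simp: axis_def)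
  ultimately show ?thesis by (simp add: axis_def)
qed

text \<open>
  The product measure is invariant under resampling a coordinate. Substituting \<open>s + x\<^sub>i\<close> for \<open>s\<close> turns
  resampling into a shift by \<open>s e\<^sub>i\<close>, which Tonelli's theorem and translation invariance move from \<open>h\<close> to
  the density.
\<close>

lemma nn_gauss_prod_resample:
  fixes h :: "real^'n::finite \<Rightarrow> ennreal"
  assumes a: "a > 0" and h[measurable]: "h \<in> borel_measurable borel"
  shows "(\<integral>\<^sup>+x. (\<integral>\<^sup>+s. h (set_coord i x s) * ennreal (gauss a s) \<partial>lborel) * ennreal (gauss_prod a x) \<partial>lborel)
    = (\<integral>\<^sup>+x. h x * ennreal (gauss_prod a x) \<partial>lborel)"
proof -
  define e :: "real^'n" where "e = axis i 1"
  have nth[measurable]: "(\<lambda>x::real^'n. x $ i) \<in> borel_measurable borel"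
    by (intro borel_measurable_continuous_onI continuous_intros)
  have "(\<integral>\<^sup>+s. h (set_coord i x s) * ennreal (gauss a s) \<partial>lborel)
      = (\<integral>\<^sup>+s. h (x + s *\<^sub>R e) * ennreal (gauss a (s + x $ i)) \<partial>lborel)" for x
    using nn_integral_translate[of "\<lambda>s. h (set_coord i x s) * ennreal (gauss a s)" "x $ i"]
    by (simp add: set_coord_def e_def)
  then have "(\<integral>\<^sup>+x. (\<integral>\<^sup>+s. h (set_coord i x s) * ennreal (gauss a s) \<partial>lborel) * ennreal (gauss_prod a x) \<partial>lborel)
    = (\<integral>\<^sup>+x. \<integral>\<^sup>+s. h (x + s *\<^sub>R e) * ennreal (gauss a (s + x $ i)) * ennreal (gauss_prod a x) \<partial>lborel \<partial>lborel)"
    by (simp add: nn_integral_multc)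
  also have "\<dots> = (\<integral>\<^sup>+s. \<integral>\<^sup>+x. h (x + s *\<^sub>R e) * ennreal (gauss a (s + x $ i)) * ennreal (gauss_prod a x) \<partial>lborel \<partial>lborel)"
    by (rule lborel_pair.Fubini'[symmetric]) measurable
  also have "\<dots> = (\<integral>\<^sup>+s. \<integral>\<^sup>+x. h x * ennreal (gauss a (x $ i)) * ennreal (gauss_prod a (x - s *\<^sub>R e)) \<partial>lborel \<partial>lborel)"
  proof (rule nn_integral_cong)
    fix s
    show "(\<integral>\<^sup>+x. h (x + s *\<^sub>R e) * ennreal (gauss a (s + x $ i)) * ennreal (gauss_prod a x) \<partial>lborel)
      = (\<integral>\<^sup>+x. h x * ennreal (gauss a (x $ i)) * ennreal (gauss_prod a (x - s *\<^sub>R e)) \<partial>lborel)"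
      using nn_integral_translate[of "\<lambda>x. h x * ennreal (gauss a (x $ i)) * ennreal (gauss_prod a (x - s *\<^sub>R e))" "s *\<^sub>R e"]
      by (simp add: e_def add.commute)
  qed
  also have "\<dots> = (\<integral>\<^sup>+s. \<integral>\<^sup>+x. h x * ennreal (gauss_prod a x) * ennreal (gauss a (x $ i - s)) \<partial>lborel \<partial>lborel)"
  proof -
    have "ennreal (gauss a (x $ i)) * ennreal (gauss_prod a (x - s *\<^sub>R e))
        = ennreal (gauss_prod a x) * ennreal (gauss a (x $ i - s))" for x s
      unfolding e_def
      by (simp only: ennreal_mult[OF gauss_nonneg[OF a] gauss_prod_nonneg[OF a], symmetric]
          ennreal_mult[OF gauss_prod_nonneg[OF a] gauss_nonneg[OF a], symmetric] gauss_prod_swap)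
    then show ?thesis by (simp add: mult.assoc)
  qed
  also have "\<dots> = (\<integral>\<^sup>+x. \<integral>\<^sup>+s. h x * ennreal (gauss_prod a x) * ennreal (gauss a (x $ i - s)) \<partial>lborel \<partial>lborel)"
    by (rule lborel_pair.Fubini') measurable
  also have "\<dots> = (\<integral>\<^sup>+x. h x * ennreal (gauss_prod a x) \<partial>lborel)"
  proof (rule nn_integral_cong)
    fix x :: "real^'n"
    have "gauss a (x $ i - s) = gauss a (s + - (x $ i))" for s
      by (simp add: gauss_def power2_commute)
    then have "(\<integral>\<^sup>+s. ennreal (gauss a (x $ i - s)) \<partial>lborel) = 1"
      using nn_integral_translate[of "\<lambda>s. ennreal (gauss a s)" "- (x $ i)"] nn_gauss_integral[OF a] by simp
    then show "(\<integral>\<^sup>+s. h x * ennreal (gauss_prod a x) * ennreal (gauss a (x $ i - s)) \<partial>lborel) = h x * ennreal (gauss_prod a x)"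
      by (simp add: nn_integral_cmult)
  qed
  finally show ?thesis .
qed

lemma integral_exp_coord_log_mean:
  fixes V :: "real^'n::finite \<Rightarrow> real"
  assumes a: "a > 0" and V: "continuous_on UNIV V" "\<And>x. \<bar>V x\<bar> \<le> B"
  shows "(\<integral>x. exp (coord_log_mean a i V x) * gauss_prod a x \<partial>lborel) = (\<integral>x. exp (V x) * gauss_prod a x \<partial>lborel)"
proof -
  have [measurable]: "V \<in> borel_measurable borel" by (rule borel_measurable_continuous_onI[OF V(1)])
  have [measurable]: "coord_log_mean a i V \<in> borel_measurable borel"
    by (rule borel_measurable_continuous_onI[OF coord_log_mean_continuous[OF a V]])
  have "ennreal (exp (coord_log_mean a i V x)) = (\<integral>\<^sup>+s. ennreal (exp (V (set_coord i x s))) * ennreal (gauss a s) \<partial>lborel)" for x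
    using coord_mean_bounds(1)[OF a V, of i x] gauss_nonneg[OF a]
    by (simp add: exp_coord_log_mean[OF a V] nn_integral_eq_integral flip: ennreal_mult)
  then have "(\<integral>\<^sup>+x. ennreal (exp (coord_log_mean a i V x)) * ennreal (gauss_prod a x) \<partial>lborel)
     = (\<integral>\<^sup>+x. ennreal (exp (V x)) * ennreal (gauss_prod a x) \<partial>lborel)"
    using nn_gauss_prod_resample[OF a, of "\<lambda>x. ennreal (exp (V x))" i] by simp
  moreover have enn: "(\<integral>x. exp (w x) * gauss_prod a x \<partial>lborel)
      = enn2real (\<integral>\<^sup>+x. ennreal (exp (w x)) * ennreal (gauss_prod a x) \<partial>lborel)"
    if [measurable]: "w \<in> borel_measurable borel" for w :: "real^'n \<Rightarrow> real"
    by (subst integral_eq_nn_integral) (simp_all add: ennreal_mult gauss_prod_nonneg[OF a])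
  ultimately show ?thesis
    using enn[of V] enn[of "coord_log_mean a i V"] by simp
qed

text \<open>
  Each new coordinate replaces \<open>V'\<close> by \<open>coord_log_mean a i V'\<close>, which is independent of \<open>x\<^sub>i\<close>, stays independent
  of the coordinates already treated, and keeps \<open>\<integral> exp V' gauss_prod\<close> unchanged. The one-coordinate estimates
  then add up by telescoping.
\<close>

lemma iterated_coordinate_log_sobolev:
  fixes u :: "real^'n::finite \<Rightarrow> complex" and g :: "real^'n \<Rightarrow> complex^'n" and V :: "real^'n \<Rightarrow> real"
  assumes u: "L2 u" and g: "\<And>i. L2 (\<lambda>x. g x $ i)" and a: "a > 0"
    and weak: "has_weak_gradient u g"
    and xu: "\<And>i. integrable lborel (\<lambda>x. (x $ i)\<^sup>2 * (norm (u x))\<^sup>2)"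
    and V: "continuous_on UNIV V" "\<And>x. \<bar>V x\<bar> \<le> B"
    and J: "finite J"
  shows "\<exists>V'. continuous_on UNIV V' \<and> (\<forall>x. \<bar>V' x\<bar> \<le> B) \<and>
    (\<forall>x y. (\<forall>i. i \<notin> J \<longrightarrow> x $ i = y $ i) \<longrightarrow> V' x = V' y) \<and>
    (\<integral>x. exp (V' x) * gauss_prod a x \<partial>lborel) = (\<integral>x. exp (V x) * gauss_prod a x \<partial>lborel) \<and>
    (\<integral>x. (V x - V' x) * (norm (u x))\<^sup>2 \<partial>lborel) \<le>
      (\<Sum>i\<in>J. (1 / a) * (\<integral>x. (norm (g x $ i))\<^sup>2 \<partial>lborel) + a * (\<integral>x. (x $ i)\<^sup>2 * (norm (u x))\<^sup>2 \<partial>lborel)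
        - (\<integral>x. (norm (u x))\<^sup>2 \<partial>lborel))"
  using J
proof (induction J rule: finite_induct)
  case empty
  show ?case
  proof (intro exI[of _ V] conjI allI impI)
    fix x y :: "real^'n" assume "\<forall>i. i \<notin> {} \<longrightarrow> x $ i = y $ i"
    then have "x = y" by (simp add: vec_eq_iff)
    then show "V x = V y" by simp
  qed (use V in simp_all)
next
  case (insert i J)
  let ?D = "\<lambda>i. (1 / a) * (\<integral>x. (norm (g x $ i))\<^sup>2 \<partial>lborel) + a * (\<integral>x. (x $ i)\<^sup>2 * (norm (u x))\<^sup>2 \<partial>lborel)
        - (\<integral>x. (norm (u x))\<^sup>2 \<partial>lborel)"
  obtain V' where V': "continuous_on UNIV V' \<and> (\<forall>x. \<bar>V' x\<bar> \<le> B) \<and>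
    (\<forall>x y. (\<forall>i. i \<notin> J \<longrightarrow> x $ i = y $ i) \<longrightarrow> V' x = V' y) \<and>
    (\<integral>x. exp (V' x) * gauss_prod a x \<partial>lborel) = (\<integral>x. exp (V x) * gauss_prod a x \<partial>lborel) \<and>
    (\<integral>x. (V x - V' x) * (norm (u x))\<^sup>2 \<partial>lborel) \<le> (\<Sum>i\<in>J. ?D i)"
    using insert.IH by (rule exE)
  note V'c = V'[THEN conjunct1] and V'b = V'[THEN conjunct2, THEN conjunct1, rule_format]
    and V'J = V'[THEN conjunct2, THEN conjunct2, THEN conjunct1, rule_format]
    and V'G = V'[THEN conjunct2, THEN conjunct2, THEN conjunct2, THEN conjunct1]
    and V'le = V'[THEN conjunct2, THEN conjunct2, THEN conjunct2, THEN conjunct2]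
  let ?W = "coord_log_mean a i V'"
  note W = coord_log_mean_continuous[OF a V'c V'b, of i] coord_log_mean_bounded[OF a V'c V'b, of i]
  have WJ: "?W x = ?W y" if "\<And>j. j \<notin> insert i J \<Longrightarrow> x $ j = y $ j" for x y
  proof -
    have "V' (set_coord i x s) = V' (set_coord i y s)" for s
      by (rule V'J) (use that in \<open>auto simp: set_coord_nth\<close>)
    then show ?thesis by (simp add: coord_log_mean_def)
  qed
  have "(\<integral>x. (V' x - ?W x) * (norm (u x))\<^sup>2 \<partial>lborel) \<le> ?D i"
    by (rule coordinate_log_sobolev[OF u g a _ xu V'c V'b])
       (use weak in \<open>simp add: has_weak_gradient_iff\<close>)
  moreover have "(\<integral>x. (V x - ?W x) * (norm (u x))\<^sup>2 \<partial>lborel)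
      = (\<integral>x. (V x - V' x) * (norm (u x))\<^sup>2 \<partial>lborel) + (\<integral>x. (V' x - ?W x) * (norm (u x))\<^sup>2 \<partial>lborel)"
  proof -
    have iw: "integrable lborel (\<lambda>x. w x * (norm (u x))\<^sup>2)"
      if "continuous_on UNIV w" "\<And>x. \<bar>w x\<bar> \<le> B" for w :: "real^'n \<Rightarrow> real"
      using u that by (intro integrable_bounded_mult borel_measurable_continuous_onI) (auto simp: L2_def)
    show ?thesis
      using iw[OF V] iw[OF V'c V'b] iw[OF W] by (simp add: left_diff_distrib)
  qed
  ultimately have "(\<integral>x. (V x - ?W x) * (norm (u x))\<^sup>2 \<partial>lborel) \<le> (\<Sum>i\<in>insert i J. ?D i)"
    using V'le insert.hyps by simp
  note step = this
  show ?case
  proof (intro exI[of _ ?W] conjI allI impI)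
    fix x y :: "real^'n" assume "\<forall>j. j \<notin> insert i J \<longrightarrow> x $ j = y $ j"
    then show "?W x = ?W y" by (intro WJ) blast
  qed (fact W trans[OF integral_exp_coord_log_mean[OF a V'c V'b] V'G] step)+
qed

lemma norm_vec_square: "(norm (x :: ('b::real_normed_vector)^'n::finite))\<^sup>2 = (\<Sum>i\<in>UNIV. (norm (x $ i))\<^sup>2)"
  by (simp add: norm_vec_def L2_set_def sum_nonneg)

lemma L2_nth:
  assumes "L2 (g :: real^'m::finite \<Rightarrow> complex^'n::finite)" shows "L2 (\<lambda>x. g x $ i)"
  unfolding L2_def
proof
  have "(\<lambda>y :: complex^'n. y $ i) \<in> borel_measurable borel"
    by (intro borel_measurable_continuous_onI continuous_intros)
  from measurable_compose[OF L2_measurable[OF assms] this]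
  show m: "(\<lambda>x. g x $ i) \<in> borel_measurable lborel" by simp
  show "integrable lborel (\<lambda>x. (norm (g x $ i))\<^sup>2)"
  proof (rule Bochner_Integration.integrable_bound)
    show "integrable lborel (\<lambda>x. (norm (g x))\<^sup>2)" using assms by (simp add: L2_def)
    show "AE x in lborel. norm ((norm (g x $ i))\<^sup>2) \<le> norm ((norm (g x))\<^sup>2)"
      by (auto intro!: AE_I2 power_mono Finite_Cartesian_Product.norm_nth_le)
  qed (use m in measurable)
qed

lemma integrable_coordinate_moment:
  fixes u :: "real^'n::finite \<Rightarrow> complex"
  assumes u: "L2 u" and xu: "integrable lborel (\<lambda>x. (norm x)\<^sup>2 * (norm (u x))\<^sup>2)"
  shows "integrable lborel (\<lambda>x. (x $ i)\<^sup>2 * (norm (u x))\<^sup>2)"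
proof (rule Bochner_Integration.integrable_bound[OF xu])
  have nth[measurable]: "(\<lambda>x::real^'n. x $ i) \<in> borel_measurable borel"
    by (intro borel_measurable_continuous_onI continuous_intros)
  show "(\<lambda>x. (x $ i)\<^sup>2 * (norm (u x))\<^sup>2) \<in> borel_measurable lborel"
    using L2_measurable[OF u] by measurable
  have "(x $ i)\<^sup>2 \<le> (norm x)\<^sup>2" for x :: "real^'n"
    using power_mono[OF Finite_Cartesian_Product.norm_nth_le[of x i], of 2] by simp
  then show "AE x in lborel. norm ((x $ i)\<^sup>2 * (norm (u x))\<^sup>2) \<le> norm ((norm x)\<^sup>2 * (norm (u x))\<^sup>2)"
    by (auto intro!: AE_I2 mult_right_mono)
qed

lemma sum_coordinate_moments:
  fixes u :: "real^'n::finite \<Rightarrow> complex"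
  assumes u: "L2 u" and xu: "integrable lborel (\<lambda>x. (norm x)\<^sup>2 * (norm (u x))\<^sup>2)"
  shows "(\<Sum>i\<in>UNIV. \<integral>x. (x $ i)\<^sup>2 * (norm (u x))\<^sup>2 \<partial>lborel) = (\<integral>x. (norm x)\<^sup>2 * (norm (u x))\<^sup>2 \<partial>lborel)"
proof -
  have "(norm x)\<^sup>2 * (norm (u x))\<^sup>2 = (\<Sum>i\<in>UNIV. (x $ i)\<^sup>2 * (norm (u x))\<^sup>2)" for x
    by (simp add: norm_vec_square[where 'b=real] sum_distrib_right)
  then have "(\<integral>x. (norm x)\<^sup>2 * (norm (u x))\<^sup>2 \<partial>lborel)
      = (\<integral>x. (\<Sum>i\<in>UNIV. (x $ i)\<^sup>2 * (norm (u x))\<^sup>2) \<partial>lborel)"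
    by simp
  also have "\<dots> = (\<Sum>i\<in>UNIV. \<integral>x. (x $ i)\<^sup>2 * (norm (u x))\<^sup>2 \<partial>lborel)"
    by (intro Bochner_Integration.integral_sum integrable_coordinate_moment[OF assms])
  finally show ?thesis by (rule sym)
qed

lemma sum_L2_components:
  fixes g :: "real^'m::finite \<Rightarrow> complex^'n::finite"
  assumes "L2 g"
  shows "(\<Sum>i\<in>UNIV. \<integral>x. (norm (g x $ i))\<^sup>2 \<partial>lborel) = (\<integral>x. (norm (g x))\<^sup>2 \<partial>lborel)"
proof -
  have "(\<integral>x. (norm (g x))\<^sup>2 \<partial>lborel) = (\<integral>x. (\<Sum>i\<in>UNIV. (norm (g x $ i))\<^sup>2) \<partial>lborel)"
    by (simp only: norm_vec_square)
  also have "\<dots> = (\<Sum>i\<in>UNIV. \<integral>x. (norm (g x $ i))\<^sup>2 \<partial>lborel)"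
    using L2_nth[OF assms] by (intro Bochner_Integration.integral_sum) (simp add: L2_def)
  finally show ?thesis by simp
qed

text \<open>
  After all coordinates have been treated the potential is a constant \<open>c\<close>, and invariance of the
  exponential integral identifies \<open>exp c\<close>.
\<close>

lemma gaussian_log_sobolev_continuous:
  fixes u :: "real^'n::finite \<Rightarrow> complex" and g :: "real^'n \<Rightarrow> complex^'n" and V :: "real^'n \<Rightarrow> real"
  assumes u: "L2 u" and g: "L2 g" and a: "a > 0" and weak: "has_weak_gradient u g"
    and xu: "integrable lborel (\<lambda>x. (norm x)\<^sup>2 * (norm (u x))\<^sup>2)"
    and V: "continuous_on UNIV V" "\<And>x. \<bar>V x\<bar> \<le> B"
  shows "(\<integral>x. V x * (norm (u x))\<^sup>2 \<partial>lborel)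
    \<le> (\<integral>x. (norm (u x))\<^sup>2 \<partial>lborel) * ln (\<integral>x. exp (V x) * gauss_prod a x \<partial>lborel)
      + ((1 / a) * (\<integral>x. (norm (g x))\<^sup>2 \<partial>lborel) + a * (\<integral>x. (norm x)\<^sup>2 * (norm (u x))\<^sup>2 \<partial>lborel)
        - real CARD('n) * (\<integral>x. (norm (u x))\<^sup>2 \<partial>lborel))"
proof -
  let ?m = "\<integral>x. (norm (u x))\<^sup>2 \<partial>lborel"
  obtain V' where V': "continuous_on UNIV V' \<and> (\<forall>x. \<bar>V' x\<bar> \<le> B) \<and>
    (\<forall>x y. (\<forall>i. i \<notin> UNIV \<longrightarrow> x $ i = y $ i) \<longrightarrow> V' x = V' y) \<and>
    (\<integral>x. exp (V' x) * gauss_prod a x \<partial>lborel) = (\<integral>x. exp (V x) * gauss_prod a x \<partial>lborel) \<and>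
    (\<integral>x. (V x - V' x) * (norm (u x))\<^sup>2 \<partial>lborel) \<le>
      (\<Sum>i\<in>UNIV. (1 / a) * (\<integral>x. (norm (g x $ i))\<^sup>2 \<partial>lborel) + a * (\<integral>x. (x $ i)\<^sup>2 * (norm (u x))\<^sup>2 \<partial>lborel) - ?m)"
    using iterated_coordinate_log_sobolev[OF u L2_nth[OF g] a weak integrable_coordinate_moment[OF u xu] V finite[of UNIV]]
    by (rule exE)
  have V'J: "V' x = V' y" for x y
    using V'[THEN conjunct2, THEN conjunct2, THEN conjunct1] by blast
  note V'G = V'[THEN conjunct2, THEN conjunct2, THEN conjunct2, THEN conjunct1]
    and V'le = V'[THEN conjunct2, THEN conjunct2, THEN conjunct2, THEN conjunct2]
  define c where "c = V' 0"
  have V'c: "V' = (\<lambda>x. c)" unfolding c_def by (rule ext) (rule V'J)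
  have "exp c = (\<integral>x. exp (V x) * gauss_prod a x \<partial>lborel)"
    using V'G gauss_prod_integral[OF a, where 'n='n] by (simp add: V'c)
  from this[symmetric] have c: "c = ln (\<integral>x. exp (V x) * gauss_prod a x \<partial>lborel)" by simp
  have "integrable lborel (\<lambda>x. V x * (norm (u x))\<^sup>2)"
    using u V by (intro integrable_bounded_mult borel_measurable_continuous_onI) (auto simp: L2_def)
  then have "(\<integral>x. (V x - V' x) * (norm (u x))\<^sup>2 \<partial>lborel) = (\<integral>x. V x * (norm (u x))\<^sup>2 \<partial>lborel) - c * ?m"
    using u by (simp add: V'c left_diff_distrib L2_def)
  moreover have "(\<Sum>i\<in>UNIV. (1 / a) * (\<integral>x. (norm (g x $ i))\<^sup>2 \<partial>lborel) + a * (\<integral>x. (x $ i)\<^sup>2 * (norm (u x))\<^sup>2 \<partial>lborel) - ?m)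
    = (1 / a) * (\<integral>x. (norm (g x))\<^sup>2 \<partial>lborel) + a * (\<integral>x. (norm x)\<^sup>2 * (norm (u x))\<^sup>2 \<partial>lborel) - real CARD('n) * ?m"
  proof -
    have "(\<Sum>i\<in>UNIV. p * P i + a * Q i - ?m) = p * (\<Sum>i\<in>UNIV. P i) + a * (\<Sum>i\<in>UNIV. Q i) - real CARD('n) * ?m"
      for p and P Q :: "'n \<Rightarrow> real"
      by (simp add: sum_subtractf sum.distrib sum_distrib_left)
    from this[of "1 / a"] show ?thesis
      unfolding sum_L2_components[OF g, symmetric] sum_coordinate_moments[OF u xu, symmetric] .
  qed
  ultimately have "(\<integral>x. V x * (norm (u x))\<^sup>2 \<partial>lborel) \<le> ?m * c
      + ((1 / a) * (\<integral>x. (norm (g x))\<^sup>2 \<partial>lborel) + a * (\<integral>x. (norm x)\<^sup>2 * (norm (u x))\<^sup>2 \<partial>lborel)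
        - real CARD('n) * ?m)"
    using V'le by (simp only: mult.commute[of c])
  then show ?thesis unfolding c .
qed

section \<open>From bounded potentials to entropy\<close>

lemma AE_limit_of_continuous:
  fixes V :: "'a::euclidean_space \<Rightarrow> real"
  assumes "V \<in> borel_measurable borel" and K: "\<And>x. \<bar>V x\<bar> \<le> K"
  obtains W where "\<And>n. continuous_on UNIV (W n)" "\<And>n x. \<bar>W n x\<bar> \<le> K"
    "AE x in lborel. (\<lambda>n. W n x) \<longlonglongrightarrow> V x"
proof -
  have "V \<in> borel_measurable lebesgue"
    using assms(1) by (simp add: measurable_completion)
  then have "V measurable_on UNIV"
    by (rule lebesgue_measurable_imp_measurable_on) simp
  then obtain N w where N: "negligible N" and w: "\<And>n. continuous_on UNIV (w n)"
    and lim: "\<And>x. x \<notin> N \<Longrightarrow> (\<lambda>n. w n x) \<longlonglongrightarrow> V x"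
    unfolding measurable_on_def by auto
  have "AE x in lebesgue. x \<notin> N"
    using N by (intro AE_not_in) (simp add: negligible_iff_null_sets)
  then have "AE x in lborel. x \<notin> N" by (simp add: AE_completion_iff)
  then have AE: "AE x in lborel. (\<lambda>n. max (- K) (min K (w n x))) \<longlonglongrightarrow> V x"
  proof eventually_elim
    case (elim x)
    have "(\<lambda>n. max (- K) (min K (w n x))) \<longlonglongrightarrow> max (- K) (min K (V x))"
      by (intro tendsto_intros lim elim)
    moreover have "max (- K) (min K (V x)) = V x" using K[of x] by (simp add: abs_le_iff)
    ultimately show ?case by simp
  qed
  have "0 \<le> K" using K[of undefined] by simp
  then show ?thesis
    using AE w by (intro that[of "\<lambda>n x. max (- K) (min K (w n x))"]) (auto intro!: continuous_intros)
qed

lemma gaussian_log_sobolev_bounded: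
  fixes u :: "real^'n::finite \<Rightarrow> complex" and g :: "real^'n \<Rightarrow> complex^'n" and V :: "real^'n \<Rightarrow> real"
  assumes u: "L2 u" and g: "L2 g" and a: "a > 0" and weak: "has_weak_gradient u g"
    and xu: "integrable lborel (\<lambda>x. (norm x)\<^sup>2 * (norm (u x))\<^sup>2)"
    and V[measurable]: "V \<in> borel_measurable borel" and K: "\<And>x. \<bar>V x\<bar> \<le> K"
  shows "(\<integral>x. V x * (norm (u x))\<^sup>2 \<partial>lborel)
    \<le> (\<integral>x. (norm (u x))\<^sup>2 \<partial>lborel) * ln (\<integral>x. exp (V x) * gauss_prod a x \<partial>lborel)
      + ((1 / a) * (\<integral>x. (norm (g x))\<^sup>2 \<partial>lborel) + a * (\<integral>x. (norm x)\<^sup>2 * (norm (u x))\<^sup>2 \<partial>lborel)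
        - real CARD('n) * (\<integral>x. (norm (u x))\<^sup>2 \<partial>lborel))"
    (is "?L \<le> ?m * ln ?Z + ?E")
proof -
  note [measurable] = L2_measurable[OF u]
  obtain W where W: "\<And>n. continuous_on UNIV (W n)" "\<And>n x. \<bar>W n x\<bar> \<le> K"
    and lim: "AE x in lborel. (\<lambda>n. W n x) \<longlonglongrightarrow> V x"
    using AE_limit_of_continuous[OF V K] by blast
  have [measurable]: "W n \<in> borel_measurable borel" for n
    by (rule borel_measurable_continuous_onI[OF W(1)])
  have 1: "(\<lambda>n. \<integral>x. W n x * (norm (u x))\<^sup>2 \<partial>lborel) \<longlonglongrightarrow> ?L"
  proof (rule integral_dominated_convergence)
    show "integrable lborel (\<lambda>x. K * (norm (u x))\<^sup>2)" using u by (simp add: L2_def)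
    show "AE x in lborel. (\<lambda>n. W n x * (norm (u x))\<^sup>2) \<longlonglongrightarrow> V x * (norm (u x))\<^sup>2"
      using lim by eventually_elim (intro tendsto_intros)
    show "AE x in lborel. norm (W n x * (norm (u x))\<^sup>2) \<le> K * (norm (u x))\<^sup>2" for n
      using W(2) by (auto simp: abs_mult intro!: mult_right_mono)
  qed measurable
  have 2: "(\<lambda>n. \<integral>x. exp (W n x) * gauss_prod a x \<partial>lborel) \<longlonglongrightarrow> ?Z"
  proof (rule integral_dominated_convergence)
    show "integrable lborel (\<lambda>x::real^'n. exp K * gauss_prod a x)" using gauss_prod_integrable[OF a] by simp
    show "AE x in lborel. (\<lambda>n. exp (W n x) * gauss_prod a x) \<longlonglongrightarrow> exp (V x) * gauss_prod a x"
      using lim by eventually_elim (intro tendsto_intros)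
    show "AE x in lborel. norm (exp (W n x) * gauss_prod a x) \<le> exp K * gauss_prod a x" for n
      using W(2) gauss_prod_nonneg[OF a, where 'a='n]
      by (intro AE_I2) (simp add: abs_mult abs_le_iff mult_right_mono)
  qed measurable
  have "exp (- K) = (\<integral>x. exp (- K) * gauss_prod a (x::real^'n) \<partial>lborel)"
    using gauss_prod_integral[OF a, where 'n='n] by simp
  also have "\<dots> \<le> ?Z"
  proof (rule integral_mono)
    show "integrable lborel (\<lambda>x. exp (V x) * gauss_prod a x)"
      using K by (intro integrable_bounded_mult[where K="exp K"] gauss_prod_integrable a) (auto simp: abs_le_iff)
    show "exp (- K) * gauss_prod a x \<le> exp (V x) * gauss_prod a x" for x
      using K[of x] gauss_prod_nonneg[OF a] by (auto simp: abs_le_iff intro!: mult_right_mono)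
  qed (use gauss_prod_integrable[OF a] in simp)
  finally have "?Z > 0" using exp_gt_zero[of "- K"] by linarith
  then have "(\<lambda>n. ?m * ln (\<integral>x. exp (W n x) * gauss_prod a x \<partial>lborel) + ?E) \<longlonglongrightarrow> ?m * ln ?Z + ?E"
    by (intro tendsto_intros 2) simp
  then show ?thesis
    by (rule LIMSEQ_le[OF 1]) (intro exI[of _ 0] allI impI gaussian_log_sobolev_continuous[OF u g a weak xu W])
qed

text \<open>
  The bound is applied to \<open>ln (f / r)\<close> truncated to \<open>[-k, k]\<close>. Truncation changes the exponential integral to at
  most \<open>\<integral> f + exp (- k)\<close>. The negative part of \<open>f ln (f / r)\<close> is bounded by \<open>r\<close>, hence the bounds for the
  truncations also bound the positive part uniformly, and monotone convergence gives integrability.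
\<close>

lemma entropy_le_of_variational_bound:
  fixes f r :: "'a::euclidean_space \<Rightarrow> real"
  assumes [measurable]: "f \<in> borel_measurable borel" "r \<in> borel_measurable borel"
    and f0: "\<And>x. f x \<ge> 0" and intf: "integrable lborel f" and m: "(\<integral>x. f x \<partial>lborel) > 0"
    and r0: "\<And>x. r x > 0" and intr: "integrable lborel r" and r1: "(\<integral>x. r x \<partial>lborel) = 1"
    and bound: "\<And>V K. V \<in> borel_measurable borel \<Longrightarrow> (\<And>x. \<bar>V x\<bar> \<le> K) \<Longrightarrow>
      (\<integral>x. V x * f x \<partial>lborel) \<le> (\<integral>x. f x \<partial>lborel) * ln (\<integral>x. exp (V x) * r x \<partial>lborel) + E"
  shows "integrable lborel (\<lambda>x. f x * ln (f x / r x))"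
    and "(\<integral>x. f x * ln (f x / r x) \<partial>lborel) \<le> (\<integral>x. f x \<partial>lborel) * ln (\<integral>x. f x \<partial>lborel) + E"
proof -
  define m where "m = (\<integral>x. f x \<partial>lborel)"
  have m0: "m > 0" using m by (simp add: m_def)
  define y where "y x = ln (f x / r x)" for x
  have [measurable]: "y \<in> borel_measurable borel" unfolding y_def by measurable
  \<comment> \<open>ln 0 = 0 by convention, so the truncation of the value minus infinity has to be set by hand.\<close>
  define V where "V k x = (if f x = 0 then - real k else max (- real k) (min (real k) (y x)))" for k :: nat and x
  have [measurable]: "V k \<in> borel_measurable borel" for k unfolding V_def by measurable
  have Vb: "\<bar>V k x\<bar> \<le> real k" for k x by (auto simp: V_def)
  have expV: "exp (V k x) * r x \<le> f x + exp (- real k) * r x" for k x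
  proof (cases "f x = 0")
    case False
    then have fx: "f x > 0" using f0[of x] by simp
    have "exp (V k x) \<le> exp (- real k) + exp (y x)"
    proof (cases "V k x \<le> y x")
      case True
      then have "exp (V k x) \<le> exp (y x)" by simp
      also have "\<dots> \<le> exp (- real k) + exp (y x)" by simp
      finally show ?thesis .
    next
      case F: False
      then have "V k x \<le> - real k" using False by (auto simp: V_def)
      then have "exp (V k x) \<le> exp (- real k)" by simp
      also have "\<dots> \<le> exp (- real k) + exp (y x)" by simp
      finally show ?thesis .
    qed
    also have "exp (y x) = f x / r x" using fx r0[of x] by (simp add: y_def)
    finally have "exp (V k x) * r x \<le> (exp (- real k) + f x / r x) * r x"
      by (intro mult_right_mono) (use r0[of x] in auto)
    then show ?thesis using r0[of x] by (simp add: algebra_simps)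
  qed (simp add: V_def)
  have iV: "integrable lborel (\<lambda>x. V k x * f x)" for k
    by (rule integrable_bounded_mult[OF intf _ Vb]) measurable
  have V_le: "(\<integral>x. V k x * f x \<partial>lborel) \<le> m * ln (m + exp (- real k)) + E" for k
  proof -
    let ?Z = "\<integral>x. exp (V k x) * r x \<partial>lborel"
    have iZ: "integrable lborel (\<lambda>x. exp (V k x) * r x)"
      using Vb[of k] by (intro integrable_bounded_mult[OF intr, where K="exp (real k)"]) (auto simp: abs_le_iff)
    have "exp (- real k) = (\<integral>x. exp (- real k) * r x \<partial>lborel)" using r1 by simp
    also have "\<dots> \<le> ?Z"
    proof (rule integral_mono[OF _ iZ])
      show "exp (- real k) * r x \<le> exp (V k x) * r x" for x
        using Vb[of k x] r0[of x] by (auto simp: abs_le_iff)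
    qed (use intr in simp)
    finally have Z0: "?Z > 0" using exp_gt_zero[of "- real k"] by linarith
    have "?Z \<le> (\<integral>x. f x + exp (- real k) * r x \<partial>lborel)"
      by (intro integral_mono iZ expV) (use intf intr in simp)
    also have "\<dots> = m + exp (- real k)" using intf intr r1 by (simp add: m_def)
    finally have "ln ?Z \<le> ln (m + exp (- real k))" using Z0 by simp
    then have "m * ln ?Z \<le> m * ln (m + exp (- real k))" using m0 by simp
    then show ?thesis using bound[of "V k" "real k"] Vb by (simp add: m_def)
  qed
  \<comment> \<open>q and the limit of p are the negative and the positive part of f ln (f / r).\<close>
  define q where "q x = f x * max 0 (- y x)" for x
  have q0: "q x \<ge> 0" for x using f0 by (simp add: q_def)
  have q_le: "q x \<le> r x" for x
  proof (cases "f x = 0 \<or> y x \<ge> 0")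
    case False
    then have fx: "f x > 0" using f0[of x] by simp
    \<comment> \<open>z ln (1/z) is at most 1 for z = f/r.\<close>
    have "- y x = ln (r x / f x)" using fx r0[of x] by (simp add: y_def ln_div)
    also have "\<dots> \<le> r x / f x - 1" using fx r0[of x] by (intro ln_le_minus_one) simp
    also have "\<dots> \<le> r x / f x" by simp
    finally have "f x * (- y x) \<le> f x * (r x / f x)" using fx by (intro mult_left_mono) auto
    then show ?thesis using False fx by (simp add: q_def)
  qed (use r0[of x] in \<open>auto simp: q_def\<close>)
  have [measurable]: "q \<in> borel_measurable borel" unfolding q_def by measurable
  have iq: "integrable lborel q"
    by (rule Bochner_Integration.integrable_bound[OF intr]) (use q0 q_le r0 in \<open>auto simp: less_imp_le\<close>)
  define p where "p k x = f x * min (real k) (max 0 (y x))" for k :: nat and x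
  have [measurable]: "p k \<in> borel_measurable borel" for k unfolding p_def by measurable
  have p_eq: "p k x \<le> V k x * f x + q x" for k x
  proof (cases "f x = 0")
    case False
    have "min (real k) (max 0 (y x)) \<le> V k x + max 0 (- y x)"
      using False by (auto simp: V_def min_def max_def)
    from mult_left_mono[OF this f0[of x]] show ?thesis by (simp add: p_def q_def algebra_simps)
  qed (simp add: p_def q_def)
  have p0: "0 \<le> p k x" for k x using f0[of x] by (simp add: p_def)
  have ip: "integrable lborel (p k)" for k
    by (rule Bochner_Integration.integrable_bound[OF Bochner_Integration.integrable_add[OF iV[of k] iq]])
       (use p0 p_eq in \<open>auto intro!: AE_I2 order_trans[OF p_eq abs_ge_self]\<close>)
  have p_int: "(\<integral>x. p k x \<partial>lborel) \<le> m * ln (m + 1) + E + (\<integral>x. q x \<partial>lborel)" for k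
  proof -
    have "(\<integral>x. p k x \<partial>lborel) \<le> (\<integral>x. V k x * f x + q x \<partial>lborel)"
      by (intro integral_mono ip Bochner_Integration.integrable_add iV iq p_eq)
    also have "\<dots> = (\<integral>x. V k x * f x \<partial>lborel) + (\<integral>x. q x \<partial>lborel)"
      using iV iq by simp
    also have "\<dots> \<le> m * ln (m + exp (- real k)) + E + (\<integral>x. q x \<partial>lborel)" using V_le by simp
    also have "m * ln (m + exp (- real k)) \<le> m * ln (m + 1)"
      using m0 add_pos_pos[OF m0 exp_gt_zero[of "- real k"]] by simp
    finally show ?thesis by simp
  qed
  have p_mono: "p k x \<le> p l x" if "k \<le> l" for k l x
    using that f0[of x] unfolding p_def by (intro mult_left_mono) auto
  have p_lim: "(\<lambda>k. p k x) \<longlonglongrightarrow> f x * max 0 (y x)" for x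
  proof (rule tendsto_eventually)
    obtain N :: nat where N: "max 0 (y x) < real N" using reals_Archimedean2 by blast
    show "eventually (\<lambda>k. p k x = f x * max 0 (y x)) sequentially"
      by (rule eventually_sequentiallyI[of N]) (use N in \<open>auto simp: p_def min_def\<close>)
  qed
  have "incseq (\<lambda>k. \<integral>x. p k x \<partial>lborel)"
    by (intro incseq_SucI integral_mono ip p_mono) simp
  then obtain L where L: "(\<lambda>k. \<integral>x. p k x \<partial>lborel) \<longlonglongrightarrow> L"
    using incseq_convergent[of "\<lambda>k. \<integral>x. p k x \<partial>lborel"] p_int by blast
  have ipos: "integrable lborel (\<lambda>x. f x * max 0 (y x))"
    by (rule integrable_monotone_convergence[OF ip _ _ L])
       (use p_mono p_lim in \<open>auto intro!: AE_I2 simp: mono_def\<close>)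
  have "f x * y x = f x * max 0 (y x) - q x" for x
    by (auto simp: q_def max_def)
  then have ify: "integrable lborel (\<lambda>x. f x * y x)" using ipos iq by simp
  then show "integrable lborel (\<lambda>x. f x * ln (f x / r x))" by (simp add: y_def)
  have "(\<lambda>k. \<integral>x. V k x * f x \<partial>lborel) \<longlonglongrightarrow> (\<integral>x. f x * y x \<partial>lborel)"
  proof (rule integral_dominated_convergence)
    show "integrable lborel (\<lambda>x. \<bar>f x * y x\<bar>)" using ify by simp
    show "AE x in lborel. (\<lambda>k. V k x * f x) \<longlonglongrightarrow> f x * y x"
    proof (intro AE_I2 tendsto_eventually)
      fix x
      obtain N :: nat where N: "\<bar>y x\<bar> < real N" using reals_Archimedean2 by blast
      show "eventually (\<lambda>k. V k x * f x = f x * y x) sequentially"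
        by (rule eventually_sequentiallyI[of N]) (use N in \<open>auto simp: V_def min_def max_def\<close>)
    qed
    show "AE x in lborel. norm (V k x * f x) \<le> \<bar>f x * y x\<bar>" for k
    proof (rule AE_I2)
      fix x
      have "\<bar>V k x\<bar> \<le> \<bar>y x\<bar>" if "f x \<noteq> 0" using that by (auto simp: V_def min_def max_def)
      then show "norm (V k x * f x) \<le> \<bar>f x * y x\<bar>"
        by (cases "f x = 0") (auto simp: abs_mult mult.commute intro!: mult_left_mono)
    qed
  qed measurable
  moreover have "(\<lambda>k. m * ln (m + exp (- real k)) + E) \<longlonglongrightarrow> m * ln (m + 0) + E"
  proof (intro tendsto_intros)
    show "(\<lambda>k. exp (- real k)) \<longlonglongrightarrow> 0"
      by (rule filterlim_compose[OF exp_at_bot]) 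
         (auto simp: filterlim_uminus_at_bot filterlim_real_sequentially)
  qed (use m0 in simp)
  ultimately have "(\<integral>x. f x * y x \<partial>lborel) \<le> m * ln (m + 0) + E"
    by (rule LIMSEQ_le) (use V_le in blast)
  then show "(\<integral>x. f x * ln (f x / r x) \<partial>lborel) \<le> (\<integral>x. f x \<partial>lborel) * ln (\<integral>x. f x \<partial>lborel) + E"
    by (simp add: y_def m_def)
qed

section \<open>The harmonic oscillator\<close>

lemma abs_arctan_le: "\<bar>arctan y\<bar> \<le> \<bar>y\<bar>"
proof -
  have le: "arctan z \<le> z" if "0 \<le> z" for z :: real
  proof -
    have "arctan z - z \<le> arctan 0 - 0"
    proof (rule DERIV_nonpos_imp_nonincreasing[OF that, where f = "\<lambda>s. arctan s - s"])
      fix s :: real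
      have "((\<lambda>s. arctan s - s) has_real_derivative inverse (1 + s\<^sup>2) - 1) (at s)"
        by (auto intro!: derivative_eq_intros simp: add_nonneg_eq_0_iff)
      moreover have "inverse (1 + s\<^sup>2) \<le> 1" by (simp add: inverse_le_1_iff)
      ultimately show "\<exists>d. ((\<lambda>s. arctan s - s) has_real_derivative d) (at s) \<and> d \<le> 0" by force
    qed
    then show ?thesis by simp
  qed
  show ?thesis using le[of y] le[of "- y"] by (cases "0 \<le> y") (simp_all add: arctan_minus)
qed

text \<open>
  The field \<open>T = x\<^sub>i\<close> would give the claim at once. It is unbounded and is replaced by \<open>R arctan (x\<^sub>i / R)\<close>, which
  is bounded, has derivative tending to \<open>1\<close> as \<open>R\<close> grows, and satisfies \<open>T\<^sup>2 \<le> x\<^sub>i\<^sup>2\<close>.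
\<close>

lemma coordinate_uncertainty:
  fixes u v :: "real^'n::finite \<Rightarrow> complex"
  assumes u: "L2 u" and v: "L2 v" and a: "a > 0"
    and weak: "has_weak_partial_deriv i u v"
    and xu: "integrable lborel (\<lambda>x. (x $ i)\<^sup>2 * (norm (u x))\<^sup>2)"
  shows "(\<integral>x. (norm (u x))\<^sup>2 \<partial>lborel)
      \<le> (1 / a) * (\<integral>x. (norm (v x))\<^sup>2 \<partial>lborel) + a * (\<integral>x. (x $ i)\<^sup>2 * (norm (u x))\<^sup>2 \<partial>lborel)"
proof -
  note [measurable] = L2_measurable[OF u]
  have nth[measurable]: "(\<lambda>x::real^'n. x $ i) \<in> borel_measurable borel"
    by (intro borel_measurable_continuous_onI continuous_intros)
  have intf: "integrable lborel (\<lambda>x. (norm (u x))\<^sup>2)" using u by (simp add: L2_def)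
  define R where "R n = real (Suc n)" for n
  have R: "R n > 0" for n by (simp add: R_def)
  define T where "T n x = R n * arctan (x $ i / R n)" for n and x :: "real^'n"
  define T' where "T' n x = inverse (1 + (x $ i / R n)\<^sup>2)" for n and x :: "real^'n"
  have [measurable]: "T n \<in> borel_measurable borel" "T' n \<in> borel_measurable borel" for n
    unfolding T_def T'_def
    by (intro borel_measurable_continuous_onI continuous_intros; use R[of n] in \<open>auto simp: add_nonneg_eq_0_iff\<close>)+
  have Tb: "\<bar>T n x\<bar> \<le> R n * (pi / 2)" for n x
  proof -
    have "\<bar>arctan (x $ i / R n)\<bar> \<le> pi / 2"
      using arctan_bounded[of "x $ i / R n"] by (intro abs_leI) linarith+
    then show ?thesis unfolding T_def abs_mult using R[of n] by (intro mult_mono) auto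
  qed
  have T'0: "0 \<le> T' n x" "T' n x \<le> 1" for n x
    unfolding T'_def by (auto simp: inverse_le_1_iff)
  have T2: "(T n x)\<^sup>2 \<le> (x $ i)\<^sup>2" for n x
  proof -
    have "\<bar>T n x\<bar> \<le> R n * \<bar>x $ i / R n\<bar>"
      unfolding T_def abs_mult using R[of n] abs_arctan_le[of "x $ i / R n"]
      by (intro mult_mono) auto
    then have "\<bar>T n x\<bar> \<le> \<bar>x $ i\<bar>" using R[of n] by (simp only: abs_divide) simp
    then show ?thesis by (simp add: abs_le_square_iff)
  qed
  have deriv: "((\<lambda>s. T n (x + s *\<^sub>R axis i 1)) has_real_derivative T' n x) (at 0)" for n x
    unfolding T_def T'_def using R[of n]
    by (auto intro!: derivative_eq_intros simp: axis_def add_nonneg_eq_0_iff)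
  have le: "(\<integral>x. T' n x * (norm (u x))\<^sup>2 \<partial>lborel)
    \<le> (1 / a) * (\<integral>x. (norm (v x))\<^sup>2 \<partial>lborel) + a * (\<integral>x. (x $ i)\<^sup>2 * (norm (u x))\<^sup>2 \<partial>lborel)" for n
  proof -
    have "(\<integral>x. T' n x * (norm (u x))\<^sup>2 \<partial>lborel)
      \<le> (1 / a) * (\<integral>x. (norm (v x))\<^sup>2 \<partial>lborel) + 1 / (1 / a) * (\<integral>x. (T n x)\<^sup>2 * (norm (u x))\<^sup>2 \<partial>lborel)"
      by (rule weak_integration_by_parts_le[OF u v _ weak _ _ Tb _ deriv, where C=1])
         (use a T'0 in \<open>simp_all add: abs_le_iff order_trans[of _ 0]\<close>)
    also have "(\<integral>x. (T n x)\<^sup>2 * (norm (u x))\<^sup>2 \<partial>lborel) \<le> (\<integral>x. (x $ i)\<^sup>2 * (norm (u x))\<^sup>2 \<partial>lborel)"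
    proof (rule integral_mono[OF _ xu])
      show "integrable lborel (\<lambda>x. (T n x)\<^sup>2 * (norm (u x))\<^sup>2)"
        by (rule Bochner_Integration.integrable_bound[OF xu]) (auto intro!: AE_I2 mult_right_mono T2)
      show "(T n x)\<^sup>2 * (norm (u x))\<^sup>2 \<le> (x $ i)\<^sup>2 * (norm (u x))\<^sup>2" for x
        by (intro mult_right_mono T2) simp
    qed
    finally show ?thesis using a by simp
  qed
  have "(\<lambda>n. \<integral>x. T' n x * (norm (u x))\<^sup>2 \<partial>lborel) \<longlonglongrightarrow> (\<integral>x. (norm (u x))\<^sup>2 \<partial>lborel)"
  proof (rule integral_dominated_convergence[OF _ _ intf])
    show "AE x in lborel. (\<lambda>n. T' n x * (norm (u x))\<^sup>2) \<longlonglongrightarrow> (norm (u x))\<^sup>2"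
    proof (rule AE_I2)
      fix x
      have "(\<lambda>n. inverse (1 + (x $ i * inverse (real (Suc n)))\<^sup>2) * (norm (u x))\<^sup>2)
          \<longlonglongrightarrow> inverse (1 + (x $ i * 0)\<^sup>2) * (norm (u x))\<^sup>2"
        by (intro tendsto_intros LIMSEQ_inverse_real_of_nat) simp
      then show "(\<lambda>n. T' n x * (norm (u x))\<^sup>2) \<longlonglongrightarrow> (norm (u x))\<^sup>2"
        by (simp add: T'_def R_def divide_inverse)
    qed
    show "AE x in lborel. norm (T' n x * (norm (u x))\<^sup>2) \<le> (norm (u x))\<^sup>2" for n
      using T'0[of n] by (auto intro!: AE_I2 mult_left_le_one_le simp: abs_mult)
  qed measurable
  then show ?thesis by (rule LIMSEQ_le_const2) (use le in blast)
qed

lemma harmonic_oscillator_bound: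
  fixes u :: "real^'n::finite \<Rightarrow> complex" and g :: "real^'n \<Rightarrow> complex^'n"
  assumes u: "L2 u" and g: "L2 g" and a: "a > 0" and weak: "has_weak_gradient u g"
    and xu: "integrable lborel (\<lambda>x. (norm x)\<^sup>2 * (norm (u x))\<^sup>2)"
  shows "real CARD('n) * (\<integral>x. (norm (u x))\<^sup>2 \<partial>lborel)
      \<le> (1 / a) * (\<integral>x. (norm (g x))\<^sup>2 \<partial>lborel) + a * (\<integral>x. (norm x)\<^sup>2 * (norm (u x))\<^sup>2 \<partial>lborel)"
proof -
  have "(\<Sum>i\<in>(UNIV::'n set). \<integral>x. (norm (u x))\<^sup>2 \<partial>lborel)
    \<le> (\<Sum>i\<in>UNIV. (1 / a) * (\<integral>x. (norm (g x $ i))\<^sup>2 \<partial>lborel) + a * (\<integral>x. (x $ i)\<^sup>2 * (norm (u x))\<^sup>2 \<partial>lborel))"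
    by (intro sum_mono coordinate_uncertainty[OF u L2_nth[OF g] a _ integrable_coordinate_moment[OF u xu]])
       (use weak in \<open>simp add: has_weak_gradient_iff\<close>)
  also have "\<dots> = (1 / a) * (\<Sum>i\<in>UNIV. \<integral>x. (norm (g x $ i))\<^sup>2 \<partial>lborel)
      + a * (\<Sum>i\<in>UNIV. \<integral>x. (x $ i)\<^sup>2 * (norm (u x))\<^sup>2 \<partial>lborel)"
    by (simp only: sum.distrib sum_distrib_left)
  finally show ?thesis
    unfolding sum_L2_components[OF g] sum_coordinate_moments[OF u xu] by simp
qed

section \<open>Gaussian moments\<close>

lemma gauss_prod_eq:
  "gauss_prod a (x::real^'n::finite) = sqrt (a / pi) ^ CARD('n) * exp (- a * (norm x)\<^sup>2)"
  by (simp add: gauss_prod_def gauss_def prod.distrib norm_vec_square[where 'b=real] sum_distrib_left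
      sum_negf flip: exp_sum)

lemma gauss_prod_line_derivative:
  fixes x :: "real^'n::finite"
  shows "((\<lambda>s. gauss_prod a (x + s *\<^sub>R axis i 1)) has_real_derivative
    - 2 * a * (x + s *\<^sub>R axis i 1) $ i * gauss_prod a (x + s *\<^sub>R axis i 1)) (at s)"
proof -
  have sq: "(norm (x + s *\<^sub>R axis i 1))\<^sup>2 = (norm x)\<^sup>2 + 2 * s * x $ i + s\<^sup>2" for s
  proof -
    have "(x + s *\<^sub>R w) \<bullet> (x + s *\<^sub>R w) = x \<bullet> x + 2 * s * (x \<bullet> w) + s\<^sup>2 * (w \<bullet> w)" for w :: "real^'n"
      by (simp add: inner_add_left inner_add_right inner_commute power2_eq_square)
    from this[of "axis i 1"] show ?thesis
      by (simp only: power2_norm_eq_inner) (simp add: inner_axis inner_axis_axis)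
  qed
  have i: "(x + s *\<^sub>R axis i 1) $ i = x $ i + s" by (simp add: axis_def)
  show ?thesis
    unfolding gauss_prod_eq sq i
    by (auto intro!: derivative_eq_intros simp: algebra_simps)
qed

lemma gauss_prod_moment_integrable:
  assumes a: "a > 0"
  shows "integrable lborel (\<lambda>x::real^'n::finite. (norm x)\<^sup>2 * gauss_prod a x)"
proof (rule Bochner_Integration.integrable_bound)
  define c d where "c = sqrt (a / pi) ^ CARD('n)" and "d = sqrt (a / 2 / pi) ^ CARD('n)"
  have c: "c > 0" and d: "d > 0" using a by (simp_all add: c_def d_def)
  define K where "K = 2 / a * c / d"
  have K: "K > 0" using a c d by (simp add: K_def)
  show "integrable lborel (\<lambda>x::real^'n. K * gauss_prod (a / 2) x)"
    using gauss_prod_integrable[of "a / 2", where 'n='n] a by simp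
  have "(norm x)\<^sup>2 * gauss_prod a x \<le> K * gauss_prod (a / 2) x" for x :: "real^'n"
  proof -
    \<comment> \<open>Half of the exponent pays for the polynomial factor.\<close>
    have "a / 2 * (norm x)\<^sup>2 \<le> exp (a / 2 * (norm x)\<^sup>2)"
      using exp_ge_add_one_self[of "a / 2 * (norm x)\<^sup>2"] by linarith
    then have "(norm x)\<^sup>2 \<le> 2 / a * exp (a / 2 * (norm x)\<^sup>2)" using a by (simp add: field_simps)
    then have "(norm x)\<^sup>2 * exp (- a * (norm x)\<^sup>2) \<le> 2 / a * exp (a / 2 * (norm x)\<^sup>2) * exp (- a * (norm x)\<^sup>2)"
      by (rule mult_right_mono) simp
    also have "\<dots> = 2 / a * exp (- (a / 2) * (norm x)\<^sup>2)"
      by (simp add: mult.assoc flip: exp_add)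
    finally have "c * ((norm x)\<^sup>2 * exp (- a * (norm x)\<^sup>2)) \<le> c * (2 / a * exp (- (a / 2) * (norm x)\<^sup>2))"
      using c by (intro mult_left_mono) auto
    moreover have "gauss_prod a x = c * exp (- a * (norm x)\<^sup>2)"
      "gauss_prod (a / 2) x = d * exp (- (a / 2) * (norm x)\<^sup>2)"
      by (simp_all add: gauss_prod_eq c_def d_def)
    ultimately show ?thesis using d by (simp add: K_def mult_ac)
  qed
  then have "norm ((norm x)\<^sup>2 * gauss_prod a x) \<le> norm (K * gauss_prod (a / 2) x)" for x :: "real^'n"
    using gauss_prod_nonneg[OF a, of x] gauss_prod_nonneg[of "a / 2" x] K a by (simp add: abs_mult)
  then show "AE x::real^'n in lborel. norm ((norm x)\<^sup>2 * gauss_prod a x) \<le> norm (K * gauss_prod (a / 2) x)"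
    by simp
qed measurable

text \<open>
  The integral of \<open>F (x + e\<^sub>i) - F x\<close> vanishes by translation invariance and equals \<open>\<integral> F'\<close> by the fundamental
  theorem of calculus and Fubini's theorem.
\<close>

lemma integral_directional_derivative_eq_0:
  fixes F F' :: "real^'n::finite \<Rightarrow> real"
  assumes F: "integrable lborel F" and F': "integrable lborel F'" and cont: "continuous_on UNIV F'"
    and deriv: "\<And>x s. ((\<lambda>s. F (x + s *\<^sub>R axis i 1)) has_real_derivative F' (x + s *\<^sub>R axis i 1)) (at s)"
  shows "(\<integral>x. F' x \<partial>lborel) = 0"
proof -
  define e :: "real^'n" where "e = axis i 1"
  have [measurable]: "F' \<in> borel_measurable borel" by (rule borel_measurable_continuous_onI[OF cont])
  have Fm: "F \<in> borel_measurable borel" using borel_measurable_integrable[OF F] by simp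
  have int: "integrable (lborel \<Otimes>\<^sub>M lborel) (\<lambda>(x, s). F' (x + s *\<^sub>R e) * indicator {0..1} s)"
    unfolding integrable_iff_bounded
  proof
    have "(\<integral>\<^sup>+s. \<integral>\<^sup>+x. ennreal (norm (F' (x + s *\<^sub>R e) * indicator {0..1} s)) \<partial>lborel \<partial>lborel)
      = (\<integral>\<^sup>+s. (\<integral>\<^sup>+x. ennreal (norm (F' x)) \<partial>lborel) * indicator {0..1::real} s \<partial>lborel)"
    proof (rule nn_integral_cong)
      fix s :: real
      show "(\<integral>\<^sup>+x. ennreal (norm (F' (x + s *\<^sub>R e) * indicator {0..1} s)) \<partial>lborel)
        = (\<integral>\<^sup>+x. ennreal (norm (F' x)) \<partial>lborel) * indicator {0..1::real} s"
        using nn_integral_translate[of "\<lambda>x. ennreal (norm (F' x))" "s *\<^sub>R e"]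
        by (cases "s \<in> {0..1}") auto
    qed
    also have "\<dots> = (\<integral>\<^sup>+x. ennreal (norm (F' x)) \<partial>lborel)"
      by (subst nn_integral_cmult) auto
    also have "\<dots> < \<infinity>" using F' by (simp add: integrable_iff_bounded)
    finally show "(\<integral>\<^sup>+z. ennreal (norm (case z of (x, s) \<Rightarrow> F' (x + s *\<^sub>R e) * indicator {0..1} s)) \<partial>(lborel \<Otimes>\<^sub>M lborel)) < \<infinity>"
      by (subst lborel_pair.nn_integral_snd[symmetric]) (auto simp: split_beta)
  qed measurable
  have "0 = (\<integral>x. F (x + e) \<partial>lborel) - (\<integral>x. F x \<partial>lborel)"
    using integral_translate[OF Fm, of e] by simp
  also have "\<dots> = (\<integral>x. F (x + e) - F x \<partial>lborel)"
    using F integrable_translate[OF F, of e] by simp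
  also have "\<dots> = (\<integral>x. \<integral>s. F' (x + s *\<^sub>R e) * indicator {0..1} s \<partial>lborel \<partial>lborel)"
  proof (rule Bochner_Integration.integral_cong[OF refl])
    fix x
    have "continuous_on UNIV (\<lambda>s. F' (x + s *\<^sub>R e))"
      by (intro continuous_on_compose2[OF cont] continuous_intros) auto
    then have "(\<integral>s. F' (x + s *\<^sub>R e) * indicator {0..1} s \<partial>lborel) = F (x + 1 *\<^sub>R e) - F (x + 0 *\<^sub>R e)"
      by (intro integral_FTC_Icc_real) (use deriv in \<open>auto simp: e_def continuous_on_eq_continuous_at\<close>)
    then show "F (x + e) - F x = (\<integral>s. F' (x + s *\<^sub>R e) * indicator {0..1} s \<partial>lborel)" by simp
  qed
  also have "\<dots> = (\<integral>s. \<integral>x. F' (x + s *\<^sub>R e) * indicator {0..1} s \<partial>lborel \<partial>lborel)"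
    by (rule lborel_pair.Fubini_integral[OF int, symmetric])
  also have "\<dots> = (\<integral>s. (\<integral>x. F' x \<partial>lborel) * indicator {0..1::real} s \<partial>lborel)"
    using integral_translate[of F' "_ *\<^sub>R e"] by simp
  also have "\<dots> = (\<integral>x. F' x \<partial>lborel)" by simp
  finally show ?thesis by simp
qed

text \<open>
  Integrating the derivative of \<open>x\<^sub>i gauss_prod a x\<close> in direction \<open>i\<close> relates each coordinate moment to the
  total mass.
\<close>

lemma gauss_prod_second_moment:
  assumes a: "a > 0"
  shows "(\<integral>x. (norm x)\<^sup>2 * gauss_prod a (x::real^'n::finite) \<partial>lborel) = real CARD('n) / (2 * a)"
proof -
  have nth[measurable]: "(\<lambda>x::real^'n. x $ i) \<in> borel_measurable borel" for i
    by (intro borel_measurable_continuous_onI continuous_intros)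
  have G: "integrable lborel (gauss_prod a :: real^'n \<Rightarrow> real)" by (rule gauss_prod_integrable[OF a])
  have i2: "integrable lborel (\<lambda>x::real^'n. (x $ i)\<^sup>2 * gauss_prod a x)" for i
  proof (rule Bochner_Integration.integrable_bound[OF gauss_prod_moment_integrable[OF a]])
    have "(x $ i)\<^sup>2 \<le> (norm x)\<^sup>2" for x :: "real^'n"
      using power_mono[OF Finite_Cartesian_Product.norm_nth_le[of x i], of 2] by simp
    then show "AE x::real^'n in lborel. norm ((x $ i)\<^sup>2 * gauss_prod a x) \<le> norm ((norm x)\<^sup>2 * gauss_prod a x)"
      by (auto intro!: AE_I2 mult_right_mono simp: abs_mult)
  qed measurable
  have i1: "integrable lborel (\<lambda>x::real^'n. x $ i * gauss_prod a x)" for i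
  proof (rule Bochner_Integration.integrable_bound[OF Bochner_Integration.integrable_add[OF G i2[of i]]])
    have "\<bar>x $ i\<bar> \<le> 1 + (x $ i)\<^sup>2" for x :: "real^'n"
      using mult_le_sum_squares[of 1 "\<bar>x $ i\<bar>"] by simp
    then have "norm (x $ i * gauss_prod a x) \<le> norm (gauss_prod a x + (x $ i)\<^sup>2 * gauss_prod a x)" for x :: "real^'n"
      using mult_right_mono[of "\<bar>x $ i\<bar>" "1 + (x $ i)\<^sup>2" "gauss_prod a x"] gauss_prod_nonneg[OF a, of x]
      by (simp add: abs_mult distrib_right)
    then show "AE x::real^'n in lborel. norm (x $ i * gauss_prod a x) \<le> norm (gauss_prod a x + (x $ i)\<^sup>2 * gauss_prod a x)"
      by simp
  qed measurable
  have m: "(\<integral>x. (x $ i)\<^sup>2 * gauss_prod a (x::real^'n) \<partial>lborel) = 1 / (2 * a)" for i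
  proof -
    have "(\<integral>x. gauss_prod a (x::real^'n) - 2 * a * ((x $ i)\<^sup>2 * gauss_prod a x) \<partial>lborel) = 0"
    proof (rule integral_directional_derivative_eq_0[OF i1[of i]])
      show "continuous_on UNIV (\<lambda>x::real^'n. gauss_prod a x - 2 * a * ((x $ i)\<^sup>2 * gauss_prod a x))"
        by (intro continuous_intros gauss_prod_continuous)
      fix x :: "real^'n" and s :: real
      have "((\<lambda>s. (x + s *\<^sub>R axis i 1) $ i) has_real_derivative 1) (at s)"
        by (auto intro!: derivative_eq_intros simp: axis_def)
      from DERIV_mult[OF this gauss_prod_line_derivative[of a x i s]]
      show "((\<lambda>s. (x + s *\<^sub>R axis i 1) $ i * gauss_prod a (x + s *\<^sub>R axis i 1)) has_real_derivative
          gauss_prod a (x + s *\<^sub>R axis i 1) - 2 * a * (((x + s *\<^sub>R axis i 1) $ i)\<^sup>2 * gauss_prod a (x + s *\<^sub>R axis i 1))) (at s)"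
        by (simp add: power2_eq_square algebra_simps)
    qed (use G i2 in auto)
    then show ?thesis using G i2[of i] a gauss_prod_integral[OF a, where 'n='n] by (simp add: field_simps)
  qed
  have "(norm x)\<^sup>2 * gauss_prod a x = (\<Sum>i\<in>UNIV. (x $ i)\<^sup>2 * gauss_prod a x)" for x :: "real^'n"
    by (simp add: norm_vec_square[where 'b=real] sum_distrib_right)
  then have "(\<integral>x. (norm x)\<^sup>2 * gauss_prod a (x::real^'n) \<partial>lborel)
      = (\<integral>x. (\<Sum>i\<in>UNIV. (x $ i)\<^sup>2 * gauss_prod a (x::real^'n)) \<partial>lborel)" by simp
  also have "\<dots> = (\<Sum>i\<in>(UNIV::'n set). 1 / (2 * a))"
    by (subst Bochner_Integration.integral_sum) (simp_all add: i2 m)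
  finally show ?thesis by simp
qed

section \<open>Independence of the choice of weak gradient\<close>

text \<open>
  Needed because \<^const>\<open>weak_gradient\<close> is an arbitrary choice: only through uniqueness can the explicit gradient
  of the Gaussian be used to evaluate the functional.
\<close>

lemma weak_gradient_unique:
  fixes u :: "real^'n::finite \<Rightarrow> complex" and g g' :: "real^'n \<Rightarrow> complex^'n"
  assumes g: "L2 g" "has_weak_gradient u g" and g': "L2 g'" "has_weak_gradient u g'"
  shows "AE x in lborel. g x = g' x"
proof -
  have "AE x in lborel. g x $ i - g' x $ i = 0" for i
  proof (rule AE_eq_0_of_test_functions)
    note L = L2_nth[OF g(1), of i] L2_nth[OF g'(1), of i]
    show "(\<lambda>x. g x $ i - g' x $ i) \<in> borel_measurable borel"
      by (rule L2_measurable[OF L2_diff[OF L]])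
    show "set_integrable lborel (cbox a b) (\<lambda>x. g x $ i - g' x $ i)" for a b
      by (rule L2_set_integrable[OF L2_diff[OF L]])
    fix \<phi> :: "real^'n \<Rightarrow> real" assume phi: "test_function \<phi>"
    have "- (\<integral>x. \<phi> x *\<^sub>R (g x $ i) \<partial>lborel) = - (\<integral>x. \<phi> x *\<^sub>R (g' x $ i) \<partial>lborel)"
      using g(2) g'(2) phi unfolding has_weak_gradient_def by metis
    then show "(\<integral>x. \<phi> x *\<^sub>R (g x $ i - g' x $ i) \<partial>lborel) = 0"
      using integrable_scaleR_L2[OF test_function_L2[OF phi] L(1)] integrable_scaleR_L2[OF test_function_L2[OF phi] L(2)]
      by (simp add: scaleR_diff_right)
  qed
  then have "AE x in lborel. \<forall>i\<in>UNIV. g x $ i - g' x $ i = 0"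
    by (intro AE_finite_allI) auto
  then show ?thesis by eventually_elim (simp add: vec_eq_iff)
qed

lemma weak_gradient_of_H1:
  assumes "H1 u" shows "L2 (weak_gradient u)" "has_weak_gradient u (weak_gradient u)"
proof -
  have "\<exists>g. L2 g \<and> has_weak_gradient u g" using assms by (simp add: H1_def)
  from someI_ex[OF this] show "L2 (weak_gradient u)" "has_weak_gradient u (weak_gradient u)"
    by (simp_all add: weak_gradient_def)
qed

lemma L2_norm_weak_gradient:
  assumes u: "L2 u" and g: "L2 g" "has_weak_gradient u g"
  shows "L2_norm (weak_gradient u) = L2_norm g"
proof -
  have "H1 u" using assms by (auto simp: H1_def)
  note w = weak_gradient_of_H1[OF this]
  note [measurable] = L2_measurable[OF g(1)] L2_measurable[OF w(1)]
  have "AE x in lborel. (norm (weak_gradient u x))\<^sup>2 = (norm (g x))\<^sup>2"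
    using weak_gradient_unique[OF w g] by eventually_elim simp
  then have "(\<integral>x. (norm (weak_gradient u x))\<^sup>2 \<partial>lborel) = (\<integral>x. (norm (g x))\<^sup>2 \<partial>lborel)"
    by (intro integral_cong_AE) measurable
  then show ?thesis by (simp add: L2_norm_def)
qed

section \<open>Minimality of the Gaussian on the Nehari set\<close>

lemma Sigma_spaceD:
  assumes "u \<in> Sigma_space"
  shows "L2 u" "L2 (weak_gradient u)" "has_weak_gradient u (weak_gradient u)"
    "integrable lborel (\<lambda>x. (norm x)\<^sup>2 * (norm (u x))\<^sup>2)"
    "(L2_norm (\<lambda>x. norm x *\<^sub>R u x))\<^sup>2 = (\<integral>x. (norm x)\<^sup>2 * (norm (u x))\<^sup>2 \<partial>lborel)"
proof -
  have H: "H1 u" and X: "L2 (\<lambda>x. norm x *\<^sub>R u x)" using assms by (simp_all add: Sigma_space_def)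
  show "L2 u" using H by (simp add: H1_def)
  show "L2 (weak_gradient u)" "has_weak_gradient u (weak_gradient u)"
    using weak_gradient_of_H1[OF H] by auto
  show "integrable lborel (\<lambda>x. (norm x)\<^sup>2 * (norm (u x))\<^sup>2)"
    using X by (simp add: L2_def power_mult_distrib)
  show "(L2_norm (\<lambda>x. norm x *\<^sub>R u x))\<^sup>2 = (\<integral>x. (norm x)\<^sup>2 * (norm (u x))\<^sup>2 \<partial>lborel)"
    using L2_norm_square[OF X] by (simp add: power_mult_distrib)
qed

text \<open>
  With \<open>G = \<parallel>\<nabla>u\<parallel>\<^sup>2\<close>, \<open>X = \<parallel>xu\<parallel>\<^sup>2\<close> and \<open>ln K = (N/2) ln (\<gamma>/\<pi>)\<close> the logarithmic Sobolev inequality reads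
  \<open>\<integral> f ln f \<le> m ln m + G/\<gamma> - N m + m ln K\<close>. The left hand side is \<open>G + \<gamma>(\<gamma> - 1) X + \<omega> m\<close> on the Nehari set, and
  \<open>\<gamma> - 1\<close> times the oscillator bound is \<open>(\<gamma> - 1) N m \<le> G - G/\<gamma> + \<gamma>(\<gamma> - 1) X\<close>. All gradient terms cancel, leaving
  \<open>\<omega> + \<gamma> N - ln K \<le> ln m\<close>.
\<close>

lemma nehari_mass_lower_bound:
  fixes u :: "real^'n::finite \<Rightarrow> complex"
  assumes \<gamma>: "\<gamma> > 1" and u: "u \<in> nehari_set \<gamma> \<omega>"
  shows "exp (\<omega> + \<gamma> * real CARD('n)) / sqrt (\<gamma> / pi) ^ CARD('n) \<le> (L2_norm u)\<^sup>2"
proof -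
  have S: "u \<in> Sigma_space" and nz: "\<not> (AE x in lborel. u x = 0)" and I: "I_functional \<gamma> \<omega> u = 0"
    using u by (simp_all add: nehari_set_def)
  note D = Sigma_spaceD[OF S]
  note [measurable] = L2_measurable[OF D(1)]
  define f where "f x = (norm (u x))\<^sup>2" for x
  have [measurable]: "f \<in> borel_measurable borel" unfolding f_def by measurable
  have f0: "f x \<ge> 0" for x by (simp add: f_def)
  define m where "m = (\<integral>x. f x \<partial>lborel)"
  define G where "G = (\<integral>x. (norm (weak_gradient u x))\<^sup>2 \<partial>lborel)"
  define X where "X = (\<integral>x. (norm x)\<^sup>2 * f x \<partial>lborel)"
  define N where "N = real CARD('n)"
  define K where "K = sqrt (\<gamma> / pi) ^ CARD('n)"
  have K: "K > 0" using \<gamma> by (simp add: K_def)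
  have a: "\<gamma> > 0" using \<gamma> by simp
  have intf: "integrable lborel f" using D(1) by (simp add: L2_def f_def[abs_def])
  have intX: "integrable lborel (\<lambda>x. (norm x)\<^sup>2 * f x)" using D(4) by (simp add: f_def)
  have "m \<noteq> 0"
  proof
    assume "m = 0"
    then have "AE x in lborel. f x = 0"
      using integral_nonneg_eq_0_iff_AE[OF intf] f0 by (simp add: m_def)
    then have "AE x in lborel. u x = 0" by eventually_elim (simp add: f_def)
    then show False using nz by simp
  qed
  moreover have "m \<ge> 0" unfolding m_def by (intro Bochner_Integration.integral_nonneg) (simp add: f_def)
  ultimately have m: "m > 0" by simp
  define E where "E = (1 / \<gamma>) * G + \<gamma> * X - N * m"
  have bound: "(\<integral>x. V x * f x \<partial>lborel) \<le> (\<integral>x. f x \<partial>lborel) * ln (\<integral>x. exp (V x) * gauss_prod \<gamma> x \<partial>lborel) + E"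
    if "V \<in> borel_measurable borel" "\<And>x. \<bar>V x\<bar> \<le> B" for V B
    using gaussian_log_sobolev_bounded[OF D(1) D(2) a D(3) D(4) that]
    by (simp add: m_def E_def G_def X_def N_def f_def)
  have fm: "f \<in> borel_measurable borel" by measurable
  note entropy = entropy_le_of_variational_bound[OF fm gauss_prod_measurable f0 intf m[unfolded m_def]
      gauss_prod_pos[OF a] gauss_prod_integrable[OF a] gauss_prod_integral[OF a], where E=E, folded m_def]
  have ent_int: "integrable lborel (\<lambda>x. f x * ln (f x / gauss_prod \<gamma> x))"
    by (rule entropy(1)) (rule bound[folded m_def])
  have ent_le: "(\<integral>x. f x * ln (f x / gauss_prod \<gamma> x) \<partial>lborel) \<le> m * ln m + E"
    by (rule entropy(2)) (rule bound[folded m_def])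
  have logf: "f x * ln (f x) = f x * ln (f x / gauss_prod \<gamma> x) + ln K * f x - \<gamma> * ((norm x)\<^sup>2 * f x)" for x
  proof (cases "f x = 0")
    case False
    then have fx: "f x > 0" by (simp add: f_def)
    have "gauss_prod \<gamma> x = K * exp (- \<gamma> * (norm x)\<^sup>2)" by (simp add: gauss_prod_eq K_def)
    then have "ln (gauss_prod \<gamma> x) = ln K - \<gamma> * (norm x)\<^sup>2" using K by (simp add: ln_mult)
    moreover have "ln (f x / gauss_prod \<gamma> x) = ln (f x) - ln (gauss_prod \<gamma> x)"
      using fx gauss_prod_pos[OF a, of x] by (simp add: ln_div)
    ultimately have *: "ln (f x) = ln (f x / gauss_prod \<gamma> x) + ln K - \<gamma> * (norm x)\<^sup>2" by simp
    show ?thesis by (subst *) (simp add: algebra_simps)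
  qed simp
  have "log_integral u = (\<integral>x. f x * ln (f x) \<partial>lborel)" by (simp add: log_integral_def f_def)
  also have "\<dots> = (\<integral>x. f x * ln (f x / gauss_prod \<gamma> x) \<partial>lborel) + ln K * m - \<gamma> * X"
    unfolding logf using ent_int intf intX by (simp add: m_def X_def)
  finally have log_le: "log_integral u \<le> m * ln m + E + ln K * m - \<gamma> * X" using ent_le by simp
  have unc: "N * m \<le> (1 / \<gamma>) * G + \<gamma> * X"
    using harmonic_oscillator_bound[OF D(1) D(2) a D(3) D(4)]
    by (simp add: N_def m_def G_def X_def f_def)
  have Ieq: "G + \<gamma> * (\<gamma> - 1) * X + \<omega> * m = log_integral u"
    using I L2_norm_square[OF D(1)] L2_norm_square[OF D(2)] D(5)
    by (simp add: I_functional_def m_def G_def X_def f_def)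
  have "(\<gamma> - 1) * (N * m) \<le> (\<gamma> - 1) * ((1 / \<gamma>) * G + \<gamma> * X)"
    using unc \<gamma> by (intro mult_left_mono) auto
  also have "\<dots> = G - (1 / \<gamma>) * G + \<gamma> * (\<gamma> - 1) * X" using \<gamma> by (simp add: field_simps)
  finally have "\<gamma> * N * m + \<omega> * m \<le> m * ln m + ln K * m"
    using log_le Ieq by (simp add: E_def algebra_simps)
  then have "m * (\<omega> + \<gamma> * N - ln K) \<le> m * ln m" by (simp add: algebra_simps)
  then have "\<omega> + \<gamma> * N - ln K \<le> ln m" using m by simp
  then have "exp (\<omega> + \<gamma> * N - ln K) \<le> m" using m by (simp add: ln_ge_iff)
  then show ?thesis
    using K L2_norm_square[OF D(1)] by (simp add: exp_diff N_def K_def m_def f_def)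
qed

lemma gaussian_state_eq:
  fixes x :: "real^'n::finite"
  assumes "\<gamma> > 0"
  shows "gaussian_state \<gamma> \<omega> x = complex_of_real
    (exp ((\<omega> + \<gamma> * real CARD('n)) / 2) / sqrt (\<gamma> / 2 / pi) ^ CARD('n) * gauss_prod (\<gamma> / 2) x)"
  using assms by (simp add: gaussian_state_def gauss_prod_eq)

lemma norm_gaussian_state_square:
  fixes x :: "real^'n::finite"
  assumes "\<gamma> > 0"
  shows "(norm (gaussian_state \<gamma> \<omega> x))\<^sup>2
    = exp (\<omega> + \<gamma> * real CARD('n)) / sqrt (\<gamma> / pi) ^ CARD('n) * gauss_prod \<gamma> x"
proof -
  have "(norm (gaussian_state \<gamma> \<omega> x))\<^sup>2 = (exp ((\<omega> + \<gamma> * real CARD('n)) / 2) * exp (- (\<gamma> / 2) * (norm x)\<^sup>2))\<^sup>2"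
    by (simp only: gaussian_state_def norm_of_real power2_abs)
  also have "\<dots> = exp (\<omega> + \<gamma> * real CARD('n)) * exp (- \<gamma> * (norm x)\<^sup>2)"
    by (simp add: power_mult_distrib flip: exp_double)
  finally show ?thesis using assms by (simp add: gauss_prod_eq)
qed

lemma gaussian_state_mass:
  assumes "\<gamma> > 0"
  shows "L2 (gaussian_state \<gamma> \<omega> :: real^'n::finite \<Rightarrow> complex)"
    and "(L2_norm (gaussian_state \<gamma> \<omega> :: real^'n \<Rightarrow> complex))\<^sup>2
      = exp (\<omega> + \<gamma> * real CARD('n)) / sqrt (\<gamma> / pi) ^ CARD('n)"
proof -
  have "(\<lambda>x::real^'n. gaussian_state \<gamma> \<omega> x) \<in> borel_measurable borel"
    unfolding gaussian_state_def by measurable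
  then show L: "L2 (gaussian_state \<gamma> \<omega> :: real^'n \<Rightarrow> complex)"
    using gauss_prod_integrable[OF assms, where 'n='n]
    by (simp add: L2_def norm_gaussian_state_square[OF assms])
  show "(L2_norm (gaussian_state \<gamma> \<omega> :: real^'n \<Rightarrow> complex))\<^sup>2
      = exp (\<omega> + \<gamma> * real CARD('n)) / sqrt (\<gamma> / pi) ^ CARD('n)"
    using gauss_prod_integral[OF assms, where 'n='n]
    by (simp add: L2_norm_square[OF L] norm_gaussian_state_square[OF assms])
qed

text \<open>
  The classical gradient \<open>- \<gamma> x \<phi>(x)\<close> is a weak gradient because the integral of a directional derivative
  of \<open>\<psi> \<phi>\<close> vanishes for every test function \<open>\<psi>\<close>.
\<close>

lemma gaussian_state_weak_gradient:
  fixes \<gamma> \<omega> :: real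
  assumes \<gamma>: "\<gamma> > 0"
  defines "g \<equiv> (\<lambda>x::real^'n::finite. \<chi> i. (- \<gamma> * x $ i) *\<^sub>R gaussian_state \<gamma> \<omega> x)"
  shows "L2 g" and "has_weak_gradient (gaussian_state \<gamma> \<omega>) g"
    and "(norm (g x))\<^sup>2 = \<gamma>\<^sup>2 * ((norm x)\<^sup>2 * (norm (gaussian_state \<gamma> \<omega> x))\<^sup>2)"
proof -
  have norm_g: "(norm (g x))\<^sup>2 = \<gamma>\<^sup>2 * ((norm x)\<^sup>2 * (norm (gaussian_state \<gamma> \<omega> x))\<^sup>2)" for x
  proof -
    have "(norm (g x))\<^sup>2 = (\<Sum>i\<in>UNIV. \<gamma>\<^sup>2 * ((x $ i)\<^sup>2 * (norm (gaussian_state \<gamma> \<omega> x))\<^sup>2))"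
      by (simp add: norm_vec_square g_def power_mult_distrib mult.assoc)
    also have "\<dots> = \<gamma>\<^sup>2 * ((norm x)\<^sup>2 * (norm (gaussian_state \<gamma> \<omega> x))\<^sup>2)"
      by (simp add: norm_vec_square[of x] sum_distrib_left sum_distrib_right)
    finally show ?thesis .
  qed
  then show "(norm (g x))\<^sup>2 = \<gamma>\<^sup>2 * ((norm x)\<^sup>2 * (norm (gaussian_state \<gamma> \<omega> x))\<^sup>2)" .
  have "continuous_on UNIV g"
    unfolding g_def gaussian_state_def by (intro continuous_intros)
  then have "g \<in> borel_measurable borel" by (rule borel_measurable_continuous_onI)
  moreover have "integrable lborel (\<lambda>x. (norm (g x))\<^sup>2)"
  proof -
    have "integrable lborel (\<lambda>x. \<gamma>\<^sup>2 * (exp (\<omega> + \<gamma> * real CARD('n)) / sqrt (\<gamma> / pi) ^ CARD('n))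
        * ((norm x)\<^sup>2 * gauss_prod \<gamma> (x::real^'n)))"
      by (intro Bochner_Integration.integrable_mult_right gauss_prod_moment_integrable \<gamma>)
    then show ?thesis
      by (simp only: norm_g norm_gaussian_state_square[OF \<gamma>] mult_ac)
  qed
  ultimately show "L2 g" by (simp add: L2_def)
  show "has_weak_gradient (gaussian_state \<gamma> \<omega>) g"
    unfolding has_weak_gradient_def
  proof (intro allI impI)
    fix \<phi> :: "real^'n \<Rightarrow> real" and i assume phi: "test_function \<phi>"
    have d: "test_function (partial_deriv i \<phi>)" by (rule test_function_partial_deriv[OF phi])
    define A where "A = exp ((\<omega> + \<gamma> * real CARD('n)) / 2) / sqrt (\<gamma> / 2 / pi) ^ CARD('n)"
    define r where "r x = A * gauss_prod (\<gamma> / 2) x" for x :: "real^'n"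
    have st: "gaussian_state \<gamma> \<omega> x = complex_of_real (r x)" for x :: "real^'n"
      using gaussian_state_eq[OF \<gamma>, of \<omega> x] by (simp add: r_def A_def)
    have rc: "continuous_on UNIV r" unfolding r_def by (intro continuous_intros gauss_prod_continuous)
    have Lr: "L2 r"
      using gaussian_state_mass(1)[OF \<gamma>, of \<omega>, where 'n='n] borel_measurable_continuous_onI[OF rc]
      by (simp add: L2_def st)
    have Lxr: "L2 (\<lambda>x. - \<gamma> * x $ i * r x)"
    proof -
      have "continuous_on UNIV (\<lambda>x. - \<gamma> * x $ i * r x)" by (intro continuous_intros rc)
      from borel_measurable_continuous_onI[OF this] L2_nth[OF \<open>L2 g\<close>, of i]
      show ?thesis by (simp add: L2_def g_def st abs_mult)
    qed
    have i1: "integrable lborel (\<lambda>x. partial_deriv i \<phi> x * r x)"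
      using integrable_scaleR_L2[OF test_function_L2[OF d] Lr] by simp
    have i2: "integrable lborel (\<lambda>x. \<phi> x * (- \<gamma> * x $ i * r x))"
      using integrable_scaleR_L2[OF test_function_L2[OF phi] Lxr] by simp
    have "(\<integral>x. partial_deriv i \<phi> x * r x + \<phi> x * (- \<gamma> * x $ i * r x) \<partial>lborel) = 0"
    proof (rule integral_directional_derivative_eq_0[where F = "\<lambda>x. \<phi> x * r x"])
      show "integrable lborel (\<lambda>x. \<phi> x * r x)"
        using integrable_scaleR_L2[OF test_function_L2[OF phi] Lr] by simp
      show "continuous_on UNIV (\<lambda>x. partial_deriv i \<phi> x * r x + \<phi> x * (- \<gamma> * x $ i * r x))"
        by (intro continuous_intros rc test_function_continuous phi d)
      fix x :: "real^'n" and s :: real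
      have "((\<lambda>s. r (x + s *\<^sub>R axis i 1)) has_real_derivative
          A * (- 2 * (\<gamma> / 2) * (x + s *\<^sub>R axis i 1) $ i * gauss_prod (\<gamma> / 2) (x + s *\<^sub>R axis i 1))) (at s)"
        unfolding r_def by (rule DERIV_cmult[OF gauss_prod_line_derivative])
      then have "((\<lambda>s. r (x + s *\<^sub>R axis i 1)) has_real_derivative
          - \<gamma> * (x + s *\<^sub>R axis i 1) $ i * r (x + s *\<^sub>R axis i 1)) (at s)"
        by (simp add: r_def mult_ac)
      from DERIV_mult[OF partial_derivative_along_line[OF phi] this]
      show "((\<lambda>s. \<phi> (x + s *\<^sub>R axis i 1) * r (x + s *\<^sub>R axis i 1)) has_real_derivative
          partial_deriv i \<phi> (x + s *\<^sub>R axis i 1) * r (x + s *\<^sub>R axis i 1)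
          + \<phi> (x + s *\<^sub>R axis i 1) * (- \<gamma> * (x + s *\<^sub>R axis i 1) $ i * r (x + s *\<^sub>R axis i 1))) (at s)"
        by (simp add: mult.commute)
    qed (use i1 i2 in simp)
    then have "(\<integral>x. partial_deriv i \<phi> x * r x \<partial>lborel) = - (\<integral>x. \<phi> x * (- \<gamma> * x $ i * r x) \<partial>lborel)"
      using i1 i2 by (simp only: Bochner_Integration.integral_add)
    then have "complex_of_real (\<integral>x. partial_deriv i \<phi> x * r x \<partial>lborel)
        = - complex_of_real (\<integral>x. \<phi> x * (- \<gamma> * x $ i * r x) \<partial>lborel)"
      by (simp only: of_real_minus)
    moreover have "partial_deriv i \<phi> x *\<^sub>R gaussian_state \<gamma> \<omega> x = complex_of_real (partial_deriv i \<phi> x * r x)" for x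
      by (simp add: st scaleR_conv_of_real)
    moreover have "\<phi> x *\<^sub>R (g x $ i) = complex_of_real (\<phi> x * (- \<gamma> * x $ i * r x))" for x
      by (simp add: g_def st scaleR_conv_of_real)
    ultimately show "(\<integral>x. partial_deriv i \<phi> x *\<^sub>R gaussian_state \<gamma> \<omega> x \<partial>lborel) = - (\<integral>x. \<phi> x *\<^sub>R (g x $ i) \<partial>lborel)"
      by (simp only: integral_complex_of_real)
  qed
qed

text \<open>
  With \<open>M\<close> the mass of the state, \<open>\<parallel>x\<phi>\<parallel>\<^sup>2 = M N/(2\<gamma>)\<close> and \<open>\<parallel>\<nabla>\<phi>\<parallel>\<^sup>2 = \<gamma>\<^sup>2 \<parallel>x\<phi>\<parallel>\<^sup>2\<close>, while \<open>ln |\<phi>|\<^sup>2 = \<omega> + \<gamma> N - \<gamma> |x|\<^sup>2\<close>.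
  Hence the functional equals \<open>2\<gamma>\<^sup>2 \<parallel>x\<phi>\<parallel>\<^sup>2 - \<gamma> N M = 0\<close>.
\<close>

lemma gaussian_state_in_nehari_set:
  assumes \<gamma>: "\<gamma> > 0"
  shows "(gaussian_state \<gamma> \<omega> :: real^'n::finite \<Rightarrow> complex) \<in> nehari_set \<gamma> \<omega>"
proof -
  let ?u = "gaussian_state \<gamma> \<omega> :: real^'n \<Rightarrow> complex"
  let ?g = "\<lambda>x::real^'n. \<chi> i. (- \<gamma> * x $ i) *\<^sub>R gaussian_state \<gamma> \<omega> x"
  define N where "N = real CARD('n)"
  define M where "M = exp (\<omega> + \<gamma> * N) / sqrt (\<gamma> / pi) ^ CARD('n)"
  have M: "M > 0" using \<gamma> by (simp add: M_def)
  have sq: "(norm (?u x))\<^sup>2 = M * gauss_prod \<gamma> x" for x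
    using norm_gaussian_state_square[OF \<gamma>, of \<omega> x] by (simp add: M_def N_def)
  note L = gaussian_state_mass(1)[OF \<gamma>, of \<omega>, where 'n='n]
  have mass: "(L2_norm ?u)\<^sup>2 = M"
    using gaussian_state_mass(2)[OF \<gamma>, of \<omega>, where 'n='n] by (simp add: M_def N_def)
  note g = gaussian_state_weak_gradient[OF \<gamma>, where \<omega>=\<omega> and 'n='n]
  have moment: "integrable lborel (\<lambda>x::real^'n. (norm x)\<^sup>2 * (norm (?u x))\<^sup>2)"
    "(\<integral>x. (norm x)\<^sup>2 * (norm (?u x))\<^sup>2 \<partial>lborel) = M * (N / (2 * \<gamma>))"
  proof -
    have eq: "(norm x)\<^sup>2 * (norm (?u x))\<^sup>2 = M * ((norm x)\<^sup>2 * gauss_prod \<gamma> x)" for x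
      by (simp add: sq)
    show "integrable lborel (\<lambda>x::real^'n. (norm x)\<^sup>2 * (norm (?u x))\<^sup>2)"
      unfolding eq by (intro Bochner_Integration.integrable_mult_right gauss_prod_moment_integrable \<gamma>)
    show "(\<integral>x. (norm x)\<^sup>2 * (norm (?u x))\<^sup>2 \<partial>lborel) = M * (N / (2 * \<gamma>))"
      unfolding eq using gauss_prod_second_moment[OF \<gamma>, where 'n='n] by (simp add: N_def)
  qed
  have LX: "L2 (\<lambda>x. norm x *\<^sub>R ?u x)"
    using moment(1) L2_measurable[OF L] by (simp add: L2_def power_mult_distrib)
  have S: "?u \<in> Sigma_space"
    using L LX g(1,2) by (auto simp: Sigma_space_def H1_def)
  have X: "(L2_norm (\<lambda>x. norm x *\<^sub>R ?u x))\<^sup>2 = M * (N / (2 * \<gamma>))"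
    using Sigma_spaceD(5)[OF S] moment(2) by simp
  have G: "(L2_norm (weak_gradient ?u))\<^sup>2 = \<gamma>\<^sup>2 * (M * (N / (2 * \<gamma>)))"
  proof -
    have "(L2_norm (weak_gradient ?u))\<^sup>2 = (\<integral>x. (norm (?g x))\<^sup>2 \<partial>lborel)"
      using L2_norm_weak_gradient[OF L g(1,2)] L2_norm_square[OF g(1)] by (simp only:)
    also have "\<dots> = (\<integral>x. \<gamma>\<^sup>2 * ((norm x)\<^sup>2 * (norm (?u x))\<^sup>2) \<partial>lborel)"
      by (simp only: g(3))
    also have "\<dots> = \<gamma>\<^sup>2 * (M * (N / (2 * \<gamma>)))"
      unfolding moment(2)[symmetric] by (rule Bochner_Integration.integral_mult_right_zero)
    finally show ?thesis .
  qed
  have log: "log_integral ?u = (\<omega> + \<gamma> * N) * M - \<gamma> * (M * (N / (2 * \<gamma>)))"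
  proof -
    have e: "(norm (?u x))\<^sup>2 * ln ((norm (?u x))\<^sup>2)
        = (\<omega> + \<gamma> * N) * (norm (?u x))\<^sup>2 - \<gamma> * ((norm x)\<^sup>2 * (norm (?u x))\<^sup>2)" for x
    proof -
      have "(norm (?u x))\<^sup>2 = exp (\<omega> + \<gamma> * N - \<gamma> * (norm x)\<^sup>2)"
        using \<gamma> by (simp add: sq M_def gauss_prod_eq exp_diff exp_minus field_simps)
      then have "ln ((norm (?u x))\<^sup>2) = \<omega> + \<gamma> * N - \<gamma> * (norm x)\<^sup>2" by (simp only: ln_exp)
      then show ?thesis by (simp only:) (simp add: algebra_simps)
    qed
    have "integrable lborel (\<lambda>x. (norm (?u x))\<^sup>2)" using L by (simp add: L2_def)
    then show ?thesis
      unfolding log_integral_def e using moment mass L2_norm_square[OF L] by simp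
  qed
  have "I_functional \<gamma> \<omega> ?u = 0"
    unfolding I_functional_def G X mass log using \<gamma> by (simp add: field_simps power2_eq_square)
  moreover have "\<not> (AE x in lborel. ?u x = 0)"
  proof
    assume "AE x in lborel. ?u x = 0"
    then have "(\<integral>x. (norm (?u x))\<^sup>2 \<partial>lborel) = 0" by (intro integral_eq_zero_AE) auto
    then show False using mass M L2_norm_square[OF L] by simp
  qed
  ultimately show ?thesis using S by (simp add: nehari_set_def)
qed

theorem lemma4p2:
  fixes \<gamma> \<omega> :: real
  assumes "\<gamma> > 1"
  shows "d_level TYPE('n::finite) \<gamma> \<omega>
           = ereal (1/2 * (L2_norm (gaussian_state \<gamma> \<omega> :: real^'n \<Rightarrow> complex))\<^sup>2)
       \<and> 1/2 * (L2_norm (gaussian_state \<gamma> \<omega> :: real^'n \<Rightarrow> complex))\<^sup>2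
           = 1/2 * pi powr (real CARD('n) / 2) * \<gamma> powr (- (real CARD('n) / 2))
               * exp (\<omega> + \<gamma> * real CARD('n))"
proof
  let ?u = "gaussian_state \<gamma> \<omega> :: real^'n \<Rightarrow> complex"
  let ?N = "real CARD('n)"
  have pos: "\<gamma> > 0" using assms by simp
  have S: "S_functional \<gamma> \<omega> w = 1/2 * (L2_norm w)\<^sup>2" if "w \<in> nehari_set \<gamma> \<omega>" for w :: "real^'n \<Rightarrow> complex"
    using that by (simp add: S_functional_eq nehari_set_def)
  note nehari = gaussian_state_in_nehari_set[OF pos, of \<omega>, where 'n='n]
  show "d_level TYPE('n) \<gamma> \<omega> = ereal (1/2 * (L2_norm ?u)\<^sup>2)"
    unfolding d_level_def
  proof (rule antisym)
    show "(INF w\<in>nehari_set \<gamma> \<omega>. ereal (S_functional \<gamma> \<omega> (w :: real^'n \<Rightarrow> complex))) \<le> ereal (1/2 * (L2_norm ?u)\<^sup>2)"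
      using INF_lower[OF nehari, of "\<lambda>w. ereal (S_functional \<gamma> \<omega> w)"] S[OF nehari] by simp
    show "ereal (1/2 * (L2_norm ?u)\<^sup>2) \<le> (INF w\<in>nehari_set \<gamma> \<omega>. ereal (S_functional \<gamma> \<omega> (w :: real^'n \<Rightarrow> complex)))"
    proof (rule INF_greatest)
      fix w :: "real^'n \<Rightarrow> complex" assume w: "w \<in> nehari_set \<gamma> \<omega>"
      show "ereal (1/2 * (L2_norm ?u)\<^sup>2) \<le> ereal (S_functional \<gamma> \<omega> w)"
        using nehari_mass_lower_bound[OF assms w] gaussian_state_mass(2)[OF pos, of \<omega>, where 'n='n] S[OF w]
        by simp
    qed
  qed
  have "sqrt (\<gamma> / pi) ^ CARD('n) = (\<gamma> / pi) powr (?N / 2)"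
    using pos by (simp add: powr_realpow[symmetric] powr_half_sqrt[symmetric] powr_powr)
  also have "\<dots> = \<gamma> powr (?N / 2) / pi powr (?N / 2)"
    using pos by (simp add: powr_divide)
  finally have "(L2_norm ?u)\<^sup>2 = exp (\<omega> + \<gamma> * ?N) / (\<gamma> powr (?N / 2) / pi powr (?N / 2))"
    using gaussian_state_mass(2)[OF pos, of \<omega>, where 'n='n] by (simp only:)
  then show "1/2 * (L2_norm ?u)\<^sup>2
           = 1/2 * pi powr (?N / 2) * \<gamma> powr (- (?N / 2)) * exp (\<omega> + \<gamma> * ?N)"
    by (simp add: powr_minus field_simps)
qed

end
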